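(* Let $\zeta\in NBV([0,1];\mathbb R^{n\times n})$, $Y=B([-1,0];\mathbb R^n)$ and $Y^\diamond=NBV([0,1];\mathbb R^n)$ with pairing $\langle y^\diamond,y\rangle=\int_{[0,1]}dy^\diamond(\sigma)\cdot y(-\sigma)$. Let $\{S(t)\}_{t\ge0}$ be the twin semigroup $(S(t)\varphi)(\theta)=x(t+\theta;\varphi)$, where $x(\cdot;\varphi)$ solves $\dot x(t)=\int_{[0,1]}d\zeta(\sigma)x(t-\sigma)$ for $t\ge0$ with $x=\varphi\in Y$ on $[-1,0]$. Then the generator of $\{S(t)\}_{t\ge0}$ is the multi-valued operator $C$ on $Y$ defined by $\mathcal D(C)=\mathrm{Lip}([-1,0];\mathbb R^n)$ and $$C\psi=\Bigl\{\psi'\in Y\ :\ \psi(\theta)=\psi(-1)+\int_{-1}^\theta\psi'(\sigma)\,d\sigma\ \ (-1\le\theta\le0),\quad \psi'(0)=\int_{[0,1]}d\zeta(\sigma)\,\psi(-\sigma)\Bigr\}.$$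
   Context: $B([-1,0];\mathbb R^n)$: bounded Borel functions (not equivalence classes) with the supremum norm. $NBV([0,1])$: functions $f$ of bounded variation on $[0,1]$ with $f(0)=0$, right-continuous on $(0,1)$, with total variation norm; $df$ is the measure on $[0,1]$ with $df([0,t])=f(t)$ for $0<t\le1$. $\mathrm{Lip}$: Lipschitz continuous functions. The solution $x(\cdot;\varphi)$ is the unique locally bounded Borel function on $[-1,\infty)$ with $x=\varphi$ on $[-1,0]$ and $x(t)=\varphi(0)+\int_0^t\int_{[0,1]}d\zeta(\sigma)x(s-\sigma)\,ds$ for $t\ge0$. $\{S(t)\}$ is a twin semigroup: each $S(t)$ is a bounded operator on $Y$ whose adjoint leaves (the embedding of) $Y^\diamond$ invariant; $S(0)=I$, $S(t+s)=S(t)S(s)$; there are $M\ge1,\omega\in\mathbb R$ with $|\langle y^\diamond,S(t)y\rangle|\le Me^{\omega t}\|y\|\|y^\diamond\|$; $t\mapsto\langle y^\diamond,S(t)y\rangle$ is measurable; and for $\operatorname{Re}\lambda>\omega$ there is a bounded operator $\overline S(\lambda)$ on (the complexification of) $Y$ whose adjoint leaves $Y^\diamond$ invariant and such that $\langle y^\diamond,\overline S(\lambda)y\rangle=\int_0^\infty e^{-\lambda t}\langle y^\diamond,S(t)y\rangle\,dt$. The generator is the (possibly multi-valued) linear operator $C$ on $Y$ with $(\lambda I-C)^{-1}=\overline S(\lambda)$, i.e. $y\in\mathcal D(C)$ and $z\in Cy$ iff $y=\overline S(\lambda)(\lambda y-z)$; it does not depend on $\lambda$ with $\operatorname{Re}\lambda>\omega$.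 *)

theory Defs
  imports "HOL-Analysis.Analysis"
begin

text \<open>An element is a function on the closed interval from -1 to 0, stored as a total function
  that is 0 elsewhere, so that equality in the type is equality at every point of the interval
  (no almost-everywhere identification).\<close>

typedef (overloaded) ('a::euclidean_space) bborel =
  "{f :: real \<Rightarrow> 'a. f \<in> borel_measurable borel \<and> bounded (range f) \<and> (\<forall>\<theta>. \<theta> \<notin> {-1..0} \<longrightarrow> f \<theta> = 0)}"
  morphisms fn Abs_bborel
  by (rule exI[of _ "\<lambda>_. 0"]) (auto simp: bounded_iff)

setup_lifting type_definition_bborel

text \<open>The element with the values of g on the interval; meaningful when g is Borel and bounded
  there, see \<open>fn_bborel_of\<close>.\<close>

definition bborel_of :: "(real \<Rightarrow> 'a::euclidean_space) \<Rightarrow> 'a bborel" where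
  "bborel_of g = Abs_bborel (\<lambda>\<theta>. if \<theta> \<in> {-1..0} then g \<theta> else 0)"

lemma fn_bborel_of:
  fixes g :: "real \<Rightarrow> 'a::euclidean_space"
  assumes "g \<in> borel_measurable (restrict_space borel {-1..0})" "bounded (g ` {-1..0})"
  shows "fn (bborel_of g) = (\<lambda>\<theta>. if \<theta> \<in> {-1..0} then g \<theta> else 0)"
proof -
  let ?h = "\<lambda>\<theta>::real. if \<theta> \<in> {-1..0} then g \<theta> else 0"
  have "?h \<in> borel_measurable borel"
    using assms(1) by (subst (asm) measurable_restrict_space_iff[where c = 0]) auto
  moreover have "bounded (range ?h)"
    by (rule bounded_subset[of "insert 0 (g ` {-1..0})"]) (use assms(2) in auto)
  ultimately show ?thesis
    unfolding bborel_of_def by (subst Abs_bborel_inverse) auto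
qed

lemma bounded_fn: "bounded (range (fn y))"
  and measurable_fn [measurable]: "fn y \<in> borel_measurable borel"
  and fn_outside: "\<theta> \<notin> {-1..0} \<Longrightarrow> fn y \<theta> = 0"
  using fn[of y] by auto

lemma bdd_above_fn: "bdd_above ((\<lambda>\<theta>. norm (fn y \<theta>)) ` A)"
proof -
  obtain B where "\<And>\<theta>. norm (fn y \<theta>) \<le> B"
    using bounded_fn[of y] by (auto simp: bounded_iff)
  then show ?thesis by (auto intro!: bdd_aboveI[of _ B])
qed

instantiation bborel :: (euclidean_space) real_vector
begin

lift_definition zero_bborel :: "'a bborel" is "\<lambda>_. 0"
  by (auto simp: bounded_iff)

lift_definition plus_bborel :: "'a bborel \<Rightarrow> 'a bborel \<Rightarrow> 'a bborel" is "\<lambda>f g \<theta>. f \<theta> + g \<theta>"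
  by (auto simp: bounded_plus_comp)

lift_definition uminus_bborel :: "'a bborel \<Rightarrow> 'a bborel" is "\<lambda>f \<theta>. - f \<theta>"
  by (auto simp: bounded_iff)

lift_definition minus_bborel :: "'a bborel \<Rightarrow> 'a bborel \<Rightarrow> 'a bborel" is "\<lambda>f g \<theta>. f \<theta> - g \<theta>"
  by (auto simp: bounded_minus_comp)

lift_definition scaleR_bborel :: "real \<Rightarrow> 'a bborel \<Rightarrow> 'a bborel" is "\<lambda>r f \<theta>. r *\<^sub>R f \<theta>"
  by (auto simp: bounded_scaleR_comp)

instance
  by standard (transfer; auto simp: algebra_simps)+

end

instantiation bborel :: (euclidean_space) real_normed_vector
begin

definition norm_bborel :: "'a bborel \<Rightarrow> real" where
  "norm_bborel y = (SUP \<theta>\<in>{-1..0}. norm (fn y \<theta>))"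

definition dist_bborel :: "'a bborel \<Rightarrow> 'a bborel \<Rightarrow> real" where
  "dist_bborel y z = norm (y - z)"

definition sgn_bborel :: "'a bborel \<Rightarrow> 'a bborel" where
  "sgn_bborel y = inverse (norm y) *\<^sub>R y"

definition uniformity_bborel :: "('a bborel \<times> 'a bborel) filter" where
  "uniformity_bborel = (INF e\<in>{0<..}. principal {(x, y). dist x y < e})"

definition open_bborel :: "'a bborel set \<Rightarrow> bool" where
  "open_bborel U = (\<forall>x\<in>U. eventually (\<lambda>(x', y). x' = x \<longrightarrow> y \<in> U) uniformity)"

instance
proof
  fix x y :: "'a bborel" and r :: real
  have le: "norm (fn z \<theta>) \<le> norm z" if "\<theta> \<in> {-1..0}" for z :: "'a bborel" and \<theta>
    unfolding norm_bborel_def using that by (intro cSUP_upper bdd_above_fn)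
  have leI: "norm z \<le> B" if "\<And>\<theta>. \<theta> \<in> {-1..0} \<Longrightarrow> norm (fn z \<theta>) \<le> B" for z :: "'a bborel" and B
    unfolding norm_bborel_def using that by (intro cSUP_least) auto
  have pos: "0 \<le> norm z" for z :: "'a bborel"
    by (rule order_trans[OF norm_ge_zero le[of 0]]) simp
  show "dist x y = norm (x - y)" by (fact dist_bborel_def)
  show "sgn x = x /\<^sub>R norm x" by (fact sgn_bborel_def)
  show "(uniformity :: ('a bborel \<times> 'a bborel) filter) = (INF e\<in>{0<..}. principal {(x, y). dist x y < e})"
    by (fact uniformity_bborel_def)
  show "open U = (\<forall>x\<in>U. eventually (\<lambda>(x', y). x' = x \<longrightarrow> y \<in> U) uniformity)" for U :: "'a bborel set"
    by (fact open_bborel_def)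
  show "norm x = 0 \<longleftrightarrow> x = 0"
  proof
    assume "norm x = 0"
    then have "fn x \<theta> = 0" for \<theta>
      using le[of \<theta> x] fn_outside[of \<theta> x] by (cases "\<theta> \<in> {-1..0}") auto
    then show "x = 0"
      by (intro fn_inject[THEN iffD1] ext) (simp add: zero_bborel.rep_eq)
  next
    assume "x = 0"
    then show "norm x = 0"
      using leI[of x 0] pos[of x] by (simp add: zero_bborel.rep_eq)
  qed
  show "norm (x + y) \<le> norm x + norm y"
    by (rule leI) (auto simp: plus_bborel.rep_eq intro!: norm_triangle_mono le)
  have sc: "norm (r *\<^sub>R z) \<le> \<bar>r\<bar> * norm z" for r and z :: "'a bborel"
    by (rule leI) (auto simp: scaleR_bborel.rep_eq intro!: mult_left_mono le)
  have "\<bar>r\<bar> * norm x \<le> norm (r *\<^sub>R x)"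
  proof (cases "r = 0")
    case False
    then show ?thesis
      using sc[of "inverse r" "r *\<^sub>R x"] by (simp add: field_simps)
  qed (simp add: pos)
  with sc[of r x] show "norm (r *\<^sub>R x) = \<bar>r\<bar> * norm x" by simp
qed

end

text \<open>The complexification of the space of functions with values in \<open>real ^ 'n\<close> is the space of
  functions with values in \<open>complex ^ 'n\<close>.\<close>

definition cvec :: "real ^ 'n \<Rightarrow> complex ^ 'n" where
  "cvec v = (\<chi> k. complex_of_real (v $ k))"

definition cfn :: "(real ^ 'n) bborel \<Rightarrow> (complex ^ 'n) bborel" where
  "cfn y = bborel_of (\<lambda>\<theta>. cvec (fn y \<theta>))"

definition scaleC :: "complex \<Rightarrow> (complex ^ 'n) bborel \<Rightarrow> (complex ^ 'n) bborel" where
  "scaleC c y = bborel_of (\<lambda>\<theta>. c *s fn y \<theta>)"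

lemma fn_cfn: "fn (cfn y) \<theta> = cvec (fn y \<theta>)"
proof -
  have lin: "bounded_linear (cvec :: real ^ 'n \<Rightarrow> complex ^ 'n)"
    by (intro linear_conv_bounded_linear[THEN iffD1] linearI)
       (simp_all add: cvec_def vec_eq_iff complex_eq_iff)
  have "(\<lambda>\<theta>. cvec (fn y \<theta>)) \<in> borel_measurable borel"
    by (rule measurable_compose[OF measurable_fn])
       (intro borel_measurable_continuous_onI linear_continuous_on lin)
  then have m: "(\<lambda>\<theta>. cvec (fn y \<theta>)) \<in> borel_measurable (restrict_space borel {-1..0})"
    by (rule measurable_restrict_space1)
  have "bounded (cvec ` range (fn y))"
    by (rule bounded_linear_image[OF bounded_fn lin])
  then have "bounded ((\<lambda>\<theta>. cvec (fn y \<theta>)) ` {-1..0})"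
    by (rule bounded_subset) auto
  from fn_bborel_of[OF m this] show ?thesis
    using fn_outside[of \<theta> y] by (auto simp: cfn_def cvec_def vec_eq_iff)
qed

lemma fn_scaleC: "fn (scaleC c y) \<theta> = c *s fn y \<theta>"
proof -
  have lin: "bounded_linear (\<lambda>v :: complex ^ 'n. c *s v)"
    by (intro linear_conv_bounded_linear[THEN iffD1] linearI)
       (auto simp: vec_eq_iff algebra_simps)
  have "(\<lambda>\<theta>. c *s fn y \<theta>) \<in> borel_measurable borel"
    by (rule measurable_compose[OF measurable_fn])
       (intro borel_measurable_continuous_onI linear_continuous_on lin)
  then have m: "(\<lambda>\<theta>. c *s fn y \<theta>) \<in> borel_measurable (restrict_space borel {-1..0})"
    by (rule measurable_restrict_space1)
  have "bounded ((\<lambda>v. c *s v) ` range (fn y))"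
    by (rule bounded_linear_image[OF bounded_fn lin])
  then have "bounded ((\<lambda>\<theta>. c *s fn y \<theta>) ` {-1..0})"
    by (rule bounded_subset) auto
  from fn_bborel_of[OF m this] show ?thesis
    using fn_outside[of \<theta> y] by (auto simp: scaleC_def vec_eq_iff)
qed

text \<open>Values of f outside the unit interval play no role in what follows.\<close>

definition variation_sums :: "(real \<Rightarrow> 'a::real_normed_vector) \<Rightarrow> real set" where
  "variation_sums f = {\<Sum>i<k. norm (f (p (Suc i)) - f (p i)) | (k::nat) p.
     (\<forall>i\<le>k. p i \<in> {0..1}) \<and> (\<forall>i<k. p i \<le> p (Suc i))}"

definition total_variation :: "(real \<Rightarrow> 'a::real_normed_vector) \<Rightarrow> real" where
  "total_variation f = Sup (variation_sums f)"

definition NBV :: "(real \<Rightarrow> 'a::real_normed_vector) set" where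
  "NBV = {f. bdd_above (variation_sums f) \<and> f 0 = 0 \<and>
             (\<forall>t\<in>{0<..<1}. continuous (at_right t) f)}"

text \<open>The finite signed measure df of a scalar f is represented by a pair of finite positive Borel
  measures on the unit interval whose difference it is; f may have a right limit other than
  \<open>f 0 = 0\<close> at 0, in which case df has an atom there. For f in \<open>NBV\<close> such a pair exists, and
  the integral of a bounded Borel function does not depend on the pair.\<close>

definition signed_measure_pair :: "(real \<Rightarrow> real) \<Rightarrow> real measure \<times> real measure \<Rightarrow> bool" where
  "signed_measure_pair f = (\<lambda>(\<mu>, \<nu>).
     finite_measure \<mu> \<and> sets \<mu> = sets (restrict_space borel {0..1}) \<and>
     finite_measure \<nu> \<and> sets \<nu> = sets (restrict_space borel {0..1}) \<and>
     (\<forall>t. 0 < t \<and> t \<le> 1 \<longrightarrow> measure \<mu> {0..t} - measure \<nu> {0..t} = f t))"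

definition scalar_stieltjes ::
    "(real \<Rightarrow> real) \<Rightarrow> (real \<Rightarrow> 'c::{banach, second_countable_topology}) \<Rightarrow> 'c" where
  "scalar_stieltjes f g =
     (let (\<mu>, \<nu>) = (SOME m. signed_measure_pair f m)
      in integral\<^sup>L \<mu> g - integral\<^sup>L \<nu> g)"

text \<open>The integral of \<open>prd (df(\<sigma>)) (g(\<sigma>))\<close> over the unit interval for vector- or matrix-valued f
  and a bilinear product \<open>prd\<close>, obtained by expanding f in coordinates.\<close>

definition stieltjes ::
    "('a \<Rightarrow> 'b \<Rightarrow> 'c::{banach, second_countable_topology}) \<Rightarrow>
     (real \<Rightarrow> 'a::euclidean_space) \<Rightarrow> (real \<Rightarrow> 'b) \<Rightarrow> 'c" where
  "stieltjes prd f g = (\<Sum>b\<in>Basis. scalar_stieltjes (\<lambda>\<sigma>. f \<sigma> \<bullet> b) (\<lambda>\<sigma>. prd b (g \<sigma>)))"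

definition pairing :: "(real \<Rightarrow> real ^ 'n) \<Rightarrow> (real ^ 'n) bborel \<Rightarrow> real" where
  "pairing f y = stieltjes (\<bullet>) f (\<lambda>\<sigma>. fn y (- \<sigma>))"

text \<open>The complex pairing is bilinear: no conjugation.\<close>

definition cpairing :: "(real \<Rightarrow> complex ^ 'n) \<Rightarrow> (complex ^ 'n) bborel \<Rightarrow> complex" where
  "cpairing f y = stieltjes (\<lambda>u v. \<Sum>k\<in>UNIV. u $ k * v $ k) f (\<lambda>\<sigma>. fn y (- \<sigma>))"

text \<open>\<open>R\<close> is the operator written S with a bar, at the point \<open>lam\<close>. The defining identity is stated
  for real arguments; it extends to complex ones by complex linearity.\<close>

definition laplace_operator ::
    "(real \<Rightarrow> (real ^ 'n) bborel \<Rightarrow> (real ^ 'n) bborel) \<Rightarrow> complex \<Rightarrow>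
     ((complex ^ 'n) bborel \<Rightarrow> (complex ^ 'n) bborel) \<Rightarrow> bool" where
  "laplace_operator S lam R \<longleftrightarrow>
     bounded_linear R \<and> (\<forall>c y. R (scaleC c y) = scaleC c (R y)) \<and>
     (\<forall>f\<in>NBV. \<exists>g\<in>NBV. \<forall>y. cpairing f (R y) = cpairing g y) \<and>
     (\<forall>f\<in>NBV. \<forall>y. cpairing (\<lambda>\<sigma>. cvec (f \<sigma>)) (R (cfn y)) =
        (LBINT t:{0..}. exp (- lam * complex_of_real t) * complex_of_real (pairing f (S t y))))"

definition twin_semigroup_with ::
    "(real \<Rightarrow> (real ^ 'n) bborel \<Rightarrow> (real ^ 'n) bborel) \<Rightarrow> real \<Rightarrow> real \<Rightarrow> bool" where
  "twin_semigroup_with S M \<omega> \<longleftrightarrow>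
     1 \<le> M \<and>
     (\<forall>t\<ge>0. bounded_linear (S t) \<and>
        (\<forall>f\<in>NBV. \<exists>g\<in>NBV. \<forall>y. pairing f (S t y) = pairing g y)) \<and>
     (\<forall>y. S 0 y = y) \<and>
     (\<forall>t\<ge>0. \<forall>s\<ge>0. \<forall>y. S (t + s) y = S t (S s y)) \<and>
     (\<forall>t\<ge>0. \<forall>f\<in>NBV. \<forall>y.
        \<bar>pairing f (S t y)\<bar> \<le> M * exp (\<omega> * t) * norm y * total_variation f) \<and>
     (\<forall>f\<in>NBV. \<forall>y. (\<lambda>t. pairing f (S t y)) \<in> borel_measurable (restrict_space borel {0..})) \<and>
     (\<forall>lam. \<omega> < Re lam \<longrightarrow> (\<exists>R. laplace_operator S lam R))"

definition twin_semigroup ::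
    "(real \<Rightarrow> (real ^ 'n) bborel \<Rightarrow> (real ^ 'n) bborel) \<Rightarrow> bool" where
  "twin_semigroup S \<longleftrightarrow> (\<exists>M \<omega>. twin_semigroup_with S M \<omega>)"

text \<open>Multi-valued operators are given by their graphs. The defining relation is required at every
  admissible \<open>lam\<close>, so independence of \<open>lam\<close> is part of the notion.\<close>

definition is_generator ::
    "(real \<Rightarrow> (real ^ 'n) bborel \<Rightarrow> (real ^ 'n) bborel) \<Rightarrow>
     ((real ^ 'n) bborel \<times> (real ^ 'n) bborel) set \<Rightarrow> bool" where
  "is_generator S C \<longleftrightarrow>
     twin_semigroup S \<and>
     (\<forall>M \<omega> lam R. twin_semigroup_with S M \<omega> \<and> \<omega> < Re lam \<and> laplace_operator S lam R \<longrightarrow>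
        (\<forall>y z. (y, z) \<in> C \<longleftrightarrow> cfn y = R (scaleC lam (cfn y) - cfn z)))"

text \<open>Solutions live on the half-line from -1; they are stored as 0 to the left of -1.\<close>

definition delay_solution ::
    "(real \<Rightarrow> real ^ 'n ^ 'n) \<Rightarrow> (real ^ 'n) bborel \<Rightarrow> (real \<Rightarrow> real ^ 'n) \<Rightarrow> bool" where
  "delay_solution \<zeta> \<phi> x \<longleftrightarrow>
     x \<in> borel_measurable borel \<and> (\<forall>T. bounded (x ` {-1..T})) \<and> (\<forall>t. t < -1 \<longrightarrow> x t = 0) \<and>
     (\<forall>\<theta>\<in>{-1..0}. x \<theta> = fn \<phi> \<theta>) \<and>
     (\<forall>t\<ge>0. x t = fn \<phi> 0 + (LBINT s:{0..t}. stieltjes (*v) \<zeta> (\<lambda>\<sigma>. x (s - \<sigma>))))"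

definition the_solution ::
    "(real \<Rightarrow> real ^ 'n ^ 'n) \<Rightarrow> (real ^ 'n) bborel \<Rightarrow> real \<Rightarrow> real ^ 'n" where
  "the_solution \<zeta> \<phi> = (THE x. delay_solution \<zeta> \<phi> x)"

definition delay_semigroup ::
    "(real \<Rightarrow> real ^ 'n ^ 'n) \<Rightarrow> real \<Rightarrow> (real ^ 'n) bborel \<Rightarrow> (real ^ 'n) bborel" where
  "delay_semigroup \<zeta> t \<phi> = bborel_of (\<lambda>\<theta>. the_solution \<zeta> \<phi> (t + \<theta>))"

definition Lip :: "(real ^ 'n) bborel set" where
  "Lip = {\<psi>. \<exists>L. L-lipschitz_on {-1..0} (fn \<psi>)}"

definition delay_operator ::
    "(real \<Rightarrow> real ^ 'n ^ 'n) \<Rightarrow> ((real ^ 'n) bborel \<times> (real ^ 'n) bborel) set" where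
  "delay_operator \<zeta> = {(\<psi>, \<psi>'). \<psi> \<in> Lip \<and>
     (\<forall>\<theta>\<in>{-1..0}. fn \<psi> \<theta> = fn \<psi> (-1) + (LBINT \<sigma>:{-1..\<theta>}. fn \<psi>' \<sigma>)) \<and>
     fn \<psi>' 0 = stieltjes (*v) \<zeta> (\<lambda>\<sigma>. fn \<psi> (- \<sigma>))}"

end

theory Submission
  imports Defs
begin

text \<open>
  Write \<open>u\<close> and \<open>v\<close> for the solutions of the delay equation with initial
  segments \<open>\<psi>\<close> and \<open>\<psi>'\<close>. Pairing with the elements of \<open>NBV\<close> that represent point evaluations
  (\<open>point_evaluation\<close>) turns the weak definition of the Laplace transformed semigroup into a
  pointwise one: the equation \<open>\<psi> = R (\<lambda> \<psi> - \<psi>')\<close> says that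
  \<open>\<psi>(\<theta>) = \<integral>\<^sub>0\<^sup>\<infinity> exp(- \<lambda> t) (\<lambda> u(t + \<theta>) - v(t + \<theta>)) dt\<close> for every \<open>\<theta>\<close> in the interval from -1 to 0
  (\<open>resolvent_equation_iff\<close>).

  If \<open>\<psi>'\<close> belongs to \<open>C \<psi>\<close>, then \<open>u(t) = \<psi>(-1) + \<integral> v\<close> over the interval from -1 to t: by Fubini, and by
  the boundary condition at 0, the right-hand side solves the delay equation with initial segment
  \<open>\<psi>\<close> (\<open>delay_operator_primitive\<close>), and solutions are unique. Integration by parts then gives the
  displayed equation (\<open>laplace_derivative\<close>).

  Conversely, multiply the displayed equation by \<open>exp(- \<lambda> \<theta>)\<close>. It becomes a tail integral, so
  \<open>exp(- \<lambda> \<theta>) \<psi>(\<theta>)\<close> is a primitive of \<open>exp(- \<lambda> \<theta>) (\<psi>' - \<lambda> \<psi>)\<close>; a second integration by parts, now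
  with exponent \<open>- \<lambda>\<close>, shows that \<open>\<psi>\<close> is a primitive of \<open>\<psi>'\<close>, hence Lipschitz
  (\<open>resolvent_primitive\<close>). For the boundary condition, take Laplace transforms of the delay
  equations for \<open>u\<close> and \<open>v\<close>, exchange them with the Stieltjes integral, and eliminate
  (\<open>resolvent_boundary_condition\<close>).

  It remains to see that the solution operators form a twin semigroup. The solution is the sum of the
  Picard series, whose terms halve in an exponentially weighted norm (\<open>evolve_halves\<close>). Each point
  value of the solution, and of its Laplace transform, is a linear functional of the initial segment
  which is continuous under bounded pointwise convergence. Such functionals are exactly those given by
  functions of bounded variation: \<open>t \<mapsto> L(1\<^bsub>[0,t]\<^esub>)\<close> has bounded variation and represents \<open>L\<close>
  (\<open>sigma_functional_representation\<close>). Hence adjoints leave \<open>NBV\<close> invariant, and no measure has to be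
  transported along the semigroup.

  Finally, each coordinate of a function \<open>\<psi>\<close> with Lipschitz constant \<open>L\<close> is the primitive of a bounded
  Borel function: with \<open>f\<close> the coordinate, take the Radon-Nikodym density of the measure that belongs to
  the increasing function \<open>f(\<theta>) + L \<theta>\<close> and subtract \<open>L\<close>. Redefining the densities at the single point 0
  makes them satisfy the boundary condition, so that the domain is all of \<open>Lip\<close>.
\<close>

section \<open>Functionals continuous under bounded convergence\<close>

text \<open>Integrands are functions on the whole line, required to be bounded on the unit interval only:
  delayed solutions \<open>\<sigma> \<mapsto> x(s - \<sigma>)\<close> are of this kind, and may be unbounded
  far to the left of 0.\<close>

definition bounded_borel :: "(real \<Rightarrow> 'a::euclidean_space) \<Rightarrow> bool" where
  "bounded_borel g \<longleftrightarrow> g \<in> borel_measurable borel \<and> (\<exists>B. \<forall>\<sigma>\<in>{0..1}. norm (g \<sigma>) \<le> B)"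

lemma bounded_borelI:
  assumes "g \<in> borel_measurable borel" "\<And>\<sigma>. \<sigma> \<in> {0..1} \<Longrightarrow> norm (g \<sigma>) \<le> B"
  shows "bounded_borel g"
  using assms unfolding bounded_borel_def by blast

lemma bounded_borel_zero [simp]: "bounded_borel (\<lambda>_. 0)"
  by (rule bounded_borelI[of _ 0]) auto

lemma bounded_borel_measurable: "bounded_borel g \<Longrightarrow> g \<in> borel_measurable borel"
  by (simp add: bounded_borel_def)

lemma bounded_borelE:
  assumes "bounded_borel g"
  obtains B where "0 \<le> B" "\<And>\<sigma>. \<sigma> \<in> {0..1} \<Longrightarrow> norm (g \<sigma>) \<le> B"
proof -
  obtain B where "\<forall>\<sigma>\<in>{0..1}. norm (g \<sigma>) \<le> B" using assms by (auto simp: bounded_borel_def)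
  then show ?thesis by (intro that[of "max 0 B"]) (auto simp: le_max_iff_disj)
qed

lemma bounded_borel_linear:
  assumes "bounded_linear T" "bounded_borel g"
  shows "bounded_borel (\<lambda>\<sigma>. T (g \<sigma>))"
proof -
  interpret bounded_linear T by fact
  obtain B where B: "0 \<le> B" "\<And>\<sigma>. \<sigma> \<in> {0..1} \<Longrightarrow> norm (g \<sigma>) \<le> B"
    using assms(2) by (rule bounded_borelE) blast
  obtain K where K: "0 \<le> K" "\<And>x. norm (T x) \<le> norm x * K" using nonneg_bounded by auto
  have "T \<in> borel_measurable borel"
    by (intro borel_measurable_continuous_onI linear_continuous_on assms)
  then have "(\<lambda>\<sigma>. T (g \<sigma>)) \<in> borel_measurable borel"
    using bounded_borel_measurable[OF assms(2)] by simp
  moreover have "norm (T (g \<sigma>)) \<le> B * K" if "\<sigma> \<in> {0..1}" for \<sigma>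
    using K(2)[of "g \<sigma>"] mult_right_mono[OF B(2)[OF that] K(1)] by linarith
  ultimately show ?thesis by (rule bounded_borelI)
qed

lemma bounded_borel_add:
  assumes "bounded_borel g" "bounded_borel h"
  shows "bounded_borel (\<lambda>\<sigma>. g \<sigma> + h \<sigma>)"
proof -
  obtain A where A: "\<And>\<sigma>. \<sigma> \<in> {0..1} \<Longrightarrow> norm (g \<sigma>) \<le> A"
    using assms(1) by (rule bounded_borelE) blast
  obtain B where B: "\<And>\<sigma>. \<sigma> \<in> {0..1} \<Longrightarrow> norm (h \<sigma>) \<le> B"
    using assms(2) by (rule bounded_borelE) blast
  show ?thesis
  proof (rule bounded_borelI)
    show "(\<lambda>\<sigma>. g \<sigma> + h \<sigma>) \<in> borel_measurable borel"
      by (rule borel_measurable_add) (rule bounded_borel_measurable, fact)+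
    show "norm (g \<sigma> + h \<sigma>) \<le> A + B" if "\<sigma> \<in> {0..1}" for \<sigma>
      by (rule norm_triangle_mono[OF A B]) (rule that)+
  qed
qed

lemma bounded_borel_cmult: "bounded_borel (g :: real \<Rightarrow> real) \<Longrightarrow> bounded_borel (\<lambda>\<sigma>. c * g \<sigma>)"
  using bounded_borel_linear[OF bounded_linear_mult_right, of g c] .

lemma bounded_borel_sum:
  assumes "\<And>i. i \<in> I \<Longrightarrow> bounded_borel (g i)"
  shows "bounded_borel (\<lambda>\<sigma>. \<Sum>i\<in>I. g i \<sigma>)"
  using assms
proof (induction I rule: infinite_finite_induct)
  case (insert i I)
  then show ?case by (simp add: bounded_borel_add)
qed simp_all

lemma bounded_borel_indicator:
  "A \<in> sets borel \<Longrightarrow> bounded_borel (\<lambda>\<sigma>. indicator A \<sigma> :: real)"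
  by (rule bounded_borelI[of _ 1]) (auto simp: indicator_def)

text \<open>The last clause, continuity under bounded pointwise convergence on the unit interval, is what
  singles out integration against signed measures concentrated there.\<close>

definition sigma_functional :: "((real \<Rightarrow> real) \<Rightarrow> real) \<Rightarrow> bool" where
  "sigma_functional L \<longleftrightarrow>
     (\<forall>g h. bounded_borel g \<longrightarrow> bounded_borel h \<longrightarrow> L (\<lambda>\<sigma>. g \<sigma> + h \<sigma>) = L g + L h) \<and>
     (\<forall>c g. bounded_borel g \<longrightarrow> L (\<lambda>\<sigma>. c * g \<sigma>) = c * L g) \<and>
     (\<forall>G g B. (\<forall>n. G n \<in> borel_measurable borel) \<longrightarrow> g \<in> borel_measurable borel \<longrightarrow>
        (\<forall>n. \<forall>\<sigma>\<in>{0..1}. \<bar>G n \<sigma>\<bar> \<le> B) \<longrightarrow> (\<forall>\<sigma>\<in>{0..1}. (\<lambda>n. G n \<sigma>) \<longlonglongrightarrow> g \<sigma>) \<longrightarrow>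
        (\<lambda>n. L (G n)) \<longlonglongrightarrow> L g)"

lemma sigma_functional_add:
  "sigma_functional L \<Longrightarrow> bounded_borel g \<Longrightarrow> bounded_borel h \<Longrightarrow> L (\<lambda>\<sigma>. g \<sigma> + h \<sigma>) = L g + L h"
  by (simp add: sigma_functional_def)

lemma sigma_functional_cmult:
  "sigma_functional L \<Longrightarrow> bounded_borel g \<Longrightarrow> L (\<lambda>\<sigma>. c * g \<sigma>) = c * L g"
  by (simp add: sigma_functional_def)

lemma sigma_functional_tendsto:
  assumes "sigma_functional L" "\<And>n. G n \<in> borel_measurable borel" "g \<in> borel_measurable borel"
    "\<And>n \<sigma>. \<sigma> \<in> {0..1} \<Longrightarrow> \<bar>G n \<sigma>\<bar> \<le> B" "\<And>\<sigma>. \<sigma> \<in> {0..1} \<Longrightarrow> (\<lambda>n. G n \<sigma>) \<longlonglongrightarrow> g \<sigma>"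
  shows "(\<lambda>n. L (G n)) \<longlonglongrightarrow> L g"
  using assms unfolding sigma_functional_def by blast

lemma sigma_functional_diff:
  assumes "sigma_functional L" "bounded_borel g" "bounded_borel h"
  shows "L (\<lambda>\<sigma>. g \<sigma> - h \<sigma>) = L g - L h"
  using sigma_functional_add[OF assms(1,2) bounded_borel_cmult[OF assms(3), of "-1"]]
    sigma_functional_cmult[OF assms(1,3), of "-1"] by simp

lemma sigma_functional_sum:
  assumes "sigma_functional L" "\<And>i. i \<in> I \<Longrightarrow> bounded_borel (g i)"
  shows "L (\<lambda>\<sigma>. \<Sum>i\<in>I. g i \<sigma>) = (\<Sum>i\<in>I. L (g i))"
proof -
  have z: "L (\<lambda>\<sigma>. 0) = 0"
    using sigma_functional_cmult[OF assms(1), of "\<lambda>_. 0" 0] by simp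
  show ?thesis
    using assms(2)
    by (induction I rule: infinite_finite_induct)
       (auto simp: z sigma_functional_add[OF assms(1)] bounded_borel_sum)
qed

text \<open>Bounded convergence along a constant sequence: the limit function may be changed off the unit
  interval.\<close>

lemma sigma_functional_cong:
  assumes L: "sigma_functional L" and "bounded_borel g" "bounded_borel h"
    and eq: "\<And>\<sigma>. \<sigma> \<in> {0..1} \<Longrightarrow> g \<sigma> = h \<sigma>"
  shows "L g = L h"
proof -
  obtain B where "\<And>\<sigma>. \<sigma> \<in> {0..1} \<Longrightarrow> norm (g \<sigma>) \<le> B"
    using assms(2) by (rule bounded_borelE) blast
  then have "(\<lambda>n::nat. L g) \<longlonglongrightarrow> L h"
    using assms(2,3) bounded_borel_measurable
    by (intro sigma_functional_tendsto[OF L, where B = B]) (auto simp: eq)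
  then show ?thesis by (simp add: tendsto_const_iff)
qed

text \<open>The intervals \<open>[0, t]\<close> with \<open>t > 0\<close> already control \<open>{0}\<close>, their intersection; the initial
  segments form an intersection-stable generator of the Borel sets, and bounded convergence takes
  equality from there to all Borel sets and then to all bounded Borel functions.\<close>

lemma sigma_functional_eqI:
  assumes L: "sigma_functional L" and L': "sigma_functional L'"
    and eq: "\<And>t. 0 < t \<Longrightarrow> t \<le> 1 \<Longrightarrow> L (indicator {0..t}) = L' (indicator {0..t})"
    and g: "bounded_borel g"
  shows "L g = L' g"
proof -
  note lim = sigma_functional_tendsto
  have z: "M (\<lambda>\<sigma>. 0) = 0" if "sigma_functional M" for M
    using sigma_functional_cmult[OF that, of "\<lambda>_. 0" 0] by simp
  have ind_cong: "M (indicator A) = M (indicator B)"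
    if "sigma_functional M" "A \<in> sets borel" "B \<in> sets borel" "A \<inter> {0..1} = B \<inter> {0..1}" for M A B
  proof (rule sigma_functional_cong[OF that(1)])
    fix \<sigma> :: real assume "\<sigma> \<in> {0..1}"
    then have "\<sigma> \<in> A \<longleftrightarrow> \<sigma> \<in> B" using that(4) by blast
    then show "indicator A \<sigma> = (indicator B \<sigma> :: real)" by (simp add: indicator_def)
  qed (rule bounded_borel_indicator, fact)+
  have zero: "L (indicator {..0}) = L' (indicator {..0})"
  proof -
    have "(\<lambda>n. M (indicator {0..inverse (real (Suc n))})) \<longlonglongrightarrow> M (indicator {..0})"
      if "sigma_functional M" for M
    proof (rule lim[OF that, where B = 1])
      fix \<sigma> :: real assume \<sigma>: "\<sigma> \<in> {0..1}"
      show "(\<lambda>n. indicator {0..inverse (real (Suc n))} \<sigma> :: real) \<longlonglongrightarrow> indicator {..0} \<sigma>"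
      proof (cases "\<sigma> = 0")
        case False
        have "\<forall>\<^sub>F n in sequentially. inverse (real (Suc n)) < \<sigma>"
          using \<sigma> False by (intro order_tendstoD(2)[OF LIMSEQ_inverse_real_of_nat]) auto
        then have "\<forall>\<^sub>F n in sequentially. indicator {0..inverse (real (Suc n))} \<sigma> = (0::real)"
          by eventually_elim auto
        then show ?thesis using \<sigma> False by (auto intro: tendsto_eventually)
      qed auto
    qed (auto simp: indicator_def)
    note l = this[OF L] this[OF L']
    have "L (indicator {0..inverse (real (Suc n))}) = L' (indicator {0..inverse (real (Suc n))})" for n
      by (rule eq) (auto simp: field_simps)
    with l(1) have "(\<lambda>n. L' (indicator {0..inverse (real (Suc n))})) \<longlonglongrightarrow> L (indicator {..0})"
      by (simp only:)
    then show ?thesis using l(2) by (rule LIMSEQ_unique)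
  qed
  have seg: "L (indicator {..a}) = L' (indicator {..a})" for a :: real
  proof -
    consider "a < 0" | "a = 0" | "0 < a" "a \<le> 1" | "1 < a" by linarith
    then show ?thesis
    proof cases
      case 1
      have "M (indicator {..a}) = 0" if "sigma_functional M" for M
        proof -
        have e: "indicator {} = (\<lambda>_::real. 0::real)" by auto
        have "M (indicator {..a}) = M (indicator {})" using 1 by (intro ind_cong[OF that]) auto
        then show ?thesis using z[OF that] by (simp only: e)
      qed
      from this[OF L] this[OF L'] show ?thesis by simp
    next
      case 3
      have "M (indicator {..a}) = M (indicator {0..a})" if "sigma_functional M" for M
        using 3 by (intro ind_cong[OF that]) auto
      from this[OF L] this[OF L'] show ?thesis using eq[OF 3] by simp
    next
      case 4
      have "M (indicator {..a}) = M (indicator {0..1})" if "sigma_functional M" for M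
        using 4 by (intro ind_cong[OF that]) auto
      from this[OF L] this[OF L'] show ?thesis using eq[of 1] by simp
    qed (simp add: zero)
  qed
  have sets: "L (indicator A) = L' (indicator A)" if "A \<in> sets borel" for A
  proof -
    have 1: "Int_stable (range (atMost :: real \<Rightarrow> _))" by (auto simp: Int_stable_def)
    have 2: "range (atMost :: real \<Rightarrow> _) \<subseteq> Pow UNIV" by simp
    have 3: "A \<in> sigma_sets UNIV (range atMost)"
      using that by (simp add: borel_eq_atMost)
    show ?thesis using 1 2 3
    proof (induction rule: sigma_sets_induct_disjoint)
      case (basic A) then show ?case using seg by auto
    next
      case empty then show ?case by (simp add: z[OF L] z[OF L'])
    next
      case (compl A)
      then have A: "A \<in> sets borel" by (simp add: borel_eq_atMost)
      have "M (indicator (UNIV - A)) = M (indicator {..1}) - M (indicator A)"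
        if M: "sigma_functional M" for M
      proof -
        have "M (indicator (UNIV - A)) = M (\<lambda>\<sigma>. indicator {..1} \<sigma> - indicator A \<sigma>)"
          by (rule sigma_functional_cong[OF M])
             (use A in \<open>auto simp: indicator_def intro!: bounded_borelI[of _ 1]\<close>)
        also have "\<dots> = M (indicator {..1}) - M (indicator A)"
          by (rule sigma_functional_diff[OF M]) (auto intro!: bounded_borel_indicator A)
        finally show ?thesis .
      qed
      from this[OF L] this[OF L'] show ?case using compl seg by simp
    next
      case (union A)
      have A: "A i \<in> sets borel" for i
        using union(2) by (auto simp: borel_eq_atMost)
      have fin: "M (indicator (\<Union>i<n. A i)) = (\<Sum>i<n. M (indicator (A i)))"
        if "sigma_functional M" for M n
      proof -
        have "indicator (\<Union>i<n. A i) = (\<lambda>x. \<Sum>i<n. indicator (A i) x :: real)"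
          using union(1) by (intro ext indicator_UN_disjoint) (auto simp: disjoint_family_on_def)
        then show ?thesis
          by (simp add: sigma_functional_sum[OF that] bounded_borel_indicator A)
      qed
      have "(\<lambda>n. M (indicator (\<Union>i<n. A i))) \<longlonglongrightarrow> M (indicator (\<Union>i. A i))"
        if "sigma_functional M" for M
      proof (rule lim[OF that, where B = 1])
        show "(\<lambda>n. indicator (\<Union>i<n. A i) \<sigma> :: real) \<longlonglongrightarrow> indicator (\<Union>i. A i) \<sigma>" for \<sigma>
          by (rule LIMSEQ_indicator_UN)
      qed (use A in \<open>auto simp: indicator_def\<close>)
      from this[OF L] this[OF L'] show ?case
        unfolding fin[OF L] fin[OF L'] union(3) by (rule LIMSEQ_unique)
    qed
  qed
  have nonneg: "bounded_borel u \<longrightarrow> L u = L' u"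
    if "u \<in> borel_measurable borel" "\<And>x. 0 \<le> u x" for u
    using that
  proof (induction rule: borel_measurable_induct_real)
    case (set A) then show ?case using sets by simp
  next
    case (mult u c)
    show ?case
    proof (cases "c = 0")
      case False
      then show ?thesis
        using mult bounded_borel_cmult[of "\<lambda>x. c * u x" "inverse c"]
        by (auto simp: sigma_functional_cmult[OF L] sigma_functional_cmult[OF L'] mult.assoc[symmetric])
    qed (simp add: z[OF L] z[OF L'])
  next
    case (add u v)
    show ?case
    proof
      assume "bounded_borel (\<lambda>x. v x + u x)"
      then obtain B where B: "\<And>\<sigma>. \<sigma> \<in> {0..1} \<Longrightarrow> norm (v \<sigma> + u \<sigma>) \<le> B"
        by (rule bounded_borelE) blast
      have le: "norm (u \<sigma>) \<le> B" "norm (v \<sigma>) \<le> B" if "\<sigma> \<in> {0..1}" for \<sigma>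
        using B[OF that] add(2,4)[of \<sigma>] by auto
      have "bounded_borel u" "bounded_borel v"
        using bounded_borelI[OF add(1) le(1)] bounded_borelI[OF add(3) le(2)] by blast+
      then show "L (\<lambda>x. v x + u x) = L' (\<lambda>x. v x + u x)"
        using add by (simp add: sigma_functional_add[OF L] sigma_functional_add[OF L'])
    qed
  next
    case (seq U)
    show ?case
    proof
      assume u: "bounded_borel u"
      then obtain B where B: "\<And>\<sigma>. \<sigma> \<in> {0..1} \<Longrightarrow> norm (u \<sigma>) \<le> B"
        by (rule bounded_borelE) blast
      have U: "\<bar>U n \<sigma>\<bar> \<le> B" if "\<sigma> \<in> {0..1}" for n \<sigma>
      proof -
        have "U n \<sigma> \<le> u \<sigma>"
          using seq(3,4) by (intro incseq_le) (auto simp: incseq_def le_fun_def)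
        then show ?thesis using seq(2)[of n \<sigma>] B[OF that] by auto
      qed
      then have "bounded_borel (U n)" for n by (intro bounded_borelI[OF seq(1), of n B]) auto
      then have e: "L (U n) = L' (U n)" for n using seq by auto
      have "(\<lambda>n. M (U n)) \<longlonglongrightarrow> M u" if "sigma_functional M" for M
        using seq U bounded_borel_measurable[OF u] by (intro lim[OF that, where B = B]) auto
      from this[OF L] this[OF L'] show "L u = L' u" unfolding e by (rule LIMSEQ_unique)
    qed
  qed
  \<comment> \<open>The monotone class argument needs nonnegative functions, so split into positive and negative parts.\<close>
  let ?p = "\<lambda>\<sigma>. max 0 (g \<sigma>)" and ?m = "\<lambda>\<sigma>. max 0 (- g \<sigma>)"
  obtain B where B: "0 \<le> B" "\<And>\<sigma>. \<sigma> \<in> {0..1} \<Longrightarrow> norm (g \<sigma>) \<le> B" using g by (rule bounded_borelE) blast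
  have [measurable]: "g \<in> borel_measurable borel" by (rule bounded_borel_measurable[OF g])
  have b: "bounded_borel ?p" "bounded_borel ?m"
    using B by (auto intro!: bounded_borelI[of _ B] simp: abs_le_iff)
  have "M g = M ?p - M ?m" if "sigma_functional M" for M
  proof -
    have "(\<lambda>\<sigma>. ?p \<sigma> - ?m \<sigma>) = g" by (auto simp: max_def)
    then show ?thesis using sigma_functional_diff[OF that b] by simp
  qed
  from this[OF L] this[OF L'] show ?thesis using nonneg[of ?p] nonneg[of ?m] b by simp
qed

section \<open>Jordan decomposition of functions of bounded variation\<close>

text \<open>The distribution function of a Stieltjes measure must be right-continuous, so \<open>P\<close> is first
  replaced by its right limits. The regularized function vanishes on the negative numbers; its
  measure is pushed forward under \<open>max 0\<close>, so that \<open>[0, t]\<close> receives the mass of \<open>(-1, t]\<close>.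
  The limit in the last clause need not be \<open>P t\<close>, but the difference of two such limits is determined
  when the difference of the functions is right-continuous.\<close>

lemma increasing_function_measure:
  fixes P :: "real \<Rightarrow> real"
  assumes mono: "\<And>s t. 0 \<le> s \<Longrightarrow> s \<le> t \<Longrightarrow> t \<le> 1 \<Longrightarrow> P s \<le> P t" and "0 \<le> P 0"
  obtains \<mu> where "finite_measure \<mu>" "sets \<mu> = sets (restrict_space borel {0..1})"
    "measure \<mu> {0..1} = P 1"
    "\<And>t. 0 < t \<Longrightarrow> t < 1 \<Longrightarrow> (P \<longlongrightarrow> measure \<mu> {0..t}) (at_right t)"
proof -
  \<comment> \<open>Right limits of P, extended by 0 on the left and by the constant P 1 on the right.\<close>
  define G where "G s = (if s < 0 then 0 else INF u\<in>{s<..}. P (min u 1))" for s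
  have bdd: "bdd_below ((\<lambda>u. P (min u 1)) ` {s<..})" if "0 \<le> s" for s
    using assms(2) mono[of 0] that by (intro bdd_belowI[of _ 0]) (auto intro!: order_trans[OF assms(2) mono])
  have G_le: "G s \<le> P (min u 1)" if "0 \<le> s" "s < u" for s u
    using that by (auto simp: G_def intro!: cINF_lower bdd)
  have G_ge: "B \<le> G s" if "0 \<le> s" "\<And>u. s < u \<Longrightarrow> B \<le> P (min u 1)" for s B
    using that by (auto simp: G_def intro!: cINF_greatest)
  have G0: "0 \<le> G s" for s
  proof (cases "s < 0")
    case False
    then show ?thesis
      by (intro G_ge) (auto intro!: order_trans[OF assms(2) mono])
  qed (simp add: G_def)
  have G_less: "\<exists>u>s. P (min u 1) < e" if "0 \<le> s" "G s < e" for s e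
    using that cInf_lessD[of "(\<lambda>u. P (min u 1)) ` {s<..}" e] by (auto simp: G_def)
  have G_mono: "G s \<le> G t" if "s \<le> t" for s t
  proof (cases "s < 0")
    case True then show ?thesis using G0 by (simp add: G_def)
  next
    case False
    then show ?thesis using that by (intro G_ge G_le) auto
  qed
  have G_cont: "continuous (at_right a) G" for a
    unfolding continuous_within
  proof (cases "a < 0")
    case True
    then have "\<forall>\<^sub>F s in at_right a. s \<in> {a<..<0}" by (intro eventually_at_right_real)
    then have "\<forall>\<^sub>F s in at_right a. G s = G a"
      by eventually_elim (use True in \<open>auto simp: G_def\<close>)
    then show "(G \<longlongrightarrow> G a) (at_right a)" by (rule tendsto_eventually)
  next
    case False
    show "(G \<longlongrightarrow> G a) (at_right a)"
    proof (rule order_tendstoI)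
      fix e assume "e < G a"
      have "\<forall>\<^sub>F s in at_right a. a < s" by (rule eventually_at_right_less)
      then show "\<forall>\<^sub>F s in at_right a. e < G s"
        by eventually_elim (use \<open>e < G a\<close> G_mono in \<open>auto intro: less_le_trans\<close>)
    next
      fix e assume "G a < e"
      then obtain u where u: "a < u" "P (min u 1) < e" using G_less[of a e] False by auto
      have "\<forall>\<^sub>F s in at_right a. s \<in> {a<..<u}" using u by (intro eventually_at_right_real)
      then show "\<forall>\<^sub>F s in at_right a. G s < e"
        by eventually_elim (use False in \<open>auto intro!: le_less_trans[OF G_le u(2)]\<close>)
    qed
  qed
  define \<mu>0 where "\<mu>0 = interval_measure G"
  define \<mu> where "\<mu> = distr (restrict_space \<mu>0 {-1<..1}) (restrict_space borel {0..1}) (max 0)"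
  have meas: "max 0 \<in> measurable (restrict_space \<mu>0 {-1<..1}) (restrict_space borel {0..1::real})"
    by (rule measurable_restrict_space2) (auto simp: space_restrict_space \<mu>0_def intro!: measurable_restrict_space1)
  have em: "emeasure \<mu> {0..t} = ennreal (G t)" if "0 \<le> t" "t \<le> 1" for t
  proof -
    have "emeasure \<mu> {0..t} = emeasure (restrict_space \<mu>0 {-1<..1}) (max 0 -` {0..t} \<inter> {-1<..1})"
      unfolding \<mu>_def using that
      by (subst emeasure_distr[OF meas]) (auto simp: sets_restrict_space space_restrict_space \<mu>0_def image_iff intro!: bexI[of _ "{0..t}"])
    also have "max 0 -` {0..t} \<inter> {-1<..1} = {-1<..t}" using that by auto
    also have "emeasure (restrict_space \<mu>0 {-1<..1}) {-1<..t} = emeasure \<mu>0 {-1<..t}"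
      using that by (intro emeasure_restrict_space) (auto simp: \<mu>0_def)
    also have "\<dots> = G t - G (-1)"
      unfolding \<mu>0_def using that by (intro emeasure_interval_measure_Ioc G_mono G_cont) auto
    finally show ?thesis by (simp add: G_def)
  qed
  have m: "measure \<mu> {0..t} = G t" if "0 \<le> t" "t \<le> 1" for t
    using em[OF that] G0 by (simp add: measure_def)
  show ?thesis
  proof
    have "space \<mu> = {0..1}" by (simp add: \<mu>_def space_restrict_space)
    then show "finite_measure \<mu>" using em[of 1] by (intro finite_measureI) simp
    show "sets \<mu> = sets (restrict_space borel {0..1})" by (simp add: \<mu>_def)
    have "G 1 = P 1" by (rule antisym) (use G_le[of 1 2] G_ge[of 1 "P 1"] in auto)
    then show "measure \<mu> {0..1} = P 1" by (simp add: m)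
    fix t :: real assume t: "0 < t" "t < 1"
    have ev: "\<forall>\<^sub>F s in at_right t. s \<in> {t<..<1}" using t by (intro eventually_at_right_real)
    have "(P \<longlongrightarrow> G t) (at_right t)"
    proof (rule order_tendstoI)
      fix e assume e: "e < G t"
      show "\<forall>\<^sub>F s in at_right t. e < P s"
        using ev
      proof eventually_elim
        case (elim s)
        then show ?case using G_le[of t s] e t by (auto simp: min_def split: if_splits)
      qed
    next
      fix e assume "G t < e"
      then obtain u where u: "t < u" "P (min u 1) < e" using G_less[of t e] t by auto
      have "\<forall>\<^sub>F s in at_right t. s \<in> {t<..<min u 1}" using u t by (intro eventually_at_right_real) auto
      then show "\<forall>\<^sub>F s in at_right t. P s < e"
        by eventually_elim (use u t in \<open>auto intro!: le_less_trans[OF mono u(2)]\<close>)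
    qed
    then show "(P \<longlongrightarrow> measure \<mu> {0..t}) (at_right t)" using m[of t] t by simp
  qed
qed

definition chain_sums :: "(real \<Rightarrow> real) \<Rightarrow> real \<Rightarrow> real set" where
  "chain_sums f t = {\<Sum>i<k. norm (f (p (Suc i)) - f (p i)) | (k::nat) p.
     (\<forall>i\<le>k. p i \<in> {0..t}) \<and> (\<forall>i<k. p i \<le> p (Suc i))}"

definition variation_upto :: "(real \<Rightarrow> real) \<Rightarrow> real \<Rightarrow> real" where
  "variation_upto f t = Sup (chain_sums f t)"

lemma chain_sums_mono: "s \<le> t \<Longrightarrow> chain_sums f s \<subseteq> chain_sums f t"
  unfolding chain_sums_def atLeastAtMost_iff by (blast intro: order_trans)

lemma chain_sums_1: "chain_sums f 1 = variation_sums f"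
  by (simp add: chain_sums_def variation_sums_def)

lemma chain_sums_nonempty: "0 \<le> t \<Longrightarrow> 0 \<in> chain_sums f t"
  unfolding chain_sums_def by (auto intro!: exI[of _ "0::nat"] exI[of _ "\<lambda>_. 0"])

lemma NBV_bdd: "f \<in> NBV \<Longrightarrow> t \<le> 1 \<Longrightarrow> bdd_above (chain_sums f t)"
  using chain_sums_mono[of t 1 f] by (auto simp: NBV_def chain_sums_1 intro: bdd_above_mono)

text \<open>Appending both \<open>s\<close> and \<open>t\<close> to a chain keeps its sum and adds the jump from \<open>s\<close> to \<open>t\<close>.\<close>

lemma chain_sums_extend:
  assumes "x \<in> chain_sums f s" "s \<le> t" "0 \<le> s"
  shows "\<exists>y\<in>chain_sums f t. x + \<bar>f t - f s\<bar> \<le> y"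
proof -
  obtain k :: nat and p where x: "x = (\<Sum>i<k. norm (f (p (Suc i)) - f (p i)))"
    and p: "\<forall>i\<le>k. p i \<in> {0..s}" "\<forall>i<k. p i \<le> p (Suc i)"
    using assms(1) by (auto simp: chain_sums_def)
  define q where "q i = (if i \<le> k then p i else if i = Suc k then s else t)" for i
  have "(\<Sum>i<Suc (Suc k). norm (f (q (Suc i)) - f (q i))) \<in> chain_sums f t"
    unfolding chain_sums_def
  proof (rule CollectI, rule exI[of _ "Suc (Suc k)"], rule exI[of _ q], intro conjI refl)
    show "\<forall>i\<le>Suc (Suc k). q i \<in> {0..t}" using p(1) assms by (fastforce simp: q_def)
    show "\<forall>i<Suc (Suc k). q i \<le> q (Suc i)"
    proof (intro allI impI)
      fix i assume "i < Suc (Suc k)"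
      then consider "i < k" | "i = k" | "i = Suc k" by linarith
      then show "q i \<le> q (Suc i)"
        using p assms by cases (auto simp: q_def)
    qed
  qed
  moreover have "x + \<bar>f t - f s\<bar> \<le> (\<Sum>i<Suc (Suc k). norm (f (q (Suc i)) - f (q i)))"
    by (simp add: q_def x)
  ultimately show ?thesis by blast
qed

lemma variation_upto_increment:
  assumes "f \<in> NBV" "0 \<le> s" "s \<le> t" "t \<le> 1"
  shows "variation_upto f s + \<bar>f t - f s\<bar> \<le> variation_upto f t"
proof -
  have "x \<le> variation_upto f t - \<bar>f t - f s\<bar>" if x: "x \<in> chain_sums f s" for x
  proof -
    obtain y where "y \<in> chain_sums f t" "x + \<bar>f t - f s\<bar> \<le> y"
      using chain_sums_extend[OF x] assms by auto
    moreover from this have "y \<le> variation_upto f t"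
      unfolding variation_upto_def using NBV_bdd[OF assms(1,4)] by (intro cSup_upper)
    ultimately show ?thesis by linarith
  qed
  then have "variation_upto f s \<le> variation_upto f t - \<bar>f t - f s\<bar>"
    unfolding variation_upto_def[of f s] using chain_sums_nonempty[OF assms(2)]
    by (intro cSup_least) auto
  then show ?thesis by simp
qed

text \<open>Half the sum and half the difference of the variation function and \<open>f\<close> are increasing. Their right
  limits differ by the right limit of \<open>f\<close>, which is \<open>f\<close> itself. This particular pair has total mass
  equal to the total variation, which gives the sharp bound in \<open>scalar_stieltjes_bound\<close>.\<close>

lemma signed_measure_pair_exists:
  assumes f: "f \<in> NBV"
  obtains \<mu> \<nu> where "signed_measure_pair f (\<mu>, \<nu>)"
    "measure \<mu> {0..1} + measure \<nu> {0..1} = total_variation f"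
proof -
  let ?P = "\<lambda>t. (variation_upto f t + f t) / 2" and ?N = "\<lambda>t. (variation_upto f t - f t) / 2"
  have f0: "f 0 = 0" using f by (simp add: NBV_def)
  have v0: "0 \<le> variation_upto f 0"
    unfolding variation_upto_def by (rule cSup_upper[OF chain_sums_nonempty NBV_bdd[OF f]]) auto
  have P: "?P s \<le> ?P t" and N: "?N s \<le> ?N t" if "0 \<le> s" "s \<le> t" "t \<le> 1" for s t
    using variation_upto_increment[OF f that] by (auto simp: abs_if split: if_splits)
  have P0: "0 \<le> ?P 0" and N0: "0 \<le> ?N 0" using v0 f0 by simp_all
  obtain \<mu> where \<mu>: "finite_measure \<mu>" "sets \<mu> = sets (restrict_space borel {0..1})"
    "measure \<mu> {0..1} = ?P 1" "\<And>t. 0 < t \<Longrightarrow> t < 1 \<Longrightarrow> (?P \<longlongrightarrow> measure \<mu> {0..t}) (at_right t)"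
    by (rule increasing_function_measure[of ?P, OF P P0]) blast+
  obtain \<nu> where \<nu>: "finite_measure \<nu>" "sets \<nu> = sets (restrict_space borel {0..1})"
    "measure \<nu> {0..1} = ?N 1" "\<And>t. 0 < t \<Longrightarrow> t < 1 \<Longrightarrow> (?N \<longlongrightarrow> measure \<nu> {0..t}) (at_right t)"
    by (rule increasing_function_measure[of ?N, OF N N0]) blast+
  have "measure \<mu> {0..t} - measure \<nu> {0..t} = f t" if t: "0 < t" "t \<le> 1" for t
  proof (cases "t = 1")
    case True
    then show ?thesis by (simp add: \<mu>(3) \<nu>(3) field_simps)
  next
    case False
    then have "((\<lambda>s. ?P s - ?N s) \<longlongrightarrow> measure \<mu> {0..t} - measure \<nu> {0..t}) (at_right t)"
      using t by (intro tendsto_diff \<mu>(4) \<nu>(4)) auto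
    moreover have "(\<lambda>s. ?P s - ?N s) = f" by (auto simp: field_simps)
    moreover have "(f \<longlongrightarrow> f t) (at_right t)"
      using f t False by (auto simp: NBV_def continuous_within)
    ultimately show ?thesis using tendsto_unique[OF trivial_limit_at_right_real] by metis
  qed
  then have "signed_measure_pair f (\<mu>, \<nu>)"
    using \<mu> \<nu> by (simp add: signed_measure_pair_def)
  moreover have "measure \<mu> {0..1} + measure \<nu> {0..1} = total_variation f"
    by (simp add: \<mu>(3) \<nu>(3) variation_upto_def chain_sums_1 total_variation_def field_simps)
  ultimately show ?thesis by (rule that)
qed

section \<open>Operations on functions of bounded variation\<close>

text \<open>The common core of the estimates for images under Lipschitz maps.\<close>

lemma variation_sums_dominated:
  assumes "\<And>s t. s \<in> {0..1} \<Longrightarrow> t \<in> {0..1} \<Longrightarrow> norm (h s - h t) \<le> K * norm (f s - f t)"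
    and "x \<in> variation_sums h"
  shows "\<exists>y\<in>variation_sums f. x \<le> K * y"
proof -
  obtain k :: nat and p where x: "x = (\<Sum>i<k. norm (h (p (Suc i)) - h (p i)))"
    and p: "\<forall>i\<le>k. p i \<in> {0..1}" "\<forall>i<k. p i \<le> p (Suc i)"
    using assms(2) unfolding variation_sums_def by blast
  have "x \<le> (\<Sum>i<k. K * norm (f (p (Suc i)) - f (p i)))"
    unfolding x using p(1) by (intro sum_mono assms(1)) auto
  moreover have "(\<Sum>i<k. norm (f (p (Suc i)) - f (p i))) \<in> variation_sums f"
    using p unfolding variation_sums_def by blast
  ultimately show ?thesis by (intro bexI) (simp_all add: sum_distrib_left)
qed

lemma variation_sums_zero: "0 \<in> variation_sums f"
  unfolding variation_sums_def by (auto intro!: exI[of _ "0::nat"] exI[of _ "\<lambda>_. 0"])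

lemma NBV_bounded_linear:
  assumes "bounded_linear T" "f \<in> NBV"
  shows "(\<lambda>t. T (f t)) \<in> NBV"
proof -
  interpret bounded_linear T by fact
  obtain K where K: "0 < K" "\<And>x. norm (T x) \<le> norm x * K" using pos_bounded by auto
  obtain B where B: "\<And>x. x \<in> variation_sums f \<Longrightarrow> x \<le> B"
    using assms(2) by (auto simp: NBV_def bdd_above_def)
  have "bdd_above (variation_sums (\<lambda>t. T (f t)))"
  proof (rule bdd_aboveI[of _ "K * B"])
    fix x assume "x \<in> variation_sums (\<lambda>t. T (f t))"
    then have "\<exists>y\<in>variation_sums f. x \<le> K * y"
      by (rule variation_sums_dominated[rotated]) (metis K(2) diff mult.commute)
    then obtain y where y: "y \<in> variation_sums f" "x \<le> K * y" by blast
    then show "x \<le> K * B" using mult_left_mono[OF B[OF y(1)], of K] K(1) by linarith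
  qed
  then show ?thesis
    using assms(2) by (auto simp: NBV_def zero intro!: continuous)
qed

lemma NBV_add:
  assumes "f \<in> NBV" "h \<in> NBV"
  shows "(\<lambda>t. f t + h t) \<in> NBV"
proof -
  obtain A where A: "\<And>x. x \<in> variation_sums f \<Longrightarrow> x \<le> A"
    using assms(1) by (auto simp: NBV_def bdd_above_def)
  obtain B where B: "\<And>x. x \<in> variation_sums h \<Longrightarrow> x \<le> B"
    using assms(2) by (auto simp: NBV_def bdd_above_def)
  have "bdd_above (variation_sums (\<lambda>t. f t + h t))"
  proof (rule bdd_aboveI[of _ "A + B"])
    fix x assume "x \<in> variation_sums (\<lambda>t. f t + h t)"
    then obtain k :: nat and p
      where x: "x = (\<Sum>i<k. norm ((f (p (Suc i)) + h (p (Suc i))) - (f (p i) + h (p i))))"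
      and p: "\<forall>i\<le>k. p i \<in> {0..1}" "\<forall>i<k. p i \<le> p (Suc i)"
      unfolding variation_sums_def by blast
    have "x \<le> (\<Sum>i<k. norm (f (p (Suc i)) - f (p i)) + norm (h (p (Suc i)) - h (p i)))"
      unfolding x by (intro sum_mono) (simp add: add_diff_add norm_triangle_ineq)
    also have "\<dots> \<le> A + B"
      unfolding sum.distrib using p by (intro add_mono A B) (auto simp: variation_sums_def)
    finally show "x \<le> A + B" .
  qed
  then show ?thesis
    using assms by (auto simp: NBV_def intro!: continuous_add)
qed

lemma NBV_zero: "(\<lambda>_. 0) \<in> NBV"
  by (auto simp: NBV_def variation_sums_def)

lemma NBV_sum: "(\<And>i. i \<in> I \<Longrightarrow> f i \<in> NBV) \<Longrightarrow> (\<lambda>t. \<Sum>i\<in>I. f i t) \<in> NBV"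
  by (induction I rule: infinite_finite_induct) (simp_all add: NBV_zero NBV_add)

lemma total_variation_contraction:
  assumes "f \<in> NBV" and "\<And>s t. norm (h s - h t) \<le> norm (f s - f t)"
  shows "total_variation h \<le> total_variation f"
  unfolding total_variation_def
proof (rule cSup_least)
  fix x assume "x \<in> variation_sums h"
  then have "\<exists>y\<in>variation_sums f. x \<le> 1 * y"
    by (rule variation_sums_dominated[rotated]) (simp add: assms(2))
  then obtain y where y: "y \<in> variation_sums f" "x \<le> y" by auto
  have "y \<le> Sup (variation_sums f)"
    using assms(1) y(1) by (intro cSup_upper) (auto simp: NBV_def)
  then show "x \<le> Sup (variation_sums f)" using y by linarith
qed (use variation_sums_zero in auto)

section \<open>Stieltjes integrals as functionals\<close>

lemma measurable_from_unit_interval: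
  assumes "sets \<mu> = sets (restrict_space borel {0..1::real})" "g \<in> borel_measurable borel"
  shows "g \<in> borel_measurable \<mu>"
  by (subst measurable_cong_sets[OF assms(1) refl]) (rule measurable_restrict_space1[OF assms(2)])

lemma space_unit_interval:
  "sets \<mu> = sets (restrict_space borel {0..1::real}) \<Longrightarrow> space \<mu> = {0..1}"
  using sets_eq_imp_space_eq[of \<mu> "restrict_space borel {0..1}"] by (simp add: space_restrict_space)

lemma integrable_on_unit_interval:
  fixes g :: "real \<Rightarrow> 'a::euclidean_space"
  assumes "finite_measure \<mu>" "sets \<mu> = sets (restrict_space borel {0..1})" "bounded_borel g"
  shows "integrable \<mu> g"
proof -
  interpret finite_measure \<mu> by fact
  obtain B where B: "\<And>\<sigma>. \<sigma> \<in> {0..1} \<Longrightarrow> norm (g \<sigma>) \<le> B" using assms(3) by (rule bounded_borelE) blast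
  with space_unit_interval[OF assms(2)] show ?thesis
    using measurable_from_unit_interval[OF assms(2) bounded_borel_measurable[OF assms(3)]]
    by (intro integrable_const_bound[of _ B]) auto
qed

lemma sigma_functional_integral:
  assumes \<mu>: "finite_measure \<mu>" "sets \<mu> = sets (restrict_space borel {0..1})"
  shows "sigma_functional (integral\<^sup>L \<mu>)"
proof -
  interpret finite_measure \<mu> by fact
  note sp = space_unit_interval[OF \<mu>(2)]
  note m = measurable_from_unit_interval[OF \<mu>(2)]
  show ?thesis
    unfolding sigma_functional_def
  proof (intro conjI allI impI)
    fix G :: "nat \<Rightarrow> real \<Rightarrow> real" and g B
    assume "\<forall>n. G n \<in> borel_measurable borel" "g \<in> borel_measurable borel"
      "\<forall>n. \<forall>\<sigma>\<in>{0..1}. \<bar>G n \<sigma>\<bar> \<le> B" "\<forall>\<sigma>\<in>{0..1}. (\<lambda>n. G n \<sigma>) \<longlonglongrightarrow> g \<sigma>"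
    then show "(\<lambda>n. integral\<^sup>L \<mu> (G n)) \<longlonglongrightarrow> integral\<^sup>L \<mu> g"
      by (intro integral_dominated_convergence[where w = "\<lambda>_. B"]) (auto simp: sp m)
  qed (auto simp: integrable_on_unit_interval[OF \<mu>])
qed

lemma sigma_functional_difference:
  assumes "sigma_functional L" "sigma_functional L'"
  shows "sigma_functional (\<lambda>g. L g - L' g)"
  unfolding sigma_functional_def
proof (intro conjI allI impI)
  fix G :: "nat \<Rightarrow> real \<Rightarrow> real" and g B
  assume "\<forall>n. G n \<in> borel_measurable borel" "g \<in> borel_measurable borel"
    "\<forall>n. \<forall>\<sigma>\<in>{0..1}. \<bar>G n \<sigma>\<bar> \<le> B" "\<forall>\<sigma>\<in>{0..1}. (\<lambda>n. G n \<sigma>) \<longlonglongrightarrow> g \<sigma>"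
  then show "(\<lambda>n. L (G n) - L' (G n)) \<longlonglongrightarrow> L g - L' g"
    by (intro tendsto_diff sigma_functional_tendsto[OF assms(1), where B = B]
        sigma_functional_tendsto[OF assms(2), where B = B]) auto
qed (simp_all add: sigma_functional_add[OF assms(1)] sigma_functional_add[OF assms(2)]
    sigma_functional_cmult[OF assms(1)] sigma_functional_cmult[OF assms(2)] algebra_simps)

lemma signed_measure_pair_functional:
  assumes "signed_measure_pair f (\<mu>, \<nu>)"
  shows "sigma_functional (\<lambda>g. integral\<^sup>L \<mu> g - integral\<^sup>L \<nu> g)"
    and "0 < t \<Longrightarrow> t \<le> 1 \<Longrightarrow> integral\<^sup>L \<mu> (indicator {0..t}) - integral\<^sup>L \<nu> (indicator {0..t}) = f t"
proof -
  have \<mu>: "finite_measure \<mu>" "sets \<mu> = sets (restrict_space borel {0..1})"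
    and \<nu>: "finite_measure \<nu>" "sets \<nu> = sets (restrict_space borel {0..1})"
    using assms by (auto simp: signed_measure_pair_def)
  show "sigma_functional (\<lambda>g. integral\<^sup>L \<mu> g - integral\<^sup>L \<nu> g)"
    by (intro sigma_functional_difference sigma_functional_integral \<mu> \<nu>)
  assume t: "0 < t" "t \<le> 1"
  have "integral\<^sup>L m (indicator {0..t}) = measure m {0..t}"
    if "sets m = sets (restrict_space borel {0..1})" for m
  proof -
    have "{0..t} \<inter> space m = {0..t}" using t space_unit_interval[OF that] by auto
    then show ?thesis by (subst Bochner_Integration.integral_indicator) simp
  qed
  from this[OF \<mu>(2)] this[OF \<nu>(2)]
  show "integral\<^sup>L \<mu> (indicator {0..t}) - integral\<^sup>L \<nu> (indicator {0..t}) = f t"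
    using assms t by (simp add: signed_measure_pair_def)
qed

text \<open>Unpacks the choice in the definition.\<close>

lemma scalar_stieltjes_pair:
  assumes "f \<in> NBV"
  obtains \<mu> \<nu> where "signed_measure_pair f (\<mu>, \<nu>)"
    "finite_measure \<mu>" "sets \<mu> = sets (restrict_space borel {0..1})"
    "finite_measure \<nu>" "sets \<nu> = sets (restrict_space borel {0..1})"
    "\<And>g. scalar_stieltjes f g = integral\<^sup>L \<mu> g - integral\<^sup>L \<nu> g"
proof -
  obtain m where m: "signed_measure_pair f m" "(SOME m. signed_measure_pair f m) = m"
    using signed_measure_pair_exists[OF assms] someI by metis
  obtain \<mu> \<nu> where "m = (\<mu>, \<nu>)" by (cases m)
  with m show ?thesis
    by (intro that[of \<mu> \<nu>]) (simp_all add: scalar_stieltjes_def signed_measure_pair_def)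
qed

lemma scalar_stieltjes_cong:
  fixes g h :: "real \<Rightarrow> 'a::{banach, second_countable_topology}"
  assumes f: "f \<in> NBV" and eq: "\<And>\<sigma>. \<sigma> \<in> {0..1} \<Longrightarrow> g \<sigma> = h \<sigma>"
  shows "scalar_stieltjes f g = scalar_stieltjes f h"
proof -
  obtain \<mu> \<nu> where m: "sets \<mu> = sets (restrict_space borel {0..1})" "sets \<nu> = sets (restrict_space borel {0..1})"
    and p: "\<And>g :: real \<Rightarrow> 'a. scalar_stieltjes f g = integral\<^sup>L \<mu> g - integral\<^sup>L \<nu> g"
    by (rule scalar_stieltjes_pair[OF f]) blast
  have "integral\<^sup>L \<mu> g = integral\<^sup>L \<mu> h" "integral\<^sup>L \<nu> g = integral\<^sup>L \<nu> h"
    by (intro Bochner_Integration.integral_cong refl eq, simp add: space_unit_interval[OF m(1)] space_unit_interval[OF m(2)])+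
  then show ?thesis unfolding p by simp
qed

lemma sigma_functional_scalar_stieltjes:
  assumes "f \<in> NBV"
  shows "sigma_functional (scalar_stieltjes f)"
    and "0 < t \<Longrightarrow> t \<le> 1 \<Longrightarrow> scalar_stieltjes f (indicator {0..t}) = f t"
proof -
  obtain \<mu> \<nu> where p: "signed_measure_pair f (\<mu>, \<nu>)"
    "\<And>g :: real \<Rightarrow> real. scalar_stieltjes f g = integral\<^sup>L \<mu> g - integral\<^sup>L \<nu> g"
    by (rule scalar_stieltjes_pair[OF assms]) blast
  have "scalar_stieltjes f = (\<lambda>g::real\<Rightarrow>real. integral\<^sup>L \<mu> g - integral\<^sup>L \<nu> g)"
    by (rule ext) (rule p(2))
  then show "sigma_functional (scalar_stieltjes f)"
    "0 < t \<Longrightarrow> t \<le> 1 \<Longrightarrow> scalar_stieltjes f (indicator {0..t}) = f t"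
    using signed_measure_pair_functional[OF p(1)] by simp_all
qed

text \<open>A Stieltjes integral is identified by evaluating a functional on initial segments. This is the
  way in which the integral becomes independent of the pair of measures chosen in its definition.\<close>

lemma scalar_stieltjes_eqI:
  assumes "f \<in> NBV" "sigma_functional L" "\<And>t. 0 < t \<Longrightarrow> t \<le> 1 \<Longrightarrow> L (indicator {0..t}) = f t"
    "bounded_borel g"
  shows "scalar_stieltjes f g = L g"
proof (rule sigma_functional_eqI[of "scalar_stieltjes f" L])
  show "scalar_stieltjes f (indicator {0..t}) = L (indicator {0..t})" if "0 < t" "t \<le> 1" for t
    using sigma_functional_scalar_stieltjes(2)[OF assms(1) that] assms(3)[OF that] by simp
qed (fact sigma_functional_scalar_stieltjes(1)[OF assms(1)] assms)+

text \<open>The chosen pair may have large masses, so the estimate passes to the pair from the Jordan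
  decomposition.\<close>

lemma scalar_stieltjes_bound:
  fixes g :: "real \<Rightarrow> real"
  assumes f: "f \<in> NBV" and g: "g \<in> borel_measurable borel" "\<And>\<sigma>. \<sigma> \<in> {0..1} \<Longrightarrow> \<bar>g \<sigma>\<bar> \<le> B"
  shows "\<bar>scalar_stieltjes f g\<bar> \<le> total_variation f * B"
proof -
  obtain \<mu> \<nu> where p: "signed_measure_pair f (\<mu>, \<nu>)"
    and tv: "measure \<mu> {0..1} + measure \<nu> {0..1} = total_variation f"
    by (rule signed_measure_pair_exists[OF f])
  have b: "bounded_borel g" using g by (intro bounded_borelI[of g B]) auto
  have le: "\<bar>integral\<^sup>L m g\<bar> \<le> measure m {0..1} * B"
    if m: "finite_measure m" "sets m = sets (restrict_space borel {0..1})" for m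
  proof -
    interpret finite_measure m by fact
    note sp = space_unit_interval[OF m(2)]
    have "norm (integral\<^sup>L m g) \<le> (\<integral>x. B \<partial>m)"
      by (rule Bochner_Integration.integral_norm_bound_integral) (use g sp integrable_on_unit_interval[OF m b] in auto)
    then show ?thesis by (simp add: sp)
  qed
  have "scalar_stieltjes f g = integral\<^sup>L \<mu> g - integral\<^sup>L \<nu> g"
    by (rule scalar_stieltjes_eqI[OF f signed_measure_pair_functional[OF p] b])
  moreover have "\<bar>integral\<^sup>L \<mu> g\<bar> \<le> measure \<mu> {0..1} * B" "\<bar>integral\<^sup>L \<nu> g\<bar> \<le> measure \<nu> {0..1} * B"
    using p by (auto simp: signed_measure_pair_def intro!: le)
  ultimately show ?thesis unfolding tv[symmetric] by (simp add: algebra_simps abs_le_iff)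
qed

lemma scalar_stieltjes_zero:
  fixes g :: "real \<Rightarrow> real"
  assumes "bounded_borel g"
  shows "scalar_stieltjes (\<lambda>_. 0) g = 0"
  by (rule scalar_stieltjes_eqI[where L = "\<lambda>_. 0", OF NBV_zero _ _ assms])
     (simp_all add: sigma_functional_def)

text \<open>Reduces vector-valued and complex integrals to their coordinates.\<close>

lemma scalar_stieltjes_bounded_linear:
  fixes g :: "real \<Rightarrow> 'a::euclidean_space" and T :: "'a \<Rightarrow> 'b::euclidean_space"
  assumes f: "f \<in> NBV" and g: "bounded_borel g" and T: "bounded_linear T"
  shows "scalar_stieltjes f (\<lambda>\<sigma>. T (g \<sigma>)) = T (scalar_stieltjes f g)"
proof -
  obtain m where m: "signed_measure_pair f m" "m = (SOME m. signed_measure_pair f m)"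
    using signed_measure_pair_exists[OF f] someI by metis
  have "integrable (fst m) g" "integrable (snd m) g"
    using m(1) by (auto simp: signed_measure_pair_def split: prod.splits intro!: integrable_on_unit_interval g)
  then show ?thesis
    unfolding scalar_stieltjes_def m(2)[symmetric]
    by (cases m) (simp add: integral_bounded_linear[OF T] bounded_linear.linear[OF T, THEN linear_diff])
qed

lemma scalar_stieltjes_complex:
  fixes g :: "real \<Rightarrow> complex"
  assumes "f \<in> NBV" "bounded_borel g"
  shows "scalar_stieltjes f g =
    Complex (scalar_stieltjes f (\<lambda>\<sigma>. Re (g \<sigma>))) (scalar_stieltjes f (\<lambda>\<sigma>. Im (g \<sigma>)))"
  using scalar_stieltjes_bounded_linear[OF assms bounded_linear_Re]
    scalar_stieltjes_bounded_linear[OF assms bounded_linear_Im] by (simp add: complex_eq_iff)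

lemma scalar_stieltjes_diff:
  fixes g h :: "real \<Rightarrow> 'a::euclidean_space"
  assumes f: "f \<in> NBV" and g: "bounded_borel g" and h: "bounded_borel h"
  shows "scalar_stieltjes f (\<lambda>\<sigma>. g \<sigma> - h \<sigma>) = scalar_stieltjes f g - scalar_stieltjes f h"
proof -
  obtain \<mu> \<nu> where \<mu>: "finite_measure \<mu>" "sets \<mu> = sets (restrict_space borel {0..1})"
    and \<nu>: "finite_measure \<nu>" "sets \<nu> = sets (restrict_space borel {0..1})"
    and p: "\<And>g :: real \<Rightarrow> 'a. scalar_stieltjes f g = integral\<^sup>L \<mu> g - integral\<^sup>L \<nu> g"
    by (rule scalar_stieltjes_pair[OF f]) blast
  note I = integrable_on_unit_interval[OF \<mu>] integrable_on_unit_interval[OF \<nu>]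
  show ?thesis unfolding p using I[OF g] I[OF h] by simp
qed

section \<open>Representation of functionals by functions of bounded variation\<close>

text \<open>Boundedness is automatic. If \<open>\<bar>L g\<^sub>n\<bar> > n\<close> with \<open>\<bar>g\<^sub>n\<bar> \<le> 1\<close>, then \<open>g\<^sub>n / \<bar>L g\<^sub>n\<bar>\<close> tends to 0 uniformly
  while its values under \<open>L\<close> have modulus 1.\<close>

lemma sigma_functional_bounded:
  assumes L: "sigma_functional L"
  obtains K where "\<And>g. g \<in> borel_measurable borel \<Longrightarrow> (\<And>\<sigma>. \<sigma> \<in> {0..1} \<Longrightarrow> \<bar>g \<sigma>\<bar> \<le> 1) \<Longrightarrow> \<bar>L g\<bar> \<le> K"
proof (rule ccontr)
  assume contr: "\<not> thesis"
  have "\<exists>g. g \<in> borel_measurable borel \<and> (\<forall>\<sigma>\<in>{0..1}. \<bar>g \<sigma>\<bar> \<le> 1) \<and> real (Suc n) < \<bar>L g\<bar>" for n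
  proof (rule ccontr)
    assume "\<not> ?thesis"
    then have "\<bar>L g\<bar> \<le> real (Suc n)"
      if "g \<in> borel_measurable borel" "\<And>\<sigma>. \<sigma> \<in> {0..1} \<Longrightarrow> \<bar>g \<sigma>\<bar> \<le> 1" for g
      using that by (meson not_less)
    then show False using that contr by blast
  qed
  then obtain g where g: "\<And>n. g n \<in> borel_measurable borel" "\<And>n \<sigma>. \<sigma> \<in> {0..1} \<Longrightarrow> \<bar>g n \<sigma>\<bar> \<le> 1"
    "\<And>n. real (Suc n) < \<bar>L (g n)\<bar>"
    by metis
  have b: "bounded_borel (g n)" for n by (rule bounded_borelI[of _ 1]) (use g in auto)
  have pos: "0 < \<bar>L (g n)\<bar>" for n using g(3)[of n] by linarith
  have small: "\<bar>inverse \<bar>L (g n)\<bar> * g n \<sigma>\<bar> \<le> inverse (real (Suc n))" if "\<sigma> \<in> {0..1}" for n \<sigma>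
  proof -
    have "\<bar>inverse \<bar>L (g n)\<bar> * g n \<sigma>\<bar> \<le> inverse \<bar>L (g n)\<bar> * 1"
      unfolding abs_mult using g(2)[OF that, of n] by (intro mult_mono) auto
    also have "\<dots> \<le> inverse (real (Suc n))"
      using g(3)[of n] by (simp add: le_imp_inverse_le)
    finally show ?thesis .
  qed
  have "(\<lambda>n. L (\<lambda>\<sigma>. inverse \<bar>L (g n)\<bar> * g n \<sigma>)) \<longlonglongrightarrow> L (\<lambda>_. 0)"
  proof (rule sigma_functional_tendsto[OF L, where B = 1])
    fix n and \<sigma> :: real assume \<sigma>: "\<sigma> \<in> {0..1}"
    have "inverse (real (Suc n)) \<le> 1" by (simp add: field_simps)
    then show "\<bar>inverse \<bar>L (g n)\<bar> * g n \<sigma>\<bar> \<le> 1" using small[OF \<sigma>, of n] by linarith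
    show "(\<lambda>n. inverse \<bar>L (g n)\<bar> * g n \<sigma>) \<longlonglongrightarrow> 0"
      by (rule Lim_null_comparison[OF _ LIMSEQ_inverse_real_of_nat]) (use small[OF \<sigma>] in auto)
  qed (use g in simp_all)
  moreover have "L (\<lambda>_. 0) = 0"
    using sigma_functional_cmult[OF L, of "\<lambda>_. 0" 0] by simp
  ultimately have "(\<lambda>n. \<bar>inverse \<bar>L (g n)\<bar> * L (g n)\<bar>) \<longlonglongrightarrow> \<bar>0\<bar>"
    by (intro tendsto_rabs) (simp add: sigma_functional_cmult[OF L b])
  moreover have "\<bar>inverse \<bar>L (g n)\<bar> * L (g n)\<bar> = 1" for n
    using pos[of n] by (simp add: abs_mult)
  ultimately show False by (simp add: tendsto_const_iff)
qed

text \<open>The representing function is \<open>t \<mapsto> L(1\<^bsub>[0,t]\<^esub>)\<close>. A variation sum is the value of \<open>L\<close> at a signed sum of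
  indicators of disjoint intervals, a function bounded by 1; right-continuity is bounded
  convergence of \<open>1\<^bsub>[0,s]\<^esub>\<close> to \<open>1\<^bsub>[0,t]\<^esub>\<close> as \<open>s\<close> decreases to \<open>t\<close>.\<close>

lemma sigma_functional_representation:
  assumes L: "sigma_functional L"
  obtains f where "f \<in> NBV" "\<And>g. bounded_borel g \<Longrightarrow> scalar_stieltjes f g = L g"
proof -
  obtain K where bound: "\<And>g. g \<in> borel_measurable borel \<Longrightarrow> (\<And>\<sigma>. \<sigma> \<in> {0..1} \<Longrightarrow> \<bar>g \<sigma>\<bar> \<le> 1) \<Longrightarrow> \<bar>L g\<bar> \<le> K"
    by (rule sigma_functional_bounded[OF L]) blast
  \<comment> \<open>Functions in NBV vanish at 0, whereas L may charge the segment {0}; hence the empty set for t = 0.\<close>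
  define I where "I t = (if t \<le> 0 then {} else {0..t})" for t :: real
  define f where "f t = L (indicator (I t))" for t
  have I: "I t \<in> sets borel" for t by (auto simp: I_def)
  have mono: "s \<le> t \<Longrightarrow> I s \<subseteq> I t" for s t by (auto simp: I_def)
  have "bdd_above (variation_sums f)"
  proof (rule bdd_aboveI[of _ K])
    fix x assume "x \<in> variation_sums f"
    then obtain k :: nat and p where x: "x = (\<Sum>i<k. norm (f (p (Suc i)) - f (p i)))"
      and p: "\<forall>i\<le>k. p i \<in> {0..1}" "\<forall>i<k. p i \<le> p (Suc i)"
      unfolding variation_sums_def by blast
    define d :: "nat \<Rightarrow> real \<Rightarrow> real"
      where "d i \<sigma> = indicator (I (p (Suc i))) \<sigma> - indicator (I (p i)) \<sigma>" for i \<sigma>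
    \<comment> \<open>The signs turn the variation sum into a single value of L.\<close>
    define h where "h \<sigma> = (\<Sum>i<k. sgn (f (p (Suc i)) - f (p i)) * d i \<sigma>)" for \<sigma>
    have d: "bounded_borel (d i)" for i
      unfolding d_def by (rule bounded_borelI[of _ 1]) (use I in \<open>auto simp: indicator_def\<close>)
    have "L (d i) = f (p (Suc i)) - f (p i)" for i
      unfolding d_def f_def by (rule sigma_functional_diff[OF L]) (intro bounded_borel_indicator I)+
    then have "x = (\<Sum>i<k. L (\<lambda>\<sigma>. sgn (f (p (Suc i)) - f (p i)) * d i \<sigma>))"
      unfolding x by (simp add: sigma_functional_cmult[OF L d]) (simp add: abs_sgn mult.commute)
    also have "\<dots> = L h"
      unfolding h_def by (rule sigma_functional_sum[OF L, symmetric]) (rule bounded_borel_cmult[OF d])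
    also have "\<bar>L h\<bar> \<le> K"
    proof (rule bound)
      show "h \<in> borel_measurable borel"
        unfolding h_def by (intro bounded_borel_measurable[OF bounded_borel_sum] bounded_borel_cmult d)
      fix \<sigma> :: real
      have "\<bar>h \<sigma>\<bar> \<le> (\<Sum>i<k. d i \<sigma>)"
        unfolding h_def
      proof (rule order_trans[OF sum_abs sum_mono])
        fix i assume "i \<in> {..<k}"
        then have "I (p i) \<subseteq> I (p (Suc i))" using p by (intro mono) auto
        then have "0 \<le> d i \<sigma>" by (auto simp: d_def indicator_def)
        then show "\<bar>sgn (f (p (Suc i)) - f (p i)) * d i \<sigma>\<bar> \<le> d i \<sigma>"
          by (auto simp: abs_mult sgn_real_def)
      qed
      also have "\<dots> = indicator (I (p k)) \<sigma> - indicator (I (p 0)) \<sigma>"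
        unfolding d_def by (rule sum_lessThan_telescope)
      also have "\<dots> \<le> 1" by (auto simp: indicator_def)
      finally show "\<bar>h \<sigma>\<bar> \<le> 1" .
    qed
    finally show "x \<le> K" by linarith
  qed
  moreover have "f 0 = 0"
    using sigma_functional_cmult[OF L, of "\<lambda>_. 0" 0] by (simp add: f_def I_def indicator_def[abs_def])
  moreover have "continuous (at_right t) f" if t: "t \<in> {0<..<1}" for t
    unfolding continuous_within
  proof (rule tendsto_at_right_sequentially[of t 1])
    fix S :: "nat \<Rightarrow> real"
    assume S: "\<And>n. t < S n" "\<And>n. S n < 1" "decseq S" "S \<longlonglongrightarrow> t"
    show "(\<lambda>n. f (S n)) \<longlonglongrightarrow> f t"
      unfolding f_def
    proof (rule sigma_functional_tendsto[OF L, where B = 1])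
      fix \<sigma> :: real
      show "(\<lambda>n. indicator (I (S n)) \<sigma> :: real) \<longlonglongrightarrow> indicator (I t) \<sigma>"
      proof (cases "0 \<le> \<sigma> \<and> t < \<sigma>")
        case True
        have "\<forall>\<^sub>F n in sequentially. S n < \<sigma>" using True by (intro order_tendstoD(2)[OF S(4)]) auto
        then have "\<forall>\<^sub>F n in sequentially. indicator (I (S n)) \<sigma> = (indicator (I t) \<sigma> :: real)"
          by eventually_elim (use True in \<open>auto simp: indicator_def I_def\<close>)
        then show ?thesis by (rule tendsto_eventually)
      next
        case False
        then have "indicator (I (S n)) \<sigma> = (indicator (I t) \<sigma> :: real)" for n
          using t S(1)[of n] by (auto simp: indicator_def I_def)
        then show ?thesis by simp
      qed
    qed (use I in \<open>auto simp: indicator_def\<close>)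
  qed (use t in auto)
  ultimately have f: "f \<in> NBV" by (simp add: NBV_def)
  moreover have "scalar_stieltjes f g = L g" if "bounded_borel g" for g
    by (rule scalar_stieltjes_eqI[where L = L, OF f L _ that]) (simp add: f_def I_def)
  ultimately show ?thesis by (rule that)
qed

section \<open>Stieltjes integrals with parameters\<close>

lemma measurable_pair_unit_interval:
  assumes "sets \<mu> = sets (restrict_space borel {0..1::real})"
    and "case_prod h \<in> borel_measurable (N \<Otimes>\<^sub>M borel)"
  shows "case_prod h \<in> borel_measurable (N \<Otimes>\<^sub>M \<mu>)"
proof -
  have "(\<lambda>x. x) \<in> measurable \<mu> borel"
    by (rule measurable_from_unit_interval[OF assms(1)]) simp
  then have "(\<lambda>p. (fst p, snd p)) \<in> measurable (N \<Otimes>\<^sub>M \<mu>) (N \<Otimes>\<^sub>M borel)"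
    by (intro measurable_Pair measurable_fst measurable_compose[OF measurable_snd])
  from measurable_compose[OF this assms(2)] show ?thesis by (simp add: case_prod_beta)
qed

lemma scalar_stieltjes_measurable:
  fixes h :: "'a \<Rightarrow> real \<Rightarrow> 'b::euclidean_space"
  assumes f: "f \<in> NBV" and h: "case_prod h \<in> borel_measurable (N \<Otimes>\<^sub>M borel)"
  shows "(\<lambda>s. scalar_stieltjes f (h s)) \<in> borel_measurable N"
proof -
  obtain \<mu> \<nu> where \<mu>: "finite_measure \<mu>" "sets \<mu> = sets (restrict_space borel {0..1})"
    and \<nu>: "finite_measure \<nu>" "sets \<nu> = sets (restrict_space borel {0..1})"
    and p: "\<And>g :: real \<Rightarrow> 'b. scalar_stieltjes f g = integral\<^sup>L \<mu> g - integral\<^sup>L \<nu> g"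
    by (rule scalar_stieltjes_pair[OF f]) blast
  interpret \<mu>: finite_measure \<mu> by fact
  interpret \<nu>: finite_measure \<nu> by fact
  show ?thesis
    unfolding p
    by (rule borel_measurable_diff[OF
          \<mu>.borel_measurable_lebesgue_integral[OF measurable_pair_unit_interval[OF \<mu>(2) h]]
          \<nu>.borel_measurable_lebesgue_integral[OF measurable_pair_unit_interval[OF \<nu>(2) h]]])
qed

lemma Fubini_unit_interval:
  fixes h :: "real \<Rightarrow> real \<Rightarrow> 'a::euclidean_space"
  assumes m: "finite_measure m" "sets m = sets (restrict_space borel {0..1})"
    and h: "case_prod h \<in> borel_measurable (borel \<Otimes>\<^sub>M borel)"
    and w: "integrable lborel w" "\<And>s \<sigma>. \<sigma> \<in> {0..1} \<Longrightarrow> norm (h s \<sigma>) \<le> w s"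
  shows "integrable lborel (\<lambda>s. \<integral>\<sigma>. h s \<sigma> \<partial>m)" "integrable m (\<lambda>\<sigma>. \<integral>s. h s \<sigma> \<partial>lborel)"
    "(\<integral>s. (\<integral>\<sigma>. h s \<sigma> \<partial>m) \<partial>lborel) = (\<integral>\<sigma>. (\<integral>s. h s \<sigma> \<partial>lborel) \<partial>m)"
proof -
  interpret m: finite_measure m by fact
  interpret pair_sigma_finite lborel m ..
  note sp = space_unit_interval[OF m(2)]
  have hl: "case_prod h \<in> borel_measurable (lborel \<Otimes>\<^sub>M borel)"
    using h by (simp cong: measurable_cong_sets)
  have hm[measurable]: "case_prod h \<in> borel_measurable (lborel \<Otimes>\<^sub>M m)"
    by (rule measurable_pair_unit_interval[OF m(2) hl])
  have int: "integrable m (h s)" for s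
  proof (rule integrable_on_unit_interval[OF m])
    have "(\<lambda>\<sigma>. case_prod h (s, \<sigma>)) \<in> borel_measurable borel"
      by (rule measurable_compose[OF measurable_Pair1' hl]) simp
    then show "bounded_borel (h s)" using w(2) by (intro bounded_borelI[of _ "w s"]) auto
  qed
  have "integrable (lborel \<Otimes>\<^sub>M m) (case_prod h)"
  proof (rule Fubini_integrable[OF hm])
    have w0: "0 \<le> w s" for s by (rule order_trans[OF norm_ge_zero w(2)[of 0 s]]) simp
    show "integrable lborel (\<lambda>s. \<integral>\<sigma>. norm (case_prod h (s, \<sigma>)) \<partial>m)"
    proof (rule Bochner_Integration.integrable_bound[where f = "\<lambda>s. measure m (space m) * w s"])
      show "integrable lborel (\<lambda>s. measure m (space m) * w s)" using w(1) by simp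
      show "(\<lambda>s. \<integral>\<sigma>. norm (case_prod h (s, \<sigma>)) \<partial>m) \<in> borel_measurable lborel" by measurable
      have "norm (\<integral>\<sigma>. norm (h s \<sigma>) \<partial>m) \<le> (\<integral>\<sigma>. w s \<partial>m)" for s
        by (rule Bochner_Integration.integral_norm_bound_integral) (use int[of s] w sp in auto)
      then show "AE s in lborel. norm (\<integral>\<sigma>. norm (case_prod h (s, \<sigma>)) \<partial>m) \<le> norm (measure m (space m) * w s)"
        using w0 by (auto simp: sp abs_mult)
    qed
  qed (simp add: int)
  then show "integrable lborel (\<lambda>s. \<integral>\<sigma>. h s \<sigma> \<partial>m)" "integrable m (\<lambda>\<sigma>. \<integral>s. h s \<sigma> \<partial>lborel)"
    "(\<integral>s. (\<integral>\<sigma>. h s \<sigma> \<partial>m) \<partial>lborel) = (\<integral>\<sigma>. (\<integral>s. h s \<sigma> \<partial>lborel) \<partial>m)"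
    using integrable_fst integrable_snd Fubini_integral[of h] by simp_all
qed

text \<open>The measures representing the Stieltjes integral are finite, so a majorant integrable in \<open>s\<close> is
  integrable on the product.\<close>

lemma scalar_stieltjes_Fubini:
  fixes h :: "real \<Rightarrow> real \<Rightarrow> 'a::euclidean_space"
  assumes f: "f \<in> NBV" and h: "case_prod h \<in> borel_measurable (borel \<Otimes>\<^sub>M borel)"
    and w: "integrable lborel w" "\<And>s \<sigma>. \<sigma> \<in> {0..1} \<Longrightarrow> norm (h s \<sigma>) \<le> w s"
  shows "integrable lborel (\<lambda>s. scalar_stieltjes f (h s))"
    "(\<integral>s. scalar_stieltjes f (h s) \<partial>lborel) = scalar_stieltjes f (\<lambda>\<sigma>. \<integral>s. h s \<sigma> \<partial>lborel)"
proof -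
  obtain \<mu> \<nu> where \<mu>: "finite_measure \<mu>" "sets \<mu> = sets (restrict_space borel {0..1})"
    and \<nu>: "finite_measure \<nu>" "sets \<nu> = sets (restrict_space borel {0..1})"
    and p: "\<And>g :: real \<Rightarrow> 'a. scalar_stieltjes f g = integral\<^sup>L \<mu> g - integral\<^sup>L \<nu> g"
    by (rule scalar_stieltjes_pair[OF f]) blast
  note F = Fubini_unit_interval[OF \<mu> h w] Fubini_unit_interval[OF \<nu> h w]
  show "integrable lborel (\<lambda>s. scalar_stieltjes f (h s))"
    "(\<integral>s. scalar_stieltjes f (h s) \<partial>lborel) = scalar_stieltjes f (\<lambda>\<sigma>. \<integral>s. h s \<sigma> \<partial>lborel)"
    unfolding p using F by simp_all
qed

lemma scalar_stieltjes_cmult_of_real: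
  assumes "f \<in> NBV" "bounded_borel g"
  shows "scalar_stieltjes f (\<lambda>\<sigma>. c * complex_of_real (g \<sigma>)) = c * complex_of_real (scalar_stieltjes f g)"
  by (rule scalar_stieltjes_bounded_linear[OF assms])
     (intro bounded_linear_mult_right[THEN bounded_linear_compose] bounded_linear_of_real)

section \<open>The pairings in coordinates\<close>

lemma sum_Basis_vec:
  fixes F :: "'a::euclidean_space ^ 'n \<Rightarrow> 'b::comm_monoid_add"
  shows "(\<Sum>b\<in>Basis. F b) = (\<Sum>i\<in>UNIV. \<Sum>u\<in>Basis. F (axis i u))"
proof -
  have "(Basis :: ('a ^ 'n) set) = (\<Union>i\<in>UNIV. (\<lambda>u. axis i u) ` Basis)"
    by (auto simp: Basis_vec_def)
  moreover have "sum F (\<Union>i\<in>UNIV. (\<lambda>u. axis i u) ` Basis) = (\<Sum>i\<in>UNIV. sum F ((\<lambda>u. axis i u) ` Basis))"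
    by (rule sum.UNION_disjoint) (auto simp: axis_eq_axis nonzero_Basis)
  moreover have "sum F ((\<lambda>u. axis i u) ` Basis) = (\<Sum>u\<in>Basis. F (axis i u))" for i
    by (subst sum.reindex) (auto simp: inj_on_def axis_eq_axis)
  ultimately show ?thesis by simp
qed

lemma sum_axis_nth:
  fixes a :: "'n::finite \<Rightarrow> 'a::comm_monoid_add"
  shows "(\<Sum>k\<in>UNIV. axis k (a k) $ j) = a j"
  by (simp add: axis_def if_distrib if_distribR cong: if_cong)

lemma bounded_linear_axis: "bounded_linear (axis k :: real \<Rightarrow> real ^ 'n)"
  by (intro linear_conv_bounded_linear[THEN iffD1] linearI) (auto simp: axis_def vec_eq_iff)

lemma norm_fn_le: "norm (fn y \<theta>) \<le> norm y"
proof (cases "\<theta> \<in> {-1..0}")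
  case True
  then show ?thesis unfolding norm_bborel_def by (intro cSUP_upper bdd_above_fn)
next
  case False
  then show ?thesis by (simp add: fn_outside)
qed

lemma norm_bborel_leI: "(\<And>\<theta>. \<theta> \<in> {-1..0} \<Longrightarrow> norm (fn y \<theta>) \<le> B) \<Longrightarrow> norm y \<le> B"
  unfolding norm_bborel_def by (intro cSUP_least) auto

lemma bborel_eqI:
  assumes "\<And>\<theta>. \<theta> \<in> {-1..0} \<Longrightarrow> fn y \<theta> = fn z \<theta>"
  shows "y = z"
  by (rule fn_inject[THEN iffD1], rule ext) (metis assms fn_outside)

lemma bounded_borel_fn: "bounded_borel (\<lambda>\<sigma>. fn y (- \<sigma>))"
proof (rule bounded_borelI[of _ "norm y"])
  show "(\<lambda>\<sigma>. fn y (- \<sigma>)) \<in> borel_measurable borel"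
    by (rule measurable_compose[OF _ measurable_fn]) simp
qed (rule norm_fn_le)

lemma bounded_borel_nth: "bounded_borel g \<Longrightarrow> bounded_borel (\<lambda>\<sigma>. g \<sigma> $ k)"
  by (rule bounded_borel_linear[OF bounded_linear_vec_nth])

lemma NBV_nth: "f \<in> NBV \<Longrightarrow> (\<lambda>\<sigma>. f \<sigma> $ k) \<in> NBV"
  by (rule NBV_bounded_linear[OF bounded_linear_vec_nth])

lemma pairing_eq:
  "pairing f y = (\<Sum>k\<in>UNIV. scalar_stieltjes (\<lambda>\<sigma>. f \<sigma> $ k) (\<lambda>\<sigma>. fn y (- \<sigma>) $ k))"
  unfolding pairing_def stieltjes_def sum_Basis_vec by (simp add: inner_axis inner_axis')

lemma cpairing_eq:
  assumes "f \<in> NBV"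
  shows "cpairing f y = (\<Sum>k\<in>UNIV. Complex
     (scalar_stieltjes (\<lambda>\<sigma>. Re (f \<sigma> $ k)) (\<lambda>\<sigma>. Re (fn y (- \<sigma>) $ k)) -
      scalar_stieltjes (\<lambda>\<sigma>. Im (f \<sigma> $ k)) (\<lambda>\<sigma>. Im (fn y (- \<sigma>) $ k)))
     (scalar_stieltjes (\<lambda>\<sigma>. Re (f \<sigma> $ k)) (\<lambda>\<sigma>. Im (fn y (- \<sigma>) $ k)) +
      scalar_stieltjes (\<lambda>\<sigma>. Im (f \<sigma> $ k)) (\<lambda>\<sigma>. Re (fn y (- \<sigma>) $ k))))"
proof -
  have n: "(\<lambda>\<sigma>. f \<sigma> $ k) \<in> NBV" for k by (rule NBV_nth[OF assms])
  have r: "(\<lambda>\<sigma>. Re (f \<sigma> $ k)) \<in> NBV" and i: "(\<lambda>\<sigma>. Im (f \<sigma> $ k)) \<in> NBV" for k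
    by (rule NBV_bounded_linear[OF bounded_linear_Re n] NBV_bounded_linear[OF bounded_linear_Im n])+
  have b: "bounded_borel (\<lambda>\<sigma>. fn y (- \<sigma>) $ k)" for k by (rule bounded_borel_nth[OF bounded_borel_fn])
  have prd: "(\<Sum>j\<in>UNIV. axis k c $ j * v $ j) = c * v $ k" for k and c :: complex and v :: "complex ^ 'n"
    by (simp add: axis_def if_distrib if_distribR cong: if_cong)
  have "scalar_stieltjes (\<lambda>\<sigma>. Re (f \<sigma> $ k)) (\<lambda>\<sigma>. fn y (- \<sigma>) $ k) +
      scalar_stieltjes (\<lambda>\<sigma>. Im (f \<sigma> $ k)) (\<lambda>\<sigma>. \<i> * fn y (- \<sigma>) $ k) =
    Complex
     (scalar_stieltjes (\<lambda>\<sigma>. Re (f \<sigma> $ k)) (\<lambda>\<sigma>. Re (fn y (- \<sigma>) $ k)) -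
      scalar_stieltjes (\<lambda>\<sigma>. Im (f \<sigma> $ k)) (\<lambda>\<sigma>. Im (fn y (- \<sigma>) $ k)))
     (scalar_stieltjes (\<lambda>\<sigma>. Re (f \<sigma> $ k)) (\<lambda>\<sigma>. Im (fn y (- \<sigma>) $ k)) +
      scalar_stieltjes (\<lambda>\<sigma>. Im (f \<sigma> $ k)) (\<lambda>\<sigma>. Re (fn y (- \<sigma>) $ k)))" for k
  proof -
    have "scalar_stieltjes (\<lambda>\<sigma>. Im (f \<sigma> $ k)) (\<lambda>\<sigma>. \<i> * fn y (- \<sigma>) $ k) =
        \<i> * scalar_stieltjes (\<lambda>\<sigma>. Im (f \<sigma> $ k)) (\<lambda>\<sigma>. fn y (- \<sigma>) $ k)"
      by (rule scalar_stieltjes_bounded_linear[OF i b bounded_linear_mult_right])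
    then show ?thesis
      by (simp add: complex_eq_iff scalar_stieltjes_complex[OF r b] scalar_stieltjes_complex[OF i b])
  qed
  then show ?thesis
    unfolding cpairing_def stieltjes_def sum_Basis_vec
    by (simp add: inner_axis Basis_complex_def prd cong: if_cong)
qed

lemma pairing_tendsto:
  assumes f: "f \<in> NBV" and "\<And>m. norm (Y m) \<le> B"
    and "\<And>\<theta>. \<theta> \<in> {-1..0} \<Longrightarrow> (\<lambda>m. fn (Y m) \<theta>) \<longlonglongrightarrow> fn y \<theta>"
  shows "(\<lambda>m. pairing f (Y m)) \<longlonglongrightarrow> pairing f y"
  unfolding pairing_eq
proof (intro tendsto_sum sigma_functional_tendsto[OF sigma_functional_scalar_stieltjes(1)[OF NBV_nth[OF f]]])
  fix k m show "(\<lambda>\<sigma>. fn (Y m) (- \<sigma>) $ k) \<in> borel_measurable borel"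
    "(\<lambda>\<sigma>. fn y (- \<sigma>) $ k) \<in> borel_measurable borel"
    by (rule bounded_borel_measurable[OF bounded_borel_nth[OF bounded_borel_fn]])+
  show "\<bar>fn (Y m) (- \<sigma>) $ k\<bar> \<le> B" for \<sigma>
    using component_le_norm_cart[of "fn (Y m) (- \<sigma>)" k] norm_fn_le[of "Y m" "- \<sigma>"] assms(2)[of m]
    by simp
  show "(\<lambda>m. fn (Y m) (- \<sigma>) $ k) \<longlonglongrightarrow> fn y (- \<sigma>) $ k" if "\<sigma> \<in> {0..1}" for \<sigma>
    by (rule tendsto_vec_nth[OF assms(3)]) (use that in auto)
qed

lemma pairing_linear:
  assumes f: "f \<in> NBV"
  shows "linear (pairing f)"
proof (rule linearI)
  note S = sigma_functional_scalar_stieltjes(1)[OF NBV_nth[OF f]]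
  note b = bounded_borel_nth[OF bounded_borel_fn]
  show "pairing f (x + y) = pairing f x + pairing f y" for x y
    unfolding pairing_eq plus_bborel.rep_eq
    by (simp add: sigma_functional_add[OF S b b] sum.distrib)
  show "pairing f (c *\<^sub>R x) = c *\<^sub>R pairing f x" for c x
    unfolding pairing_eq scaleR_bborel.rep_eq
    by (simp add: sigma_functional_cmult[OF S b] sum_distrib_left)
qed

text \<open>The dimension enters because the total variation of each coordinate is estimated by that of the
  whole function.\<close>

lemma pairing_bound:
  fixes f :: "real \<Rightarrow> real ^ 'n"
  assumes f: "f \<in> NBV"
  shows "\<bar>pairing f y\<bar> \<le> CARD('n) * total_variation f * norm y"
proof -
  have "\<bar>pairing f y\<bar> \<le> (\<Sum>k\<in>(UNIV::'n set). total_variation f * norm y)"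
    unfolding pairing_eq
  proof (rule order_trans[OF sum_abs sum_mono])
    fix k :: 'n
    have "\<bar>scalar_stieltjes (\<lambda>\<sigma>. f \<sigma> $ k) (\<lambda>\<sigma>. fn y (- \<sigma>) $ k)\<bar> \<le> total_variation (\<lambda>\<sigma>. f \<sigma> $ k) * norm y"
    proof (rule scalar_stieltjes_bound[OF NBV_nth[OF f] bounded_borel_measurable[OF bounded_borel_nth[OF bounded_borel_fn]]])
      show "\<bar>fn y (- \<sigma>) $ k\<bar> \<le> norm y" for \<sigma>
        using component_le_norm_cart[of "fn y (- \<sigma>)" k] norm_fn_le[of y "- \<sigma>"] by simp
    qed
    also have "total_variation (\<lambda>\<sigma>. f \<sigma> $ k) \<le> total_variation f"
    proof (rule total_variation_contraction[OF f])
      show "norm (f s $ k - f t $ k) \<le> norm (f s - f t)" for s t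
        using component_le_norm_cart[of "f s - f t" k] by simp
    qed
    finally show "\<bar>scalar_stieltjes (\<lambda>\<sigma>. f \<sigma> $ k) (\<lambda>\<sigma>. fn y (- \<sigma>) $ k)\<bar> \<le> total_variation f * norm y"
      by (simp add: mult_right_mono)
  qed
  then show ?thesis by simp
qed

section \<open>Functionals on spaces of bounded Borel functions\<close>

text \<open>The analogue of \<open>sigma_functional\<close> on the space of initial segments.\<close>

definition sigma_continuous :: "((real ^ 'n) bborel \<Rightarrow> 'b::real_normed_vector) \<Rightarrow> bool" where
  "sigma_continuous F \<longleftrightarrow> linear F \<and>
     (\<forall>Y y B. (\<forall>m. norm (Y m) \<le> B) \<longrightarrow> (\<forall>\<theta>\<in>{-1..0}. (\<lambda>m. fn (Y m) \<theta>) \<longlonglongrightarrow> fn y \<theta>) \<longrightarrow>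
        (\<lambda>m. F (Y m)) \<longlonglongrightarrow> F y)"

lemma sigma_continuous_tendsto:
  assumes F: "sigma_continuous F" and "\<And>m. norm (Y m) \<le> B"
    "\<And>\<theta>. \<theta> \<in> {-1..0} \<Longrightarrow> (\<lambda>m. fn (Y m) \<theta>) \<longlonglongrightarrow> fn y \<theta>"
  shows "(\<lambda>m. F (Y m)) \<longlonglongrightarrow> F y"
  using F[unfolded sigma_continuous_def, THEN conjunct2, rule_format, of Y B y]
    assms(2,3) by blast

lemma sigma_continuous_bounded_linear:
  assumes "sigma_continuous F" "bounded_linear T"
  shows "sigma_continuous (\<lambda>y. T (F y))"
proof -
  interpret T: bounded_linear T by fact
  have "linear (\<lambda>y. T (F y))"
    using linear_compose[of F T] assms(1) T.linear_axioms by (simp add: sigma_continuous_def o_def)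
  moreover have "(\<lambda>m. T (F (Y m))) \<longlonglongrightarrow> T (F y)"
    if "\<forall>m. norm (Y m) \<le> B" "\<forall>\<theta>\<in>{-1..0}. (\<lambda>m. fn (Y m) \<theta>) \<longlonglongrightarrow> fn y \<theta>" for Y y B
    by (rule T.tendsto) (use that in \<open>blast intro: sigma_continuous_tendsto[OF assms(1)]\<close>)
  ultimately show ?thesis unfolding sigma_continuous_def by metis
qed

lemma fn_component:
  assumes "bounded_borel g"
  shows "fn (bborel_of (\<lambda>\<theta>. axis k (g (- \<theta>)))) = (\<lambda>\<theta>. if \<theta> \<in> {-1..0} then axis k (g (- \<theta>)) else (0 :: real ^ 'n))"
proof (rule fn_bborel_of)
  have b: "bounded_borel (\<lambda>\<sigma>. axis k (g \<sigma>) :: real ^ 'n)"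
    by (rule bounded_borel_linear[OF bounded_linear_axis assms])
  have "(\<lambda>\<theta>. axis k (g (- \<theta>)) :: real ^ 'n) \<in> borel_measurable borel"
    by (rule measurable_compose[OF _ bounded_borel_measurable[OF b]]) simp
  then show "(\<lambda>\<theta>. axis k (g (- \<theta>)) :: real ^ 'n) \<in> borel_measurable (restrict_space borel {-1..0})"
    by (rule measurable_restrict_space1)
  obtain B where "\<And>\<sigma>. \<sigma> \<in> {0..1} \<Longrightarrow> norm (axis k (g \<sigma>) :: real ^ 'n) \<le> B"
    using b by (rule bounded_borelE) blast
  then show "bounded ((\<lambda>\<theta>. axis k (g (- \<theta>)) :: real ^ 'n) ` {-1..0})"
    by (intro boundedI[of _ B]) auto
qed

text \<open>Each coordinate \<open>k\<close> of the representing function comes from the scalar functional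
  \<open>g \<mapsto> F(g(- \<sigma>) e\<^sub>k)\<close>, and an element of the space is the sum of its coordinate parts.\<close>

lemma pairing_representation:
  fixes F :: "(real ^ 'n) bborel \<Rightarrow> real"
  assumes F: "sigma_continuous F"
  obtains g where "g \<in> NBV" "\<And>y. F y = pairing g y"
proof -
  have lin: "linear F" using F by (simp add: sigma_continuous_def)
  note lim = sigma_continuous_tendsto[OF F]
  define E where "E k g = bborel_of (\<lambda>\<theta>. axis k (g (- \<theta>)) :: real ^ 'n)" for k g
  have E: "fn (E k g) = (\<lambda>\<theta>. if \<theta> \<in> {-1..0} then axis k (g (- \<theta>)) else 0)" if "bounded_borel g" for k g
    unfolding E_def by (rule fn_component[OF that])
  have ax: "axis k (x + y) = axis k x + axis k y" "axis k (c * x) = c *\<^sub>R axis k x" for k and x y c :: real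
    by (auto simp: axis_def vec_eq_iff)
  have na: "norm (axis k c :: real ^ 'n) = \<bar>c\<bar>" for k c
    by (simp add: norm_eq_sqrt_inner inner_axis_axis)
  have nE: "norm (E k g) \<le> B" if "bounded_borel g" "\<And>\<sigma>. \<sigma> \<in> {0..1} \<Longrightarrow> \<bar>g \<sigma>\<bar> \<le> B" for k g B
    by (rule norm_bborel_leI) (use that in \<open>auto simp: E na\<close>)
  have sf: "sigma_functional (\<lambda>g. F (E k g))" for k
    unfolding sigma_functional_def
  proof (intro conjI allI impI)
    fix g h :: "real \<Rightarrow> real" assume g: "bounded_borel g" and h: "bounded_borel h"
    have "E k (\<lambda>\<sigma>. g \<sigma> + h \<sigma>) = E k g + E k h"
      by (rule bborel_eqI) (simp add: E g h bounded_borel_add plus_bborel.rep_eq ax)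
    then show "F (E k (\<lambda>\<sigma>. g \<sigma> + h \<sigma>)) = F (E k g) + F (E k h)" by (simp add: linear_add[OF lin])
  next
    fix c and g :: "real \<Rightarrow> real" assume g: "bounded_borel g"
    have "E k (\<lambda>\<sigma>. c * g \<sigma>) = c *\<^sub>R E k g"
      by (rule bborel_eqI) (simp add: E g bounded_borel_cmult scaleR_bborel.rep_eq ax)
    then show "F (E k (\<lambda>\<sigma>. c * g \<sigma>)) = c * F (E k g)" by (simp add: linear_scale[OF lin])
  next
    fix G :: "nat \<Rightarrow> real \<Rightarrow> real" and g B
    assume G: "\<forall>n. G n \<in> borel_measurable borel" "\<forall>n. \<forall>\<sigma>\<in>{0..1}. \<bar>G n \<sigma>\<bar> \<le> B"
      and g: "g \<in> borel_measurable borel" "\<forall>\<sigma>\<in>{0..1}. (\<lambda>n. G n \<sigma>) \<longlonglongrightarrow> g \<sigma>"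
    have bG: "bounded_borel (G n)" for n by (rule bounded_borelI[of _ B]) (use G in auto)
    have "\<bar>g \<sigma>\<bar> \<le> B" if "\<sigma> \<in> {0..1}" for \<sigma>
      by (rule LIMSEQ_le_const2[of "\<lambda>n. \<bar>G n \<sigma>\<bar>"]) (use g(2) G(2) that in \<open>auto intro: tendsto_rabs\<close>)
    then have bg: "bounded_borel g" using g(1) by (intro bounded_borelI[of g B]) auto
    show "(\<lambda>n. F (E k (G n))) \<longlonglongrightarrow> F (E k g)"
    proof (rule lim)
      show "norm (E k (G n)) \<le> B" for n by (rule nE[OF bG]) (use G in auto)
      show "(\<lambda>n. fn (E k (G n)) \<theta>) \<longlonglongrightarrow> fn (E k g) \<theta>" if "\<theta> \<in> {-1..0}" for \<theta>
        using g(2) that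
        by (auto simp: E bG bg axis_def vec_eq_iff intro!: vec_tendstoI)
    qed
  qed
  have "\<exists>f. f \<in> NBV \<and> (\<forall>g. bounded_borel g \<longrightarrow> scalar_stieltjes f g = F (E k g))" for k
    by (rule sigma_functional_representation[OF sf]) blast
  then obtain f where f: "\<And>k. f k \<in> NBV" "\<And>k g. bounded_borel g \<Longrightarrow> scalar_stieltjes (f k) g = F (E k g)"
    by metis
  have "(\<lambda>t. \<Sum>k\<in>UNIV. axis k (f k t)) \<in> NBV"
    by (intro NBV_sum NBV_bounded_linear[OF bounded_linear_axis] f(1))
  moreover have "F y = pairing (\<lambda>t. \<Sum>k\<in>UNIV. axis k (f k t)) y" for y
  proof -
    have b: "bounded_borel (\<lambda>\<sigma>. fn y (- \<sigma>) $ k)" for k by (rule bounded_borel_nth[OF bounded_borel_fn])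
    have fs: "fn (\<Sum>k\<in>A. h k) \<theta> = (\<Sum>k\<in>A. fn (h k) \<theta>)" for A :: "'n set" and h :: "'n \<Rightarrow> (real ^ 'n) bborel" and \<theta>
      by (induction A rule: infinite_finite_induct) (simp_all add: zero_bborel.rep_eq plus_bborel.rep_eq)
    have "y = (\<Sum>k\<in>UNIV. E k (\<lambda>\<sigma>. fn y (- \<sigma>) $ k))"
      by (rule bborel_eqI) (simp add: fs E b vec_eq_iff sum_axis_nth)
    then have "F y = (\<Sum>k\<in>UNIV. F (E k (\<lambda>\<sigma>. fn y (- \<sigma>) $ k)))"
      using linear_sum[OF lin] by metis
    then show ?thesis unfolding pairing_eq by (simp add: f(2) b sum_axis_nth)
  qed
  ultimately show ?thesis using that by blast
qed

text \<open>Bilinearity of the complex pairing: on real elements its real and imaginary parts are the pairings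
  with the real and imaginary parts of the function of bounded variation.\<close>

lemma cpairing_cfn:
  fixes p q :: "real \<Rightarrow> real ^ 'n"
  assumes p: "p \<in> NBV" and q: "q \<in> NBV"
  shows "(\<lambda>t. \<chi> k. Complex (p t $ k) (q t $ k)) \<in> NBV" (is "?f \<in> NBV")
    and "cpairing (\<lambda>t. \<chi> k. Complex (p t $ k) (q t $ k)) (cfn y) = Complex (pairing p y) (pairing q y)"
proof -
  have lin: "bounded_linear (\<lambda>v :: real ^ 'n. \<chi> k. c * complex_of_real (v $ k))" for c
    by (intro linear_conv_bounded_linear[THEN iffD1] linearI)
       (simp_all add: vec_eq_iff complex_eq_iff algebra_simps)
  have "(\<lambda>t. (\<chi> k. 1 * complex_of_real (p t $ k)) + (\<chi> k. \<i> * complex_of_real (q t $ k))) \<in> NBV"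
    by (intro NBV_add NBV_bounded_linear[OF lin] p q)
  also have "(\<lambda>t. (\<chi> k. 1 * complex_of_real (p t $ k)) + (\<chi> k. \<i> * complex_of_real (q t $ k))) = ?f"
    by (auto simp: vec_eq_iff complex_eq_iff)
  finally show f: "?f \<in> NBV" .
  have z: "scalar_stieltjes h (\<lambda>_. 0::real) = 0" if "h \<in> NBV" for h
    using sigma_functional_cmult[OF sigma_functional_scalar_stieltjes(1)[OF that], of "\<lambda>_. 0" 0] by simp
  show "cpairing ?f (cfn y) = Complex (pairing p y) (pairing q y)"
    unfolding cpairing_eq[OF f] pairing_eq
    by (simp add: fn_cfn cvec_def z NBV_nth p q complex_eq_iff)
qed

lemma cpairing_representation:
  fixes F :: "(real ^ 'n) bborel \<Rightarrow> complex"
  assumes F: "sigma_continuous F"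
  obtains g where "g \<in> NBV" "\<And>y. F y = cpairing g (cfn y)"
proof -
  obtain p where p: "p \<in> NBV" "\<And>y. Re (F y) = pairing p y"
    by (rule pairing_representation[OF sigma_continuous_bounded_linear[OF F bounded_linear_Re]]) blast
  obtain q where q: "q \<in> NBV" "\<And>y. Im (F y) = pairing q y"
    by (rule pairing_representation[OF sigma_continuous_bounded_linear[OF F bounded_linear_Im]]) blast
  show ?thesis
    by (rule that[OF cpairing_cfn(1)[OF p(1) q(1)]])
       (simp add: cpairing_cfn(2)[OF p(1) q(1)] p(2)[symmetric] q(2)[symmetric])
qed

lemma NBV_cvec: "f \<in> NBV \<Longrightarrow> (\<lambda>\<sigma>. cvec (f \<sigma>)) \<in> NBV"
  using cpairing_cfn(1)[OF _ NBV_zero, of f] by (simp add: cvec_def complex_of_real_def)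

lemma cpairing_cvec:
  fixes f :: "real \<Rightarrow> real ^ 'n"
  assumes f: "f \<in> NBV"
  shows "cpairing (\<lambda>\<sigma>. cvec (f \<sigma>)) y =
    (\<Sum>k\<in>UNIV. scalar_stieltjes (\<lambda>\<sigma>. f \<sigma> $ k) (\<lambda>\<sigma>. fn y (- \<sigma>) $ k))"
proof -
  have b: "bounded_borel (\<lambda>\<sigma>. fn y (- \<sigma>) $ k)" for k by (rule bounded_borel_nth[OF bounded_borel_fn])
  note b' = bounded_borel_linear[OF bounded_linear_Re b] bounded_borel_linear[OF bounded_linear_Im b]
  show ?thesis
    unfolding cpairing_eq[OF NBV_cvec[OF f]] scalar_stieltjes_complex[OF NBV_nth[OF f] b]
    by (simp add: cvec_def scalar_stieltjes_zero b')
qed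

lemma stieltjes_matrix_vector:
  fixes \<zeta> :: "real \<Rightarrow> real ^ 'n ^ 'm"
  assumes \<zeta>: "\<zeta> \<in> NBV" and g: "bounded_borel g"
  shows "stieltjes (*v) \<zeta> g = (\<chi> i. \<Sum>j\<in>UNIV. scalar_stieltjes (\<lambda>\<sigma>. \<zeta> \<sigma> $ i $ j) (\<lambda>\<sigma>. g \<sigma> $ j))"
proof -
  have mv: "axis i (axis j 1) *v v = axis i (v $ j)" for i :: 'm and j :: 'n and v :: "real ^ 'n"
  proof -
    have "(\<Sum>k\<in>UNIV. (if k = j then 1 else 0) * v $ k) = v $ j"
      by (simp add: if_distrib if_distribR cong: if_cong)
    then show ?thesis by (auto simp: matrix_vector_mult_def axis_def vec_eq_iff)
  qed
  have ax: "(\<Sum>j\<in>UNIV. axis i (a j)) = axis i (\<Sum>j\<in>UNIV. a j)" for i :: 'm and a :: "'n \<Rightarrow> real"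
    using linear_sum[OF bounded_linear.linear[OF bounded_linear_axis], of i a UNIV] by simp
  show ?thesis
    unfolding stieltjes_def sum_Basis_vec
    by (simp add: inner_axis mv ax vec_eq_iff sum_axis_nth
        scalar_stieltjes_bounded_linear[OF NBV_nth[OF NBV_nth[OF \<zeta>]] bounded_borel_nth[OF g] bounded_linear_axis])
qed

section \<open>Integrals over intervals\<close>

lemma set_integrable_Icc_bounded:
  fixes f :: "real \<Rightarrow> 'a::euclidean_space"
  assumes f: "f \<in> borel_measurable borel" and B: "\<And>s. s \<in> {a..b} \<Longrightarrow> norm (f s) \<le> B"
  shows "set_integrable lborel {a..b} f"
proof (rule set_integrable_bound[where f = "\<lambda>_. B"])
  show "set_integrable lborel {a..b} (\<lambda>_. B)"
    unfolding set_integrable_def by (intro integrable_scaleR_left integrable_real_indicator) (auto simp: emeasure_lborel_Icc_eq)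
  show "set_borel_measurable lborel {a..b} f"
    unfolding set_borel_measurable_def using f by simp
  show "AE x in lborel. x \<in> {a..b} \<longrightarrow> norm (f x) \<le> norm B"
    using B by (intro always_eventually) force
qed

lemma set_integral_Icc_split:
  fixes f :: "real \<Rightarrow> 'a::euclidean_space"
  assumes "set_integrable lborel {a..b} f" "a \<le> c" "c \<le> b"
  shows "(LBINT s:{a..b}. f s) = (LBINT s:{a..c}. f s) + (LBINT s:{c..b}. f s)"
proof -
  have "{a..b} = {a..c} \<union> {c..b}" using assms by auto
  moreover have "AE r in lborel. \<not> (r \<in> {a..c} \<and> r \<in> {c..b})"
    using AE_lborel_singleton[of c] by eventually_elim auto
  moreover have "set_integrable lborel {a..c} f" "set_integrable lborel {c..b} f"
    using assms by (auto intro: set_integrable_subset[OF assms(1)])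
  ultimately show ?thesis by (simp only:) (rule set_integral_Un_AE, simp_all)
qed

lemma set_integral_shift:
  fixes h :: "real \<Rightarrow> 'a::euclidean_space"
  shows "(LBINT s:{a..b}. h s) = (LBINT s:{a - c..b - c}. h (s + c))"
  unfolding set_lebesgue_integral_def
  by (subst lborel_integral_real_affine[where c = 1 and t = c])
     (auto intro!: Bochner_Integration.integral_cong simp: indicator_def algebra_simps)

lemma primitive_measurable:
  fixes v :: "real \<Rightarrow> 'a::euclidean_space"
  assumes [measurable]: "v \<in> borel_measurable borel"
  shows "(\<lambda>t. LBINT s:{0..t}. v s) \<in> borel_measurable borel"
proof -
  have "(\<lambda>(t, s). indicator {0..t} s *\<^sub>R v s) =
      (\<lambda>p. if 0 \<le> snd p \<and> snd p \<le> fst p then v (snd p) else 0)"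
    by (auto simp: indicator_def)
  also have "\<dots> \<in> borel_measurable (borel \<Otimes>\<^sub>M lborel)" by measurable
  finally show ?thesis
    unfolding set_lebesgue_integral_def by (rule lborel.borel_measurable_lebesgue_integral)
qed

lemma primitive_nonpos:
  fixes v :: "real \<Rightarrow> 'a::euclidean_space"
  assumes "t \<le> 0"
  shows "(LBINT s:{0..t}. v s) = 0"
proof -
  have "AE s in lborel. indicator {0..t} s *\<^sub>R v s = 0"
    using AE_lborel_singleton[of 0] by eventually_elim (use assms in \<open>auto simp: indicator_def\<close>)
  then show ?thesis unfolding set_lebesgue_integral_def by (rule integral_eq_zero_AE)
qed

lemma borel_measurable_vecI:
  fixes f :: "'b \<Rightarrow> 'a::euclidean_space ^ 'n"
  assumes "\<And>i. (\<lambda>x. f x $ i) \<in> borel_measurable M"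
  shows "f \<in> borel_measurable M"
  unfolding borel_measurable_euclidean_space[of f] using assms
  by (auto simp: Basis_vec_def inner_axis intro!: borel_measurable_inner)

lemma borel_measurable_vecD:
  fixes f :: "'b \<Rightarrow> 'a::euclidean_space ^ 'n"
  assumes "f \<in> borel_measurable M"
  shows "(\<lambda>x. f x $ i) \<in> borel_measurable M"
proof -
  have "(\<lambda>v :: 'a ^ 'n. v $ i) \<in> borel_measurable borel"
    by (intro borel_measurable_continuous_onI linear_continuous_on bounded_linear_vec_nth)
  from measurable_compose[OF assms this] show ?thesis .
qed

lemma total_variation_nonneg: "f \<in> NBV \<Longrightarrow> 0 \<le> total_variation f"
  unfolding total_variation_def by (rule cSup_upper) (auto simp: NBV_def variation_sums_zero)

section \<open>Functions bounded on left half-lines\<close>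

text \<open>The class in which the delay equation is solved: closed under the equation's integral operator,
  and with bounded delayed segments \<open>\<sigma> \<mapsto> x(s - \<sigma>)\<close>.\<close>

definition history :: "(real \<Rightarrow> 'a::euclidean_space) \<Rightarrow> bool" where
  "history x \<longleftrightarrow> x \<in> borel_measurable borel \<and> (\<forall>T. \<exists>B. \<forall>t\<le>T. norm (x t) \<le> B)"

lemma historyE:
  assumes "history x"
  obtains B where "0 \<le> B" "\<And>t. t \<le> T \<Longrightarrow> norm (x t) \<le> B"
proof -
  obtain B where B: "\<And>t. t \<le> T \<Longrightarrow> norm (x t) \<le> B" using assms unfolding history_def by blast
  from order_trans[OF norm_ge_zero B[OF order_refl]] B show ?thesis by (rule that)
qed

lemma history_bounded_borel:
  assumes "history x"
  shows "bounded_borel (\<lambda>\<sigma>. x (s - \<sigma>))"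
proof -
  obtain B where "\<And>t. t \<le> s \<Longrightarrow> norm (x t) \<le> B" using assms by (rule historyE) blast
  moreover have "(\<lambda>\<sigma>. x (s - \<sigma>)) \<in> borel_measurable borel"
    using assms unfolding history_def by (auto intro: measurable_compose[of _ _ borel])
  ultimately show ?thesis by (intro bounded_borelI[of _ B]) auto
qed

lemma history_add:
  assumes "history x" "history y" shows "history (\<lambda>t. x t + y t)"
  unfolding history_def
proof (intro conjI allI)
  show "(\<lambda>t. x t + y t) \<in> borel_measurable borel"
    using assms by (intro borel_measurable_add) (auto simp: history_def)
  fix T
  obtain A where A: "\<And>t. t \<le> T \<Longrightarrow> norm (x t) \<le> A" using assms(1) by (rule historyE) blast
  obtain B where B: "\<And>t. t \<le> T \<Longrightarrow> norm (y t) \<le> B" using assms(2) by (rule historyE) blast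
  show "\<exists>B. \<forall>t\<le>T. norm (x t + y t) \<le> B"
    by (intro exI[of _ "A + B"] allI impI norm_triangle_mono A B)
qed

lemma history_scale:
  assumes "history x" shows "history (\<lambda>t. c *\<^sub>R x t)"
  unfolding history_def
proof (intro conjI allI)
  show "(\<lambda>t. c *\<^sub>R x t) \<in> borel_measurable borel"
    using assms by (intro borel_measurable_scaleR) (auto simp: history_def)
  fix T
  obtain A where A: "\<And>t. t \<le> T \<Longrightarrow> norm (x t) \<le> A" using assms(1) by (rule historyE) blast
  show "\<exists>B. \<forall>t\<le>T. norm (c *\<^sub>R x t) \<le> B"
    using mult_left_mono[OF A abs_ge_zero[of c]] by (intro exI[of _ "\<bar>c\<bar> * A"]) simp
qed

lemma history_diff: "history x \<Longrightarrow> history y \<Longrightarrow> history (\<lambda>t. x t - y t)"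
  using history_add[OF _ history_scale[of y "-1"], of x] by simp

lemma historyI:
  assumes "x \<in> borel_measurable borel" "0 \<le> C" "0 \<le> \<gamma>" "\<And>t. norm (x t) \<le> C * exp (\<gamma> * t)"
  shows "history x"
  unfolding history_def
proof (intro conjI allI assms(1))
  fix T
  have "norm (x t) \<le> C * exp (\<gamma> * T)" if "t \<le> T" for t
    using assms(4)[of t] mult_left_mono[of "exp (\<gamma> * t)" "exp (\<gamma> * T)" C] mult_left_mono[OF that assms(3)] assms(2)
    by simp
  then show "\<exists>B. \<forall>t\<le>T. norm (x t) \<le> B" by blast
qed

lemma history_integrable:
  assumes "history x"
  shows "set_integrable lborel {a..b} x"
proof -
  obtain B where "\<And>t. t \<le> b \<Longrightarrow> norm (x t) \<le> B" using assms by (rule historyE) blast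
  with assms show ?thesis by (intro set_integrable_Icc_bounded[where B = B]) (auto simp: history_def)
qed

lemma history_primitive:
  fixes v :: "real \<Rightarrow> 'a::euclidean_space"
  assumes v: "history v"
  shows "history (\<lambda>t. LBINT s:{0..t}. v s)"
  unfolding history_def
proof (intro conjI allI)
  show "(\<lambda>t. LBINT s:{0..t}. v s) \<in> borel_measurable borel"
    by (rule primitive_measurable) (use v in \<open>simp add: history_def\<close>)
  fix T
  obtain B where B: "0 \<le> B" "\<And>t. t \<le> T \<Longrightarrow> norm (v t) \<le> B" using v by (rule historyE) blast
  have "norm (LBINT s:{0..t}. v s) \<le> B * max T 0" if "t \<le> T" for t
  proof (cases "0 \<le> t")
    case False
    then show ?thesis using B(1) by (simp add: set_lebesgue_integral_def)
  next
    case True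
    have "norm (LBINT s:{0..t}. v s) \<le> (LBINT s. indicator {0..t} s *\<^sub>R B)"
      unfolding set_lebesgue_integral_def
    proof (rule Bochner_Integration.integral_norm_bound_integral)
      show "integrable lborel (\<lambda>s. indicator {0..t} s *\<^sub>R v s)"
        using history_integrable[OF v] by (simp add: set_integrable_def)
      show "integrable lborel (\<lambda>s. indicator {0..t} s *\<^sub>R B)"
        by (intro integrable_scaleR_left integrable_real_indicator) (auto simp: emeasure_lborel_Icc_eq)
      show "norm (indicator {0..t} s *\<^sub>R v s) \<le> indicator {0..t} s *\<^sub>R B" for s
        using B(2)[of s] that by (auto simp: indicator_def)
    qed
    also have "\<dots> = t * B" using True by simp
    also have "\<dots> \<le> B * max T 0" using that B(1) by (simp add: mult.commute mult_left_mono le_max_iff_disj)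
    finally show ?thesis .
  qed
  then show "\<exists>B. \<forall>t\<le>T. norm (LBINT s:{0..t}. v s) \<le> B" by blast
qed

section \<open>Solutions of the delay equation\<close>

locale delay_equation =
  fixes \<zeta> :: "real \<Rightarrow> real ^ 'n ^ 'n"
  assumes NBV: "\<zeta> \<in> NBV"
begin

lemma NBV_entry: "(\<lambda>\<sigma>. \<zeta> \<sigma> $ i $ j) \<in> NBV"
  by (rule NBV_nth[OF NBV_nth[OF NBV]])

definition rhs :: "(real \<Rightarrow> real ^ 'n) \<Rightarrow> real ^ 'n" where
  "rhs g = stieltjes (*v) \<zeta> g"

lemma rhs_nth:
  "bounded_borel g \<Longrightarrow> rhs g $ i = (\<Sum>j\<in>UNIV. scalar_stieltjes (\<lambda>\<sigma>. \<zeta> \<sigma> $ i $ j) (\<lambda>\<sigma>. g \<sigma> $ j))"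
  unfolding rhs_def by (subst stieltjes_matrix_vector[OF NBV]) simp_all

lemma rhs_cong: "(\<And>\<sigma>. \<sigma> \<in> {0..1} \<Longrightarrow> g \<sigma> = h \<sigma>) \<Longrightarrow> rhs g = rhs h"
  unfolding rhs_def stieltjes_def
  by (intro sum.cong refl scalar_stieltjes_cong NBV_bounded_linear[OF bounded_linear_inner_left NBV]) simp

lemma rhs_add:
  assumes "bounded_borel g" "bounded_borel h"
  shows "rhs (\<lambda>\<sigma>. g \<sigma> + h \<sigma>) = rhs g + rhs h"
proof -
  note S = sigma_functional_scalar_stieltjes(1)[OF NBV_entry]
  show ?thesis
    by (simp add: vec_eq_iff rhs_nth assms bounded_borel_add sum.distrib
        sigma_functional_add[OF S] bounded_borel_nth)
qed

lemma bounded_borel_scale: "bounded_borel g \<Longrightarrow> bounded_borel (\<lambda>\<sigma>. c *\<^sub>R g \<sigma>)"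
  by (rule bounded_borel_linear[OF bounded_linear_scaleR_right])

lemma rhs_scale:
  assumes "bounded_borel g"
  shows "rhs (\<lambda>\<sigma>. c *\<^sub>R g \<sigma>) = c *\<^sub>R rhs g"
proof -
  note S = sigma_functional_scalar_stieltjes(1)[OF NBV_entry]
  show ?thesis
    by (simp add: vec_eq_iff rhs_nth assms bounded_borel_scale sum_distrib_left
        sigma_functional_cmult[OF S] bounded_borel_nth)
qed

definition "rhs_bound = (\<Sum>i\<in>(UNIV::'n set). \<Sum>j\<in>(UNIV::'n set). total_variation (\<lambda>\<sigma>. \<zeta> \<sigma> $ i $ j))"

lemma rhs_bound_nonneg: "0 \<le> rhs_bound"
  unfolding rhs_bound_def by (intro sum_nonneg total_variation_nonneg NBV_entry)

lemma norm_rhs_le: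
  assumes g: "g \<in> borel_measurable borel" and B: "\<And>\<sigma>. \<sigma> \<in> {0..1} \<Longrightarrow> norm (g \<sigma>) \<le> B"
  shows "norm (rhs g) \<le> rhs_bound * B"
proof -
  have b: "bounded_borel g" using g B by (rule bounded_borelI)
  have "norm (rhs g) \<le> (\<Sum>i\<in>UNIV. \<bar>rhs g $ i\<bar>)" by (rule norm_le_l1_cart)
  also have "\<dots> \<le> (\<Sum>i\<in>(UNIV::'n set). \<Sum>j\<in>(UNIV::'n set). total_variation (\<lambda>\<sigma>. \<zeta> \<sigma> $ i $ j) * B)"
  proof (rule sum_mono)
    fix i
    show "\<bar>rhs g $ i\<bar> \<le> (\<Sum>j\<in>UNIV. total_variation (\<lambda>\<sigma>. \<zeta> \<sigma> $ i $ j) * B)"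
      unfolding rhs_nth[OF b]
    proof (rule order_trans[OF sum_abs sum_mono], rule scalar_stieltjes_bound[OF NBV_entry])
      show "(\<lambda>\<sigma>. g \<sigma> $ j) \<in> borel_measurable borel" for j
        by (rule bounded_borel_measurable[OF bounded_borel_nth[OF b]])
      show "\<bar>g \<sigma> $ j\<bar> \<le> B" if "\<sigma> \<in> {0..1}" for \<sigma> j
        using component_le_norm_cart[of "g \<sigma>" j] B[OF that] by linarith
    qed
  qed
  finally show ?thesis by (simp add: rhs_bound_def sum_distrib_right)
qed

lemma rhs_tendsto:
  assumes "\<And>n. G n \<in> borel_measurable borel" "g \<in> borel_measurable borel"
    "\<And>n \<sigma>. \<sigma> \<in> {0..1} \<Longrightarrow> norm (G n \<sigma>) \<le> B" "\<And>\<sigma>. \<sigma> \<in> {0..1} \<Longrightarrow> (\<lambda>n. G n \<sigma>) \<longlonglongrightarrow> g \<sigma>"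
  shows "(\<lambda>n. rhs (G n)) \<longlonglongrightarrow> rhs g"
proof (rule vec_tendstoI)
  fix i
  have bG: "bounded_borel (G n)" for n by (rule bounded_borelI[OF assms(1,3)])
  have "norm (g \<sigma>) \<le> B" if "\<sigma> \<in> {0..1}" for \<sigma>
    by (rule LIMSEQ_le_const2[OF tendsto_norm[OF assms(4)[OF that]]]) (use assms(3) that in auto)
  then have bg: "bounded_borel g" by (rule bounded_borelI[OF assms(2)])
  show "(\<lambda>n. rhs (G n) $ i) \<longlonglongrightarrow> rhs g $ i"
    unfolding rhs_nth[OF bG] rhs_nth[OF bg]
  proof (intro tendsto_sum sigma_functional_tendsto[OF sigma_functional_scalar_stieltjes(1)[OF NBV_entry]])
    fix j n show "(\<lambda>\<sigma>. G n \<sigma> $ j) \<in> borel_measurable borel" "(\<lambda>\<sigma>. g \<sigma> $ j) \<in> borel_measurable borel"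
      by (rule borel_measurable_vecD[OF assms(1)] borel_measurable_vecD[OF assms(2)])+
    show "\<bar>G n \<sigma> $ j\<bar> \<le> B" if "\<sigma> \<in> {0..1}" for \<sigma>
      using component_le_norm_cart[of "G n \<sigma>" j] assms(3)[OF that, of n] by linarith
    show "(\<lambda>n. G n \<sigma> $ j) \<longlonglongrightarrow> g \<sigma> $ j" if "\<sigma> \<in> {0..1}" for \<sigma>
      by (rule tendsto_vec_nth[OF assms(4)[OF that]])
  qed
qed

definition drift :: "(real \<Rightarrow> real ^ 'n) \<Rightarrow> real \<Rightarrow> real ^ 'n" where
  "drift x s = rhs (\<lambda>\<sigma>. x (s - \<sigma>))"

lemma drift_nth:
  "history x \<Longrightarrow> drift x s $ i = (\<Sum>j\<in>UNIV. scalar_stieltjes (\<lambda>\<sigma>. \<zeta> \<sigma> $ i $ j) (\<lambda>\<sigma>. x (s - \<sigma>) $ j))"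
  unfolding drift_def by (rule rhs_nth[OF history_bounded_borel])

lemma drift_add: "history x \<Longrightarrow> history y \<Longrightarrow> drift (\<lambda>t. x t + y t) s = drift x s + drift y s"
  unfolding drift_def by (rule rhs_add) (rule history_bounded_borel, assumption)+

lemma drift_scale: "history x \<Longrightarrow> drift (\<lambda>t. c *\<^sub>R x t) s = c *\<^sub>R drift x s"
  unfolding drift_def by (rule rhs_scale) (rule history_bounded_borel)

lemma drift_measurable:
  assumes "history x"
  shows "drift x \<in> borel_measurable borel"
proof (rule borel_measurable_vecI)
  fix i
  have m: "case_prod (\<lambda>s \<sigma>. x (s - \<sigma>) $ j) \<in> borel_measurable (borel \<Otimes>\<^sub>M borel)" for j
  proof -
    have "(\<lambda>t. x t $ j) \<in> borel_measurable borel"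
      using assms by (intro borel_measurable_vecD) (simp add: history_def)
    from measurable_compose[OF _ this, of "\<lambda>p. fst p - snd p" "borel \<Otimes>\<^sub>M borel"]
    show ?thesis by (simp add: case_prod_beta')
  qed
  show "(\<lambda>s. drift x s $ i) \<in> borel_measurable borel"
    unfolding drift_nth[OF assms] by (intro borel_measurable_sum scalar_stieltjes_measurable NBV_entry m)
qed

lemma norm_drift_le:
  assumes x: "x \<in> borel_measurable borel" and B: "\<And>r. s - 1 \<le> r \<Longrightarrow> r \<le> s \<Longrightarrow> norm (x r) \<le> B"
  shows "norm (drift x s) \<le> rhs_bound * B"
  unfolding drift_def
proof (rule norm_rhs_le)
  show "(\<lambda>\<sigma>. x (s - \<sigma>)) \<in> borel_measurable borel"
    by (rule measurable_compose[OF _ x]) simp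
qed (use B in auto)

lemma drift_integrable:
  assumes "history x"
  shows "set_integrable lborel {a..b} (drift x)"
proof -
  obtain B where "\<And>t. t \<le> b \<Longrightarrow> norm (x t) \<le> B" using assms by (rule historyE) blast
  then have "norm (drift x s) \<le> rhs_bound * B" if "s \<in> {a..b}" for s
    using that assms by (intro norm_drift_le) (auto simp: history_def)
  then show ?thesis by (rule set_integrable_Icc_bounded[OF drift_measurable[OF assms]])
qed

text \<open>The integral operator of the delay equation: the solutions are the functions
  \<open>x = initial \<phi> + evolve x\<close>. It vanishes for negative times because the interval is then empty.\<close>

definition evolve :: "(real \<Rightarrow> real ^ 'n) \<Rightarrow> real \<Rightarrow> real ^ 'n" where
  "evolve x t = (LBINT s:{0..t}. drift x s)"

lemma evolve_nonpos: "t \<le> 0 \<Longrightarrow> evolve x t = 0"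
  unfolding evolve_def by (rule primitive_nonpos)

lemma evolve_add:
  assumes "history x" "history y"
  shows "evolve (\<lambda>t. x t + y t) t = evolve x t + evolve y t"
proof -
  have "drift (\<lambda>t. x t + y t) = (\<lambda>s. drift x s + drift y s)" by (rule ext) (rule drift_add[OF assms])
  then show ?thesis unfolding evolve_def by (simp add: set_integral_add drift_integrable assms)
qed

lemma evolve_scale: "history x \<Longrightarrow> evolve (\<lambda>t. c *\<^sub>R x t) t = c *\<^sub>R evolve x t"
proof -
  assume "history x"
  then have "drift (\<lambda>t. c *\<^sub>R x t) = (\<lambda>s. c *\<^sub>R drift x s)" by (intro ext drift_scale)
  then show ?thesis unfolding evolve_def by simp
qed

lemma evolve_measurable:
  assumes "history x"
  shows "evolve x \<in> borel_measurable borel"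
  unfolding evolve_def[abs_def] by (rule primitive_measurable[OF drift_measurable[OF assms]])

text \<open>The weight is chosen so that \<open>evolve\<close> contracts by the factor 1/2; the summand 1 keeps it positive.\<close>

definition growth :: real where "growth = 2 * rhs_bound + 1"

lemma growth_pos: "0 < growth"
  using rhs_bound_nonneg by (simp add: growth_def)

text \<open>The contraction estimate, local in time. Since \<open>growth\<close> is positive, the weight at \<open>s - \<sigma>\<close> is at most
  the weight at \<open>s\<close>, and integrating \<open>rhs_bound * C * exp (growth * s)\<close> gains the factor
  \<open>1 / growth\<close>.\<close>

lemma evolve_halves:
  assumes h: "history x" and C: "0 \<le> C"
    and le: "\<And>s. s \<le> t \<Longrightarrow> norm (x s) \<le> C * exp (growth * s)"
  shows "norm (evolve x t) \<le> C / 2 * exp (growth * t)"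
proof (cases "0 \<le> t")
  case False
  then show ?thesis using C by (simp add: evolve_nonpos)
next
  case True
  let ?K = "rhs_bound * C"
  have K: "0 \<le> ?K" using C rhs_bound_nonneg by simp
  have d: "norm (drift x s) \<le> ?K * exp (growth * s)" if "s \<in> {0..t}" for s
  proof -
    have "norm (x r) \<le> C * exp (growth * s)" if "r \<le> s" for r
    proof -
      have "C * exp (growth * r) \<le> C * exp (growth * s)"
        using that C growth_pos by (intro mult_left_mono) auto
      then show ?thesis using le[of r] that \<open>s \<in> {0..t}\<close> by auto
    qed
    then show ?thesis using h norm_drift_le[of x s "C * exp (growth * s)"] by (simp add: mult.assoc history_def)
  qed
  have fin: "has_bochner_integral lborel (\<lambda>s. indicator {0..t} s *\<^sub>R (?K * exp (growth * s)))
      (?K / growth * exp (growth * t) - ?K / growth * exp (growth * 0))"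
    using growth_pos True
    by (intro has_bochner_integral_FTC_Icc continuous_intros)
       (auto intro!: derivative_eq_intros simp: has_real_derivative_iff_has_vector_derivative[symmetric])
  have "norm (evolve x t) \<le> (LBINT s. indicator {0..t} s *\<^sub>R (?K * exp (growth * s)))"
    unfolding evolve_def set_lebesgue_integral_def
  proof (rule Bochner_Integration.integral_norm_bound_integral)
    show "integrable lborel (\<lambda>s. indicator {0..t} s *\<^sub>R drift x s)"
      using drift_integrable[OF h] by (simp add: set_integrable_def)
    show "integrable lborel (\<lambda>s. indicator {0..t} s *\<^sub>R (?K * exp (growth * s)))"
      using fin by (rule integrable.intros)
  qed (use d in \<open>auto simp: indicator_def\<close>)
  also have "\<dots> = ?K / growth * exp (growth * t) - ?K / growth * exp (growth * 0)"
    by (rule has_bochner_integral_integral_eq[OF fin])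
  also have "\<dots> \<le> ?K / growth * exp (growth * t)" using K growth_pos by simp
  also have "\<dots> \<le> C / 2 * exp (growth * t)"
  proof (rule mult_right_mono)
    have "2 * ?K \<le> C * growth" using C by (simp add: growth_def algebra_simps)
    then show "?K / growth \<le> C / 2" using growth_pos by (simp add: field_simps)
  qed simp
  finally show ?thesis .
qed

lemma evolve_tendsto:
  assumes X: "\<And>m. history (X m)" and x: "history x"
    and B: "\<And>m s. s \<le> t \<Longrightarrow> norm (X m s) \<le> B"
    and lim: "\<And>s. s \<le> t \<Longrightarrow> (\<lambda>m. X m s) \<longlonglongrightarrow> x s"
  shows "(\<lambda>m. evolve (X m) t) \<longlonglongrightarrow> evolve x t"
  unfolding evolve_def set_lebesgue_integral_def
proof (rule integral_dominated_convergence[where w = "\<lambda>s. indicator {0..t} s *\<^sub>R (rhs_bound * B)"])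
  show "integrable lborel (\<lambda>s. indicator {0..t} s *\<^sub>R (rhs_bound * B))"
    by (intro integrable_scaleR_left integrable_real_indicator) (auto simp: emeasure_lborel_Icc_eq)
  show "(\<lambda>s. indicator {0..t} s *\<^sub>R drift x s) \<in> borel_measurable lborel"
    using drift_measurable[OF x] by simp
  show "(\<lambda>s. indicator {0..t} s *\<^sub>R drift (X m) s) \<in> borel_measurable lborel" for m
    using drift_measurable[OF X] by simp
  have "norm (drift (X m) s) \<le> rhs_bound * B" if "s \<le> t" for m s
    using X[of m] that by (intro norm_drift_le B) (auto simp: history_def)
  then show "AE s in lborel. norm (indicator {0..t} s *\<^sub>R drift (X m) s) \<le> indicator {0..t} s *\<^sub>R (rhs_bound * B)" for m
    by (auto simp: indicator_def)
  have "(\<lambda>m. drift (X m) s) \<longlonglongrightarrow> drift x s" if "s \<le> t" for s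
    unfolding drift_def
  proof (rule rhs_tendsto)
    show "(\<lambda>\<sigma>. X m (s - \<sigma>)) \<in> borel_measurable borel" "(\<lambda>\<sigma>. x (s - \<sigma>)) \<in> borel_measurable borel" for m
      by (rule bounded_borel_measurable[OF history_bounded_borel], fact)+
  qed (use that in \<open>auto intro!: B lim\<close>)
  then show "AE s in lborel. (\<lambda>m. indicator {0..t} s *\<^sub>R drift (X m) s) \<longlonglongrightarrow> indicator {0..t} s *\<^sub>R drift x s"
    by (auto simp: indicator_def)
qed

text \<open>Constant continuation beyond 0 makes \<open>x = initial \<phi> + evolve x\<close> valid on the whole line.\<close>

definition initial :: "(real ^ 'n) bborel \<Rightarrow> real \<Rightarrow> real ^ 'n" where
  "initial \<phi> t = fn \<phi> (min t 0)"

definition picard :: "nat \<Rightarrow> (real ^ 'n) bborel \<Rightarrow> real \<Rightarrow> real ^ 'n" where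
  "picard k \<phi> = (evolve ^^ k) (initial \<phi>)"

definition sol :: "(real ^ 'n) bborel \<Rightarrow> real \<Rightarrow> real ^ 'n" where
  "sol \<phi> t = (\<Sum>k. picard k \<phi> t)"

lemma picard_Suc: "picard (Suc k) \<phi> = evolve (picard k \<phi>)"
  by (simp add: picard_def)

lemma norm_initial_le: "norm (initial \<phi> t) \<le> exp growth * norm \<phi> * exp (growth * t)"
proof (cases "t < -1")
  case True
  then show ?thesis by (simp add: initial_def fn_outside)
next
  case False
  have "0 \<le> growth * (1 + t)" using False growth_pos by (intro mult_nonneg_nonneg) auto
  then have "1 \<le> exp growth * exp (growth * t)" by (simp add: exp_add[symmetric] algebra_simps)
  then have "1 * norm \<phi> \<le> exp growth * exp (growth * t) * norm \<phi>" by (rule mult_right_mono) simp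
  with norm_fn_le[of \<phi> "min t 0"] show ?thesis by (simp add: initial_def mult_ac)
qed

lemma picard_bound:
  "picard k \<phi> \<in> borel_measurable borel \<and>
   (\<forall>t. norm (picard k \<phi> t) \<le> (exp growth * norm \<phi>) / 2 ^ k * exp (growth * t))"
proof (induction k)
  case 0
  have "(\<lambda>t. fn \<phi> (min t 0)) \<in> borel_measurable borel"
    by (rule measurable_compose[OF _ measurable_fn]) simp
  then show ?case using norm_initial_le by (simp add: picard_def initial_def[abs_def])
next
  case (Suc k)
  let ?C = "(exp growth * norm \<phi>) / 2 ^ k"
  have C: "0 \<le> ?C" by simp
  have "history (picard k \<phi>)"
    by (rule historyI[OF _ C less_imp_le[OF growth_pos]]) (use Suc in auto)
  then show ?case
    using evolve_halves[of "picard k \<phi>" ?C] evolve_measurable[of "picard k \<phi>"] Suc C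
    by (simp add: picard_Suc mult.commute)
qed

lemma picard_history: "history (picard k \<phi>)"
  by (rule historyI[of _ "(exp growth * norm \<phi>) / 2 ^ k" growth])
     (use picard_bound growth_pos in \<open>auto intro: less_imp_le\<close>)

lemma geometric_majorant: "(\<lambda>k. C / 2 ^ k * (E::real)) sums (2 * C * E)"
  using sums_mult[OF geometric_sums[of "1/2 :: real"], of "C * E"] by (simp add: power_divide field_simps)

lemma picard_summable: "summable (\<lambda>k. norm (picard k \<phi> t))"
  by (rule summable_comparison_test'[OF sums_summable[OF geometric_majorant]]) (use picard_bound in auto)

lemma picard_sums: "(\<lambda>k. picard k \<phi> t) sums sol \<phi> t"
  unfolding sol_def by (rule summable_sums[OF summable_norm_cancel[OF picard_summable]])

lemma norm_sol_le: "norm (sol \<phi> t) \<le> 2 * exp growth * norm \<phi> * exp (growth * t)"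
proof -
  have "norm (sol \<phi> t) \<le> (\<Sum>k. norm (picard k \<phi> t))"
    unfolding sol_def by (rule summable_norm[OF picard_summable])
  also have "\<dots> \<le> (\<Sum>k. (exp growth * norm \<phi>) / 2 ^ k * exp (growth * t))"
    using picard_bound by (intro suminf_le picard_summable sums_summable[OF geometric_majorant]) auto
  also have "\<dots> = 2 * exp growth * norm \<phi> * exp (growth * t)"
    by (subst sums_unique[OF geometric_majorant, symmetric]) simp
  finally show ?thesis .
qed

lemma sol_measurable: "sol \<phi> \<in> borel_measurable borel"
  unfolding sol_def[abs_def] by (intro borel_measurable_suminf) (use picard_bound in auto)

lemma sol_history: "history (sol \<phi>)"
  by (rule historyI[of _ "2 * exp growth * norm \<phi>" growth])
     (use sol_measurable norm_sol_le growth_pos in \<open>auto intro: less_imp_le\<close>)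

text \<open>The partial sums \<open>P N\<close> satisfy \<open>evolve (P N) = P (N + 1) - initial \<phi>\<close>; bounded convergence passes to
  the limit.\<close>

lemma sol_eq: "sol \<phi> t = initial \<phi> t + evolve (sol \<phi>) t"
proof -
  define P where "P N t = (\<Sum>k<N. picard k \<phi> t)" for N t
  have hP: "history (P N)" for N
    unfolding P_def[abs_def]
  proof (induction N)
    case 0 show ?case by (auto simp: history_def intro: exI[of _ 0])
  next
    case (Suc N) then show ?case by (simp add: history_add picard_history)
  qed
  have step: "evolve (P N) t = P (Suc N) t - initial \<phi> t" for N
  proof (induction N)
    case 0
    have "P 0 = (\<lambda>t. 0 *\<^sub>R sol \<phi> t)" by (auto simp: P_def)
    then show ?case using evolve_scale[OF sol_history, of 0 \<phi> t] by (simp add: P_def picard_def)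
  next
    case (Suc N)
    have "P (Suc N) = (\<lambda>t. P N t + picard N \<phi> t)" by (auto simp: P_def)
    then have "evolve (P (Suc N)) t = evolve (P N) t + picard (Suc N) \<phi> t"
      by (simp add: evolve_add[OF hP picard_history] picard_Suc)
    also have "\<dots> = P (Suc (Suc N)) t - initial \<phi> t" unfolding Suc.IH by (simp add: P_def)
    finally show ?case .
  qed
  have "norm (P N s) \<le> 2 * exp growth * norm \<phi> * exp (growth * t)" if "s \<le> t" for N s
  proof -
    have "norm (P N s) \<le> (\<Sum>k<N. (exp growth * norm \<phi>) / 2 ^ k * exp (growth * s))"
      unfolding P_def using picard_bound by (intro sum_norm_le) auto
    also have "\<dots> \<le> 2 * (exp growth * norm \<phi>) * exp (growth * s)"
      unfolding sums_unique[OF geometric_majorant]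
      by (rule sum_le_suminf[OF sums_summable[OF geometric_majorant]]) auto
    also have "\<dots> \<le> 2 * (exp growth * norm \<phi>) * exp (growth * t)"
      using that growth_pos by (intro mult_left_mono) auto
    finally show ?thesis by (simp add: mult_ac)
  qed
  moreover have lim: "(\<lambda>N. P N s) \<longlonglongrightarrow> sol \<phi> s" for s
    using picard_sums unfolding sums_def P_def .
  ultimately have "(\<lambda>N. evolve (P N) t) \<longlonglongrightarrow> evolve (sol \<phi>) t"
    by (intro evolve_tendsto[OF hP sol_history]) auto
  moreover have "(\<lambda>N. evolve (P N) t) \<longlonglongrightarrow> sol \<phi> t - initial \<phi> t"
    unfolding step by (intro tendsto_diff tendsto_const LIMSEQ_Suc lim)
  ultimately have "evolve (sol \<phi>) t = sol \<phi> t - initial \<phi> t" by (rule LIMSEQ_unique)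
  then show ?thesis by simp
qed

lemma sol_initial: "t \<le> 0 \<Longrightarrow> sol \<phi> t = fn \<phi> t"
  by (simp add: sol_eq evolve_nonpos initial_def min_def)

lemma sol_forward: "0 \<le> t \<Longrightarrow> sol \<phi> t = fn \<phi> 0 + (LBINT s:{0..t}. drift (sol \<phi>) s)"
  by (subst sol_eq) (simp add: initial_def evolve_def min_def)

lemma delay_solution_history:
  assumes "delay_solution \<zeta> \<phi> x"
  shows "history x"
  unfolding history_def
proof (intro conjI allI)
  show "x \<in> borel_measurable borel" using assms by (simp add: delay_solution_def)
  fix T
  obtain B where B: "\<And>t. t \<in> {-1..T} \<Longrightarrow> norm (x t) \<le> B"
    using assms unfolding delay_solution_def bounded_iff by (metis imageI)
  have "norm (x t) \<le> max 0 B" if "t \<le> T" for t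
  proof (cases "t < -1")
    case True then show ?thesis using assms by (simp add: delay_solution_def)
  next
    case False then show ?thesis using B[of t] that by simp
  qed
  then show "\<exists>B. \<forall>t\<le>T. norm (x t) \<le> B" by blast
qed

lemma delay_solution_eq:
  assumes "delay_solution \<zeta> \<phi> x"
  shows "x t = initial \<phi> t + evolve x t"
proof (cases "0 \<le> t")
  case True
  then show ?thesis
    using assms by (simp add: delay_solution_def initial_def evolve_def drift_def rhs_def min_def)
next
  case False
  then show ?thesis
    using assms by (cases "t < -1") (auto simp: delay_solution_def evolve_nonpos initial_def fn_outside min_def)
qed

lemma delay_solution_sol: "delay_solution \<zeta> \<phi> (sol \<phi>)"
  unfolding delay_solution_def
proof (intro conjI allI impI ballI)
  show "sol \<phi> \<in> borel_measurable borel" by (rule sol_measurable)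
  show "bounded (sol \<phi> ` {-1..T})" for T
  proof -
    obtain B where "\<And>t. t \<le> T \<Longrightarrow> norm (sol \<phi> t) \<le> B" using sol_history[of \<phi>] by (rule historyE) blast
    then show ?thesis by (intro boundedI[of _ B]) auto
  qed
  show "sol \<phi> t = 0" if "t < -1" for t using that by (simp add: sol_initial fn_outside)
  show "sol \<phi> \<theta> = fn \<phi> \<theta>" if "\<theta> \<in> {-1..0}" for \<theta> using that by (simp add: sol_initial)
  show "sol \<phi> t = fn \<phi> 0 + (LBINT s:{0..t}. stieltjes (*v) \<zeta> (\<lambda>\<sigma>. sol \<phi> (s - \<sigma>)))" if "0 \<le> t" for t
    using sol_forward[OF that] by (simp add: drift_def rhs_def)
qed

text \<open>The difference of two solutions is a fixed point of \<open>evolve\<close>, so that its weighted norm on each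
  left half-line is at most half of itself.\<close>

lemma evolve_fixed_point_unique:
  assumes "history x" "history y" "\<And>t. x t - y t = evolve x t - evolve y t"
  shows "x t = y t"
proof -
  define d where "d s = x s - y s" for s
  have hd: "history d" unfolding d_def[abs_def] by (rule history_diff[OF assms(1,2)])
  have ev: "d s = evolve d s" for s
    using assms(3)[of s] evolve_add[OF assms(1) history_scale[OF assms(2), of "-1"], of s]
      evolve_scale[OF assms(2), of "-1" s]
    by (simp add: d_def[abs_def])
  obtain B where B: "0 \<le> B" "\<And>s. s \<le> max t 0 \<Longrightarrow> norm (d s) \<le> B" using hd by (rule historyE) blast
  have "norm (d s) \<le> B / 2 ^ k * exp (growth * s)" if "s \<le> max t 0" for k s
    using that
  proof (induction k arbitrary: s)
    case 0
    show ?case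
    proof (cases "s \<le> 0")
      case True
      then show ?thesis using ev[of s] B(1) by (simp add: evolve_nonpos)
    next
      case False
      then have "B * 1 \<le> B * exp (growth * s)" using B(1) growth_pos by (intro mult_left_mono) auto
      then show ?thesis using B(2)[OF 0] by simp
    qed
  next
    case (Suc k)
    have "norm (evolve d s) \<le> (B / 2 ^ k) / 2 * exp (growth * s)"
      by (rule evolve_halves[OF hd]) (use Suc B(1) in auto)
    then show ?case using ev[of s] by (simp add: mult.commute)
  qed
  then have "norm (d t) \<le> B / 2 ^ k * exp (growth * t)" for k by simp
  moreover have "(\<lambda>k. B / 2 ^ k * exp (growth * t)) \<longlonglongrightarrow> 0"
    by (rule summable_LIMSEQ_zero[OF sums_summable[OF geometric_majorant]])
  ultimately have "norm (d t) \<le> 0" by (intro LIMSEQ_le_const) auto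
  then show ?thesis by (simp add: d_def)
qed

lemma delay_solution_unique:
  assumes "delay_solution \<zeta> \<phi> x"
  shows "x = sol \<phi>"
proof
  fix t
  show "x t = sol \<phi> t"
  proof (rule evolve_fixed_point_unique)
    show "history x" by (rule delay_solution_history[OF assms])
    show "x s - sol \<phi> s = evolve x s - evolve (sol \<phi>) s" for s
      by (subst delay_solution_eq[OF assms], subst sol_eq) simp
  qed (rule sol_history)
qed

lemma the_solution_eq: "the_solution \<zeta> \<phi> = sol \<phi>"
  unfolding the_solution_def using delay_solution_sol delay_solution_unique by (rule the_equality)

end

section \<open>The semigroup of solution segments\<close>

context delay_equation
begin

lemma picard_add: "picard k (\<phi> + \<psi>) = (\<lambda>t. picard k \<phi> t + picard k \<psi> t)"
proof (induction k)
  case 0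
  show ?case by (simp add: picard_def initial_def[abs_def] plus_bborel.rep_eq)
next
  case (Suc k)
  show ?case unfolding picard_Suc Suc by (rule ext) (rule evolve_add[OF picard_history picard_history])
qed

lemma picard_scale: "picard k (c *\<^sub>R \<phi>) = (\<lambda>t. c *\<^sub>R picard k \<phi> t)"
proof (induction k)
  case 0
  show ?case by (simp add: picard_def initial_def[abs_def] scaleR_bborel.rep_eq)
next
  case (Suc k)
  show ?case unfolding picard_Suc Suc by (rule ext) (rule evolve_scale[OF picard_history])
qed

lemma sol_add: "sol (\<phi> + \<psi>) t = sol \<phi> t + sol \<psi> t"
  using sums_add[OF picard_sums[of \<phi> t] picard_sums[of \<psi> t]] picard_sums[of "\<phi> + \<psi>" t]
  unfolding picard_add by (rule sums_unique2[symmetric])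

lemma sol_scale: "sol (c *\<^sub>R \<phi>) t = c *\<^sub>R sol \<phi> t"
  using sums_scaleR_right[OF picard_sums[of \<phi> t], of c] picard_sums[of "c *\<^sub>R \<phi>" t]
  unfolding picard_scale by (rule sums_unique2[symmetric])

text \<open>Bounded convergence holds for each Picard iterate by induction, and for the sum by Tannery's
  theorem with the geometric majorant.\<close>

lemma sol_tendsto:
  assumes B: "\<And>m. norm (Y m) \<le> B"
    and lim: "\<And>\<theta>. \<theta> \<in> {-1..0} \<Longrightarrow> (\<lambda>m. fn (Y m) \<theta>) \<longlonglongrightarrow> fn y \<theta>"
  shows "(\<lambda>m. sol (Y m) t) \<longlonglongrightarrow> sol y t"
proof -
  let ?C = "exp growth * B"
  have B0: "0 \<le> B" using B[of 0] norm_ge_zero order_trans by blast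
  have bound: "norm (picard k (Y m) s) \<le> ?C / 2 ^ k * exp (growth * s)" for k m s
  proof -
    have "norm (picard k (Y m) s) \<le> (exp growth * norm (Y m)) / 2 ^ k * exp (growth * s)"
      using picard_bound by blast
    also have "\<dots> \<le> ?C / 2 ^ k * exp (growth * s)"
      by (intro mult_right_mono divide_right_mono mult_left_mono B) auto
    finally show ?thesis .
  qed
  have step: "(\<lambda>m. picard k (Y m) s) \<longlonglongrightarrow> picard k y s" for k s
  proof (induction k arbitrary: s)
    case 0
    show ?case
    proof (cases "min s 0 \<in> {-1..0}")
      case True
      then show ?thesis using lim[OF True] by (simp add: picard_def initial_def)
    next
      case False
      then have "fn (Y m) (min s 0) = 0" "fn y (min s 0) = 0" for m by (rule fn_outside)+
      then show ?thesis by (simp add: picard_def initial_def)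
    qed
  next
    case (Suc k)
    have "norm (picard k (Y m) r) \<le> ?C / 2 ^ k * exp (growth * s)" if "r \<le> s" for m r
    proof (rule order_trans[OF bound mult_left_mono])
      show "exp (growth * r) \<le> exp (growth * s)" using that growth_pos by simp
    qed (use B0 in auto)
    then show ?case
      unfolding picard_Suc by (intro evolve_tendsto[OF picard_history picard_history _ Suc.IH])
  qed
  show ?thesis
  proof (rule vec_tendstoI)
    fix i
    have nth: "sol \<phi> t $ i = (\<Sum>k. picard k \<phi> t $ i)" for \<phi>
      using bounded_linear.sums[OF bounded_linear_vec_nth picard_sums] by (rule sums_unique)
    have "((\<lambda>m. \<Sum>k. picard k (Y m) t $ i) \<longlongrightarrow> (\<Sum>k. picard k y t $ i)) sequentially"
    proof (rule tannerys_theorem[THEN conjunct2, THEN conjunct2])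
      show "(\<lambda>m. picard k (Y m) t $ i) \<longlonglongrightarrow> picard k y t $ i" for k
        by (rule tendsto_vec_nth[OF step])
      show "summable (\<lambda>k. ?C / 2 ^ k * exp (growth * t))"
        by (rule sums_summable[OF geometric_majorant])
      have "norm (picard k (Y m) t $ i) \<le> ?C / 2 ^ k * exp (growth * t)" for k m
        using component_le_norm_cart[of "picard k (Y m) t" i] bound[of k m t] by simp
      then show "\<forall>\<^sub>F (k, m) in at_top \<times>\<^sub>F sequentially. norm (picard k (Y m) t $ i) \<le> ?C / 2 ^ k * exp (growth * t)"
        by (intro always_eventually) (simp add: split_beta)
    qed simp
    then show "(\<lambda>m. sol (Y m) t $ i) \<longlonglongrightarrow> sol y t $ i" by (simp add: nth)
  qed
qed

lemma fn_semigroup: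
  "fn (delay_semigroup \<zeta> t \<phi>) = (\<lambda>\<theta>. if \<theta> \<in> {-1..0} then sol \<phi> (t + \<theta>) else 0)"
  unfolding delay_semigroup_def the_solution_eq
proof (rule fn_bborel_of)
  have "(\<lambda>\<theta>. sol \<phi> (t + \<theta>)) \<in> borel_measurable borel"
    by (rule measurable_compose[OF _ sol_measurable]) simp
  then show "(\<lambda>\<theta>. sol \<phi> (t + \<theta>)) \<in> borel_measurable (restrict_space borel {-1..0})"
    by (rule measurable_restrict_space1)
  obtain B where "\<And>s. s \<le> t \<Longrightarrow> norm (sol \<phi> s) \<le> B" using sol_history[of \<phi>] by (rule historyE) blast
  then show "bounded ((\<lambda>\<theta>. sol \<phi> (t + \<theta>)) ` {-1..0})" by (intro boundedI[of _ B]) auto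
qed

lemma norm_semigroup_le: "norm (delay_semigroup \<zeta> t \<phi>) \<le> 2 * exp growth * exp (growth * t) * norm \<phi>"
proof (rule norm_bborel_leI)
  fix \<theta> :: real assume \<theta>: "\<theta> \<in> {-1..0}"
  have "norm (sol \<phi> (t + \<theta>)) \<le> 2 * exp growth * norm \<phi> * exp (growth * (t + \<theta>))" by (rule norm_sol_le)
  also have "\<dots> \<le> 2 * exp growth * norm \<phi> * exp (growth * t)"
    using \<theta> growth_pos by (intro mult_left_mono) auto
  finally show "norm (fn (delay_semigroup \<zeta> t \<phi>) \<theta>) \<le> 2 * exp growth * exp (growth * t) * norm \<phi>"
    using \<theta> by (simp add: fn_semigroup mult_ac)
qed

lemma semigroup_linear: "linear (delay_semigroup \<zeta> t)"
  by (intro linearI bborel_eqI)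
     (simp_all add: fn_semigroup plus_bborel.rep_eq scaleR_bborel.rep_eq sol_add sol_scale)

lemma semigroup_bounded_linear: "bounded_linear (delay_semigroup \<zeta> t)"
proof (rule bounded_linear_intro)
  show "norm (delay_semigroup \<zeta> t y) \<le> norm y * (2 * exp growth * exp (growth * t))" for y
    using norm_semigroup_le[of t y] by (simp add: mult_ac)
qed (simp_all add: linear_add[OF semigroup_linear] linear_scale[OF semigroup_linear])

text \<open>The integrated equation restarted at time \<open>t\<close>: the delays reach back at most 1, so only values of \<open>x\<close>
  on the interval from -1 to \<open>s\<close> matter.\<close>

lemma evolve_shift:
  assumes "0 \<le> t" "0 \<le> s" "\<And>r. -1 \<le> r \<Longrightarrow> r \<le> s \<Longrightarrow> x r = sol \<phi> (t + r)"
  shows "sol \<phi> (t + s) = sol \<phi> t + (LBINT r:{0..s}. drift x r)"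
proof -
  have "(LBINT r:{0..t+s}. drift (sol \<phi>) r) =
      (LBINT r:{0..t}. drift (sol \<phi>) r) + (LBINT r:{t..t+s}. drift (sol \<phi>) r)"
    by (rule set_integral_Icc_split[OF drift_integrable[OF sol_history]]) (use assms in auto)
  also have "(LBINT r:{t..t+s}. drift (sol \<phi>) r) = (LBINT r:{0..s}. drift (sol \<phi>) (r + t))"
    using set_integral_shift[of t "t + s" "drift (sol \<phi>)" t] by simp
  also have "\<dots> = (LBINT r:{0..s}. drift x r)"
  proof (rule set_lebesgue_integral_cong)
    show "\<forall>r. r \<in> {0..s} \<longrightarrow> drift (sol \<phi>) (r + t) = drift x r"
      unfolding drift_def
      by (intro allI impI rhs_cong) (use assms(3) in \<open>auto simp: algebra_simps\<close>)
  qed simp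
  finally show ?thesis using sol_forward[of "t + s" \<phi>] sol_forward[of t \<phi>] assms by simp
qed

text \<open>The translated solution solves the equation with initial segment \<open>S(t) \<phi>\<close>; uniqueness gives the
  semigroup law.\<close>

lemma sol_semigroup:
  assumes t: "0 \<le> t" and s: "-1 \<le> s"
  shows "sol (delay_semigroup \<zeta> t \<phi>) s = sol \<phi> (t + s)"
proof -
  \<comment> \<open>Solutions are stored as 0 to the left of -1, so the translate has to be cut off there.\<close>
  define x where "x r = (if r < -1 then 0 else sol \<phi> (t + r))" for r
  have m: "(\<lambda>r. sol \<phi> (t + r)) \<in> borel_measurable borel"
    by (rule measurable_compose[OF _ sol_measurable]) simp
  have "delay_solution \<zeta> (delay_semigroup \<zeta> t \<phi>) x"
    unfolding delay_solution_def
  proof (intro conjI allI impI ballI)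
    show "x \<in> borel_measurable borel" unfolding x_def[abs_def] using m by measurable
    show "bounded (x ` {-1..T})" for T
    proof -
      obtain B where "0 \<le> B" "\<And>s. s \<le> t + T \<Longrightarrow> norm (sol \<phi> s) \<le> B"
        using sol_history[of \<phi>] by (rule historyE) blast
      then show ?thesis by (intro boundedI[of _ B]) (auto simp: x_def)
    qed
    show "x r = fn (delay_semigroup \<zeta> t \<phi>) 0 + (LBINT s:{0..r}. stieltjes (*v) \<zeta> (\<lambda>\<sigma>. x (s - \<sigma>)))"
      if "0 \<le> r" for r
      using evolve_shift[OF t that, of x \<phi>] that
      by (simp add: x_def fn_semigroup drift_def rhs_def)
  qed (auto simp: x_def fn_semigroup)
  then have "x = sol (delay_semigroup \<zeta> t \<phi>)" by (rule delay_solution_unique)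
  then show ?thesis using s by (auto simp: x_def dest: fun_cong[of _ _ s])
qed

lemma semigroup_zero: "delay_semigroup \<zeta> 0 y = y"
  by (rule bborel_eqI) (simp add: fn_semigroup sol_initial)

lemma semigroup_add:
  assumes "0 \<le> t" "0 \<le> s"
  shows "delay_semigroup \<zeta> (t + s) y = delay_semigroup \<zeta> t (delay_semigroup \<zeta> s y)"
proof (rule bborel_eqI)
  fix \<theta> :: real assume "\<theta> \<in> {-1..0}"
  then show "fn (delay_semigroup \<zeta> (t + s) y) \<theta> = fn (delay_semigroup \<zeta> t (delay_semigroup \<zeta> s y)) \<theta>"
    using sol_semigroup[OF assms(2), of "t + \<theta>" y] assms by (simp add: fn_semigroup add_ac)
qed

lemma semigroup_sigma_continuous:
  assumes "f \<in> NBV"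
  shows "sigma_continuous (\<lambda>y. pairing f (delay_semigroup \<zeta> t y))"
  unfolding sigma_continuous_def
proof (intro conjI allI impI)
  show "linear (\<lambda>y. pairing f (delay_semigroup \<zeta> t y))"
    using linear_compose[OF semigroup_linear pairing_linear[OF assms]] by (simp add: o_def)
  fix Y :: "nat \<Rightarrow> (real ^ 'n) bborel" and y B
  assume Y: "\<forall>m. norm (Y m) \<le> B" "\<forall>\<theta>\<in>{-1..0}. (\<lambda>m. fn (Y m) \<theta>) \<longlonglongrightarrow> fn y \<theta>"
  show "(\<lambda>m. pairing f (delay_semigroup \<zeta> t (Y m))) \<longlonglongrightarrow> pairing f (delay_semigroup \<zeta> t y)"
  proof (rule pairing_tendsto[OF assms])
    show "norm (delay_semigroup \<zeta> t (Y m)) \<le> 2 * exp growth * exp (growth * t) * B" for m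
      by (rule order_trans[OF norm_semigroup_le mult_left_mono]) (use Y in auto)
    show "(\<lambda>m. fn (delay_semigroup \<zeta> t (Y m)) \<theta>) \<longlonglongrightarrow> fn (delay_semigroup \<zeta> t y) \<theta>" for \<theta>
      using sol_tendsto[of Y B y "t + \<theta>"] Y by (cases "\<theta> \<in> {-1..0}") (auto simp: fn_semigroup)
  qed
qed

lemma pairing_semigroup:
  assumes "f \<in> NBV"
  shows "pairing f (delay_semigroup \<zeta> t y) =
    (\<Sum>k\<in>UNIV. scalar_stieltjes (\<lambda>\<sigma>. f \<sigma> $ k) (\<lambda>\<sigma>. sol y (t - \<sigma>) $ k))"
  unfolding pairing_eq
  by (intro sum.cong refl scalar_stieltjes_cong NBV_nth assms) (simp add: fn_semigroup)

lemma sol_nth_pair_measurable: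
  "case_prod (\<lambda>t \<sigma>. sol y (t - \<sigma>) $ k) \<in> borel_measurable (borel \<Otimes>\<^sub>M borel)"
proof -
  have "(\<lambda>t. sol y t $ k) \<in> borel_measurable borel"
    by (rule borel_measurable_vecD[OF sol_measurable])
  from measurable_compose[OF _ this, of "\<lambda>p. fst p - snd p" "borel \<Otimes>\<^sub>M borel"]
  show ?thesis by (simp add: case_prod_beta')
qed

lemma pairing_semigroup_measurable:
  assumes "f \<in> NBV"
  shows "(\<lambda>t. pairing f (delay_semigroup \<zeta> t y)) \<in> borel_measurable borel"
  unfolding pairing_semigroup[OF assms]
  by (intro borel_measurable_sum scalar_stieltjes_measurable NBV_nth assms sol_nth_pair_measurable)

end

section \<open>Laplace transforms of exponentially bounded functions\<close>

text \<open>The transform of the translate \<open>x(\<cdot> + \<theta>)\<close>; at \<open>\<theta> = - \<sigma>\<close> it is the transform of the delayed function.\<close>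

definition laplace :: "complex \<Rightarrow> (real \<Rightarrow> real) \<Rightarrow> real \<Rightarrow> complex" where
  "laplace lam x \<theta> = (LBINT t:{0..}. exp (- lam * complex_of_real t) * complex_of_real (x (t + \<theta>)))"

text \<open>The bound is asked on the whole line. Solutions vanish to the left of -1, so a bound at positive times
  extends to all times, whatever the sign of \<open>\<omega>\<close>.\<close>

definition exp_bounded :: "real \<Rightarrow> real \<Rightarrow> (real \<Rightarrow> real) \<Rightarrow> bool" where
  "exp_bounded C \<omega> x \<longleftrightarrow> x \<in> borel_measurable borel \<and> (\<forall>t. \<bar>x t\<bar> \<le> C * exp (\<omega> * t))"

definition decay :: "real \<Rightarrow> real \<Rightarrow> real" where
  "decay a t = indicator {0..} t * exp (- a * t)"

lemma decay_integrable:
  assumes "0 < a"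
  shows "integrable lborel (decay a)"
proof (rule integrableI_nonneg)
  show "decay a \<in> borel_measurable lborel" unfolding decay_def[abs_def] by measurable
  have lim: "((\<lambda>t. - exp (- a * t) / a) \<longlongrightarrow> - 0 / a) at_top"
    using assms by (intro tendsto_intros filterlim_compose[OF exp_at_bot] filterlim_tendsto_neg_mult_at_bot[OF tendsto_const]
        filterlim_ident) auto
  have "(\<integral>\<^sup>+t. ennreal (exp (- a * t)) * indicator {0..} t \<partial>lborel) = - 0 / a - (- exp (- a * 0) / a)"
    using assms lim by (intro nn_integral_FTC_atLeast) (auto intro!: derivative_eq_intros)
  moreover have "(\<lambda>t. ennreal (decay a t)) = (\<lambda>t. ennreal (exp (- a * t)) * indicator {0..} t)"
    by (auto simp: decay_def indicator_def)
  ultimately show "(\<integral>\<^sup>+t. ennreal (decay a t) \<partial>lborel) < \<infinity>" by simp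
qed (simp add: decay_def)

text \<open>The pointwise majorant behind all convergence statements for Laplace transforms; \<open>K\<close> allows it to be
  uniform in \<open>\<theta>\<close>.\<close>

lemma decay_bound:
  assumes x: "exp_bounded C \<omega> x" and K: "exp (\<omega> * \<theta>) \<le> K"
  shows "norm (indicator {0..} t *\<^sub>R (exp (- lam * complex_of_real t) * complex_of_real (x (t + \<theta>)))) \<le>
    C * K * decay (Re lam - \<omega>) t"
proof -
  have C: "0 \<le> C"
    using order_trans[OF abs_ge_zero, of "x 0" C] x by (auto simp: exp_bounded_def dest: spec[of _ 0])
  have "\<bar>x (t + \<theta>)\<bar> \<le> C * exp (\<omega> * (t + \<theta>))" using x by (simp add: exp_bounded_def)
  also have "\<dots> = C * exp (\<omega> * \<theta>) * exp (\<omega> * t)" by (simp add: exp_add distrib_left mult_ac)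
  also have "\<dots> \<le> C * K * exp (\<omega> * t)" using C K by (intro mult_right_mono mult_left_mono) auto
  finally have "exp (- Re lam * t) * \<bar>x (t + \<theta>)\<bar> \<le> exp (- Re lam * t) * (C * K * exp (\<omega> * t))"
    by (rule mult_left_mono) simp
  also have "\<dots> = C * K * exp (- (Re lam - \<omega>) * t)" by (simp add: mult_exp_exp algebra_simps)
  finally show ?thesis by (simp add: decay_def norm_mult indicator_def)
qed

lemma laplace_integrand_measurable:
  assumes [measurable]: "x \<in> borel_measurable borel"
  shows "case_prod (\<lambda>t \<theta>. indicator {0..} t *\<^sub>R (exp (- lam * complex_of_real t) * complex_of_real (x (t + \<theta>))))
    \<in> borel_measurable (borel \<Otimes>\<^sub>M borel)"
proof -
  have [measurable]: "(exp :: complex \<Rightarrow> complex) \<in> borel_measurable borel"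
    by (intro borel_measurable_continuous_onI continuous_intros)
  show ?thesis by measurable
qed

lemma laplace_integrable:
  assumes x: "exp_bounded C \<omega> x" and lam: "\<omega> < Re lam"
  shows "set_integrable lborel {0..} (\<lambda>t. exp (- lam * complex_of_real t) * complex_of_real (x (t + \<theta>)))"
  unfolding set_integrable_def
proof (rule Bochner_Integration.integrable_bound)
  show "integrable lborel (\<lambda>t. C * exp (\<omega> * \<theta>) * decay (Re lam - \<omega>) t)"
    using decay_integrable[of "Re lam - \<omega>"] lam by simp
  have "x \<in> borel_measurable borel" using x by (simp add: exp_bounded_def)
  from measurable_compose[OF measurable_Pair2' laplace_integrand_measurable[OF this]]
  show "(\<lambda>t. indicator {0..} t *\<^sub>R (exp (- lam * complex_of_real t) * complex_of_real (x (t + \<theta>)))) \<in> borel_measurable lborel"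
    by simp
qed (intro always_eventually allI order_trans[OF decay_bound[OF x order_refl]], simp)

lemma norm_laplace_le:
  assumes x: "exp_bounded C \<omega> x" and lam: "\<omega> < Re lam" and K: "exp (\<omega> * \<theta>) \<le> K"
  shows "norm (laplace lam x \<theta>) \<le> C * K * integral\<^sup>L lborel (decay (Re lam - \<omega>))"
proof -
  have "norm (laplace lam x \<theta>) \<le> (\<integral>t. C * K * decay (Re lam - \<omega>) t \<partial>lborel)"
    unfolding laplace_def set_lebesgue_integral_def
    using laplace_integrable[OF x lam] decay_integrable[of "Re lam - \<omega>"] lam
    by (intro Bochner_Integration.integral_norm_bound_integral decay_bound[OF x K]) (simp_all add: set_integrable_def)
  then show ?thesis by simp
qed

lemma laplace_measurable:
  assumes "x \<in> borel_measurable borel"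
  shows "laplace lam x \<in> borel_measurable borel"
  unfolding laplace_def[abs_def] set_lebesgue_integral_def
proof (rule lborel.borel_measurable_lebesgue_integral)
  show "case_prod (\<lambda>\<theta> t. indicator {0..} t *\<^sub>R (exp (- lam * complex_of_real t) * complex_of_real (x (t + \<theta>))))
      \<in> borel_measurable (borel \<Otimes>\<^sub>M lborel)"
    using measurable_compose[OF measurable_pair_swap' laplace_integrand_measurable[OF assms]]
    by (simp add: case_prod_beta' cong: measurable_cong_sets)
qed

lemma laplace_add:
  assumes x: "exp_bounded C \<omega> x" and y: "exp_bounded D \<omega> y" and lam: "\<omega> < Re lam"
  shows "laplace lam (\<lambda>t. x t + y t) \<theta> = laplace lam x \<theta> + laplace lam y \<theta>"
  unfolding laplace_def
  by (simp add: distrib_left set_integral_add(2)[OF laplace_integrable[OF x lam] laplace_integrable[OF y lam], simplified])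

lemma laplace_cmult: "laplace lam (\<lambda>t. c * x t) \<theta> = c * laplace lam x \<theta>"
proof -
  have "(\<lambda>t. exp (- lam * complex_of_real t) * complex_of_real (c * x (t + \<theta>))) =
      (\<lambda>t. complex_of_real c * (exp (- lam * complex_of_real t) * complex_of_real (x (t + \<theta>))))"
    by (auto simp: mult_ac)
  then show ?thesis unfolding laplace_def by simp
qed

lemma laplace_tendsto:
  assumes X: "\<And>m. exp_bounded C \<omega> (X m)" and x: "x \<in> borel_measurable borel" and lam: "\<omega> < Re lam"
    and lim: "\<And>t. (\<lambda>m. X m t) \<longlonglongrightarrow> x t"
  shows "(\<lambda>m. laplace lam (X m) \<theta>) \<longlonglongrightarrow> laplace lam x \<theta>"
  unfolding laplace_def set_lebesgue_integral_def
proof (rule integral_dominated_convergence[where w = "\<lambda>t. C * exp (\<omega> * \<theta>) * decay (Re lam - \<omega>) t"])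
  show "integrable lborel (\<lambda>t. C * exp (\<omega> * \<theta>) * decay (Re lam - \<omega>) t)"
    using decay_integrable[of "Re lam - \<omega>"] lam by simp
  have m: "(\<lambda>t. indicator {0..} t *\<^sub>R (exp (- lam * complex_of_real t) * complex_of_real (y (t + \<theta>)))) \<in> borel_measurable lborel"
    if "y \<in> borel_measurable borel" for y
    using measurable_compose[OF measurable_Pair2' laplace_integrand_measurable[OF that]] by simp
  show "(\<lambda>t. indicator {0..} t *\<^sub>R (exp (- lam * complex_of_real t) * complex_of_real (x (t + \<theta>)))) \<in> borel_measurable lborel"
    by (rule m[OF x])
  show "(\<lambda>t. indicator {0..} t *\<^sub>R (exp (- lam * complex_of_real t) * complex_of_real (X n (t + \<theta>)))) \<in> borel_measurable lborel" for n
    using X[of n] by (intro m) (simp add: exp_bounded_def)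
  show "AE t in lborel. norm (indicator {0..} t *\<^sub>R (exp (- lam * complex_of_real t) * complex_of_real (X n (t + \<theta>)))) \<le> C * exp (\<omega> * \<theta>) * decay (Re lam - \<omega>) t" for n
    by (intro always_eventually allI decay_bound[OF X order_refl])
  show "AE t in lborel. (\<lambda>n. indicator {0..} t *\<^sub>R (exp (- lam * complex_of_real t) * complex_of_real (X n (t + \<theta>))))
      \<longlonglongrightarrow> indicator {0..} t *\<^sub>R (exp (- lam * complex_of_real t) * complex_of_real (x (t + \<theta>)))"
    by (intro always_eventually allI tendsto_intros lim)
qed

lemma exp_shift_le:
  fixes \<sigma> \<omega> :: real
  assumes "\<sigma> \<in> {0..1}"
  shows "exp (\<omega> * (- \<sigma>)) \<le> exp \<bar>\<omega>\<bar>"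
proof -
  have "\<bar>\<omega> * \<sigma>\<bar> \<le> \<bar>\<omega>\<bar> * 1" unfolding abs_mult using assms by (intro mult_left_mono) auto
  then show ?thesis by (simp add: abs_le_iff)
qed

text \<open>Fubini; the factor \<open>exp \<bar>\<omega>\<bar>\<close> makes the exponential majorant uniform over delays in the unit interval.\<close>

lemma scalar_stieltjes_laplace:
  assumes f: "f \<in> NBV" and x: "exp_bounded C \<omega> x" and lam: "\<omega> < Re lam"
  shows "set_integrable lborel {0..} (\<lambda>t. exp (- lam * complex_of_real t) * complex_of_real (scalar_stieltjes f (\<lambda>\<sigma>. x (t - \<sigma>))))"
    "(LBINT t:{0..}. exp (- lam * complex_of_real t) * complex_of_real (scalar_stieltjes f (\<lambda>\<sigma>. x (t - \<sigma>)))) =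
     scalar_stieltjes f (\<lambda>\<sigma>. laplace lam x (- \<sigma>))"
proof -
  define h where "h t \<sigma> = indicator {0..} t *\<^sub>R (exp (- lam * complex_of_real t) * complex_of_real (x (t + - \<sigma>)))" for t \<sigma>
  have xm: "x \<in> borel_measurable borel" using x by (simp add: exp_bounded_def)
  have "(\<lambda>p. (fst p, - snd p)) \<in> measurable (borel \<Otimes>\<^sub>M borel) (borel \<Otimes>\<^sub>M (borel :: real measure))"
    by measurable
  from measurable_compose[OF this laplace_integrand_measurable[OF xm, of lam]]
  have hm: "case_prod h \<in> borel_measurable (borel \<Otimes>\<^sub>M borel)"
    by (simp add: h_def[abs_def] case_prod_beta')
  have w: "integrable lborel (\<lambda>t. C * exp \<bar>\<omega>\<bar> * decay (Re lam - \<omega>) t)"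
    using decay_integrable[of "Re lam - \<omega>"] lam by simp
  have le: "norm (h t \<sigma>) \<le> C * exp \<bar>\<omega>\<bar> * decay (Re lam - \<omega>) t" if "\<sigma> \<in> {0..1}" for t \<sigma>
    unfolding h_def by (rule decay_bound[OF x exp_shift_le[OF that]])
  have b: "bounded_borel (\<lambda>\<sigma>. x (t - \<sigma>))" for t
  proof (rule bounded_borelI)
    show "(\<lambda>\<sigma>. x (t - \<sigma>)) \<in> borel_measurable borel" by (rule measurable_compose[OF _ xm]) simp
    have C: "0 \<le> C"
      using order_trans[OF abs_ge_zero, of "x 0" C] x by (auto simp: exp_bounded_def dest: spec[of _ 0])
    show "norm (x (t - \<sigma>)) \<le> C * (exp (\<omega> * t) * exp \<bar>\<omega>\<bar>)" if "\<sigma> \<in> {0..1}" for \<sigma>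
    proof -
      have "norm (x (t - \<sigma>)) \<le> C * exp (\<omega> * (t - \<sigma>))" using x by (simp add: exp_bounded_def)
      also have "exp (\<omega> * (t - \<sigma>)) = exp (\<omega> * t) * exp (\<omega> * (- \<sigma>))" by (simp add: mult_exp_exp algebra_simps)
      also have "C * \<dots> \<le> C * (exp (\<omega> * t) * exp \<bar>\<omega>\<bar>)"
        using C exp_shift_le[OF that] by (intro mult_left_mono) auto
      finally show ?thesis .
    qed
  qed
  have h: "scalar_stieltjes f (h t) = indicator {0..} t *\<^sub>R
      (exp (- lam * complex_of_real t) * complex_of_real (scalar_stieltjes f (\<lambda>\<sigma>. x (t - \<sigma>))))" for t
    using scalar_stieltjes_cmult_of_real[OF f b, of "indicator {0..} t *\<^sub>R exp (- lam * complex_of_real t)" t]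
    by (simp add: h_def[abs_def])
  note F = scalar_stieltjes_Fubini[OF f hm w le]
  show "set_integrable lborel {0..} (\<lambda>t. exp (- lam * complex_of_real t) * complex_of_real (scalar_stieltjes f (\<lambda>\<sigma>. x (t - \<sigma>))))"
    using F(1) unfolding h set_integrable_def .
  show "(LBINT t:{0..}. exp (- lam * complex_of_real t) * complex_of_real (scalar_stieltjes f (\<lambda>\<sigma>. x (t - \<sigma>)))) =
     scalar_stieltjes f (\<lambda>\<sigma>. laplace lam x (- \<sigma>))"
    using F(2) unfolding h by (simp add: set_lebesgue_integral_def laplace_def h_def)
qed

section \<open>The complex pairing and complexification\<close>

lemma cpairing_add:
  assumes f: "f \<in> NBV"
  shows "cpairing f (x + y) = cpairing f x + cpairing f y"
proof -
  note n = NBV_bounded_linear[OF bounded_linear_Re NBV_nth[OF f]] NBV_bounded_linear[OF bounded_linear_Im NBV_nth[OF f]]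
  note S = n[THEN sigma_functional_scalar_stieltjes(1)]
  note c = bounded_borel_nth[OF bounded_borel_fn]
  note b = bounded_borel_linear[OF bounded_linear_Re c] bounded_borel_linear[OF bounded_linear_Im c]
  show ?thesis
    unfolding cpairing_eq[OF f] sum.distrib[symmetric]
    by (rule sum.cong) (simp_all add: plus_bborel.rep_eq S[THEN sigma_functional_add] b complex_eq_iff)
qed

lemma cpairing_scaleC:
  assumes f: "f \<in> NBV"
  shows "cpairing f (scaleC c y) = c * cpairing f y"
proof -
  note n = NBV_bounded_linear[OF bounded_linear_Re NBV_nth[OF f]] NBV_bounded_linear[OF bounded_linear_Im NBV_nth[OF f]]
  note S = n[THEN sigma_functional_scalar_stieltjes(1)]
  note c = bounded_borel_nth[OF bounded_borel_fn]
  note b = bounded_borel_linear[OF bounded_linear_Re c] bounded_borel_linear[OF bounded_linear_Im c]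
  show ?thesis
    unfolding cpairing_eq[OF f] sum_distrib_left
    by (rule sum.cong) (simp_all add: fn_scaleC S[THEN sigma_functional_add] S[THEN sigma_functional_diff]
        S[THEN sigma_functional_cmult] bounded_borel_cmult b complex_eq_iff algebra_simps)
qed

lemma cpairing_tendsto:
  assumes f: "f \<in> NBV" and B: "\<And>m. norm (Y m) \<le> B"
    and lim: "\<And>\<theta>. \<theta> \<in> {-1..0} \<Longrightarrow> (\<lambda>m. fn (Y m) \<theta>) \<longlonglongrightarrow> fn y \<theta>"
  shows "(\<lambda>m. cpairing f (Y m)) \<longlonglongrightarrow> cpairing f y"
proof -
  note n = NBV_bounded_linear[OF bounded_linear_Re NBV_nth[OF f]] NBV_bounded_linear[OF bounded_linear_Im NBV_nth[OF f]]
  have *: "(\<lambda>m. scalar_stieltjes h (\<lambda>\<sigma>. T (fn (Y m) (- \<sigma>) $ k))) \<longlonglongrightarrow> scalar_stieltjes h (\<lambda>\<sigma>. T (fn y (- \<sigma>) $ k))"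
    if h: "h \<in> NBV" and T: "bounded_linear T" "\<And>z. \<bar>T z\<bar> \<le> norm z" for h k and T :: "complex \<Rightarrow> real"
  proof (rule sigma_functional_tendsto[OF sigma_functional_scalar_stieltjes(1)[OF h], where B = B])
    note b = bounded_borel_measurable[OF bounded_borel_linear[OF T(1) bounded_borel_nth[OF bounded_borel_fn]]]
    show "(\<lambda>\<sigma>. T (fn (Y m) (- \<sigma>) $ k)) \<in> borel_measurable borel" "(\<lambda>\<sigma>. T (fn y (- \<sigma>) $ k)) \<in> borel_measurable borel" for m
      by (rule b)+
    show "\<bar>T (fn (Y m) (- \<sigma>) $ k)\<bar> \<le> B" for m \<sigma>
      using T(2)[of "fn (Y m) (- \<sigma>) $ k"] Finite_Cartesian_Product.norm_nth_le[of "fn (Y m) (- \<sigma>)" k]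
        norm_fn_le[of "Y m" "- \<sigma>"] B[of m] by linarith
    show "(\<lambda>m. T (fn (Y m) (- \<sigma>) $ k)) \<longlonglongrightarrow> T (fn y (- \<sigma>) $ k)" if "\<sigma> \<in> {0..1}" for \<sigma>
      by (rule bounded_linear.tendsto[OF T(1) tendsto_vec_nth[OF lim]]) (use that in auto)
  qed
  have R: "bounded_linear Re" "\<And>z. \<bar>Re z\<bar> \<le> norm z" and I: "bounded_linear Im" "\<And>z. \<bar>Im z\<bar> \<le> norm z"
    by (auto simp: bounded_linear_Re bounded_linear_Im abs_Re_le_cmod abs_Im_le_cmod)
  show ?thesis
    unfolding cpairing_eq[OF f]
    by (intro tendsto_sum tendsto_Complex tendsto_diff tendsto_add *[OF n(1) R] *[OF n(2) R] *[OF n(1) I] *[OF n(2) I])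
qed

lemma fn_bborel_of_linear:
  fixes T :: "'a::euclidean_space \<Rightarrow> 'b::euclidean_space"
  assumes T: "bounded_linear T"
  shows "fn (bborel_of (\<lambda>\<theta>. T (fn y \<theta>))) \<theta> = T (fn y \<theta>)"
proof -
  interpret T: bounded_linear T by fact
  have Tm: "T \<in> borel_measurable borel"
    by (intro borel_measurable_continuous_onI linear_continuous_on T)
  have m: "(\<lambda>\<theta>. T (fn y \<theta>)) \<in> borel_measurable (restrict_space borel {-1..0})"
    by (rule measurable_restrict_space1[OF measurable_compose[OF measurable_fn Tm]])
  have "bounded (T ` range (fn y))" by (rule bounded_linear_image[OF bounded_fn T])
  then have "bounded ((\<lambda>\<theta>. T (fn y \<theta>)) ` {-1..0})" by (rule bounded_subset) auto
  from fn_bborel_of[OF m this] show ?thesis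
    using fn_outside[of \<theta> y] by (auto simp: T.zero)
qed

lemma scaleR_eq_scaleC: "c *\<^sub>R y = scaleC (complex_of_real c) y"
  by (rule bborel_eqI) (simp add: scaleR_bborel.rep_eq fn_scaleC vec_eq_iff, simp add: scaleR_conv_of_real)

definition re_part :: "(complex ^ 'n) bborel \<Rightarrow> (real ^ 'n) bborel" where
  "re_part y = bborel_of (\<lambda>\<theta>. \<chi> k. Re (fn y \<theta> $ k))"

definition im_part :: "(complex ^ 'n) bborel \<Rightarrow> (real ^ 'n) bborel" where
  "im_part y = bborel_of (\<lambda>\<theta>. \<chi> k. Im (fn y \<theta> $ k))"

lemma fn_re_part: "fn (re_part y) \<theta> = (\<chi> k. Re (fn y \<theta> $ k))"
  unfolding re_part_def
  by (rule fn_bborel_of_linear, intro linear_conv_bounded_linear[THEN iffD1] linearI)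
     (simp_all add: vec_eq_iff)

lemma fn_im_part: "fn (im_part y) \<theta> = (\<chi> k. Im (fn y \<theta> $ k))"
  unfolding im_part_def
  by (rule fn_bborel_of_linear, intro linear_conv_bounded_linear[THEN iffD1] linearI)
     (simp_all add: vec_eq_iff)

lemma norm_re_part_le: "norm (re_part y) \<le> norm y"
proof (rule norm_bborel_leI)
  fix \<theta> :: real
  have "norm (fn (re_part y) \<theta>) \<le> norm (fn y \<theta>)"
    unfolding fn_re_part norm_vec_def by (intro L2_set_mono) (auto simp: abs_Re_le_cmod)
  then show "norm (fn (re_part y) \<theta>) \<le> norm y" using norm_fn_le order_trans by blast
qed

lemma norm_im_part_le: "norm (im_part y) \<le> norm y"
proof (rule norm_bborel_leI)
  fix \<theta> :: real
  have "norm (fn (im_part y) \<theta>) \<le> norm (fn y \<theta>)"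
    unfolding fn_im_part norm_vec_def by (intro L2_set_mono) (auto simp: abs_Im_le_cmod)
  then show "norm (fn (im_part y) \<theta>) \<le> norm y" using norm_fn_le order_trans by blast
qed

lemma norm_scaleC_le: "norm (scaleC c y) \<le> cmod c * norm y"
proof (rule norm_bborel_leI)
  fix \<theta> :: real
  have "norm (c *s fn y \<theta>) = cmod c * norm (fn y \<theta>)"
    unfolding norm_vec_def by (simp add: norm_mult L2_set_right_distrib)
  then show "norm (fn (scaleC c y) \<theta>) \<le> cmod c * norm y"
    by (simp add: fn_scaleC mult_left_mono norm_fn_le)
qed

text \<open>A complex-linear operator is determined by its values on real elements.\<close>

lemma re_im_part: "cfn (re_part y) + scaleC \<i> (cfn (im_part y)) = y"
  by (rule bborel_eqI)
     (simp add: plus_bborel.rep_eq fn_scaleC fn_cfn fn_re_part fn_im_part cvec_def vec_eq_iff complex_eq_iff)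

lemma re_part_cfn: "re_part (cfn y) = y"
  by (rule bborel_eqI) (simp add: fn_re_part fn_cfn cvec_def vec_eq_iff)

lemma im_part_cfn: "im_part (cfn y) = 0"
  by (rule bborel_eqI) (simp add: fn_im_part fn_cfn cvec_def vec_eq_iff zero_bborel.rep_eq)

section \<open>The resolvent\<close>

context delay_equation
begin

lemma sol_exp_bounded: "exp_bounded (2 * exp growth * norm y) growth (\<lambda>t. sol y t $ k)"
  unfolding exp_bounded_def
proof (intro conjI allI)
  show "(\<lambda>t. sol y t $ k) \<in> borel_measurable borel" by (rule borel_measurable_vecD[OF sol_measurable])
  show "\<bar>sol y t $ k\<bar> \<le> 2 * exp growth * norm y * exp (growth * t)" for t
    using component_le_norm_cart[of "sol y t" k] norm_sol_le[of y t] by linarith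
qed

definition real_resolvent :: "complex \<Rightarrow> (real ^ 'n) bborel \<Rightarrow> (complex ^ 'n) bborel" where
  "real_resolvent lam y = bborel_of (\<lambda>\<theta>. \<chi> k. laplace lam (\<lambda>t. sol y t $ k) \<theta>)"

definition resolvent_const :: "complex \<Rightarrow> real" where
  "resolvent_const lam = CARD('n) * (2 * exp growth * integral\<^sup>L lborel (decay (Re lam - growth)))"

lemma resolvent_const_nonneg: "0 \<le> resolvent_const lam"
proof -
  have "0 \<le> integral\<^sup>L lborel (decay (Re lam - growth))"
    by (rule Bochner_Integration.integral_nonneg) (simp add: decay_def)
  then show ?thesis by (simp add: resolvent_const_def)
qed

lemma norm_laplace_sol_le:
  assumes "growth < Re lam" "\<theta> \<le> 0"
  shows "norm (\<chi> k. laplace lam (\<lambda>t. sol y t $ k) \<theta>) \<le> resolvent_const lam * norm y"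
proof -
  have "growth * \<theta> \<le> 0" using assms(2) growth_pos by (simp add: mult_nonneg_nonpos)
  then have "exp (growth * \<theta>) \<le> 1" by simp
  note L = norm_laplace_le[OF sol_exp_bounded assms(1) this]
  have "norm (\<chi> k. laplace lam (\<lambda>t. sol y t $ k) \<theta>) \<le> (\<Sum>k\<in>UNIV. norm (laplace lam (\<lambda>t. sol y t $ k) \<theta>))"
    unfolding norm_vec_def by (rule order_trans[OF L2_set_le_sum]) auto
  also have "\<dots> \<le> (\<Sum>k\<in>(UNIV::'n set). 2 * exp growth * norm y * 1 * integral\<^sup>L lborel (decay (Re lam - growth)))"
    by (intro sum_mono L)
  finally show ?thesis by (simp add: resolvent_const_def mult_ac)
qed

lemma fn_real_resolvent:
  assumes "growth < Re lam"
  shows "fn (real_resolvent lam y) = (\<lambda>\<theta>. if \<theta> \<in> {-1..0} then \<chi> k. laplace lam (\<lambda>t. sol y t $ k) \<theta> else 0)"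
  unfolding real_resolvent_def
proof (rule fn_bborel_of)
  have "(\<lambda>\<theta>. \<chi> k. laplace lam (\<lambda>t. sol y t $ k) \<theta>) \<in> borel_measurable borel"
    by (rule borel_measurable_vecI)
       (simp add: laplace_measurable borel_measurable_vecD sol_measurable)
  then show "(\<lambda>\<theta>. \<chi> k. laplace lam (\<lambda>t. sol y t $ k) \<theta>) \<in> borel_measurable (restrict_space borel {-1..0})"
    by (rule measurable_restrict_space1)
  show "bounded ((\<lambda>\<theta>. \<chi> k. laplace lam (\<lambda>t. sol y t $ k) \<theta>) ` {-1..0})"
    by (rule boundedI[of _ "resolvent_const lam * norm y"]) (auto intro!: norm_laplace_sol_le[OF assms])
qed

lemma norm_real_resolvent_le:
  assumes "growth < Re lam"
  shows "norm (real_resolvent lam y) \<le> resolvent_const lam * norm y"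
  by (rule norm_bborel_leI) (simp add: fn_real_resolvent[OF assms] norm_laplace_sol_le[OF assms])

lemma real_resolvent_linear:
  assumes lam: "growth < Re lam"
  shows "linear (real_resolvent lam)"
proof (intro linearI bborel_eqI)
  fix \<theta> :: real assume \<theta>: "\<theta> \<in> {-1..0}"
  show "fn (real_resolvent lam (x + y)) \<theta> = fn (real_resolvent lam x + real_resolvent lam y) \<theta>" for x y
    using \<theta> by (simp add: fn_real_resolvent[OF lam] plus_bborel.rep_eq vec_eq_iff sol_add
        laplace_add[OF sol_exp_bounded sol_exp_bounded lam])
  show "fn (real_resolvent lam (c *\<^sub>R x)) \<theta> = fn (c *\<^sub>R real_resolvent lam x) \<theta>" for c x
    using \<theta> by (simp add: fn_real_resolvent[OF lam] scaleR_bborel.rep_eq vec_eq_iff sol_scale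
        laplace_cmult scaleR_conv_of_real[symmetric] del: of_real_mult)
qed

lemma real_resolvent_sigma_continuous:
  assumes f: "f \<in> NBV" and lam: "growth < Re lam"
  shows "sigma_continuous (\<lambda>y. cpairing f (real_resolvent lam y))"
  unfolding sigma_continuous_def
proof (intro conjI allI impI)
  note R = real_resolvent_linear[OF lam]
  show "linear (\<lambda>y. cpairing f (real_resolvent lam y))"
    by (rule linearI)
       (simp_all add: linear_add[OF R] linear_scale[OF R] cpairing_add[OF f] scaleR_eq_scaleC cpairing_scaleC[OF f] scaleR_conv_of_real)
  fix Y :: "nat \<Rightarrow> (real ^ 'n) bborel" and y B
  assume Y: "\<forall>m. norm (Y m) \<le> B" "\<forall>\<theta>\<in>{-1..0}. (\<lambda>m. fn (Y m) \<theta>) \<longlonglongrightarrow> fn y \<theta>"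
  show "(\<lambda>m. cpairing f (real_resolvent lam (Y m))) \<longlonglongrightarrow> cpairing f (real_resolvent lam y)"
  proof (rule cpairing_tendsto[OF f])
    show "norm (real_resolvent lam (Y m)) \<le> resolvent_const lam * B" for m
      using Y resolvent_const_nonneg by (intro order_trans[OF norm_real_resolvent_le[OF lam] mult_left_mono]) auto
    fix \<theta> :: real assume \<theta>: "\<theta> \<in> {-1..0}"
    have "(\<lambda>m. laplace lam (\<lambda>t. sol (Y m) t $ k) \<theta>) \<longlonglongrightarrow> laplace lam (\<lambda>t. sol y t $ k) \<theta>" for k
    proof (rule laplace_tendsto[OF _ _ lam])
      show "exp_bounded (2 * exp growth * B) growth (\<lambda>t. sol (Y m) t $ k)" for m
      proof -
        have "2 * exp growth * norm (Y m) * exp (growth * t) \<le> 2 * exp growth * B * exp (growth * t)" for t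
          using Y by (intro mult_right_mono mult_left_mono) auto
        then show ?thesis
          using sol_exp_bounded[of "Y m" k] unfolding exp_bounded_def by (meson order_trans)
      qed
      show "(\<lambda>t. sol y t $ k) \<in> borel_measurable borel" by (rule borel_measurable_vecD[OF sol_measurable])
      show "(\<lambda>m. sol (Y m) t $ k) \<longlonglongrightarrow> sol y t $ k" for t
        using Y by (intro tendsto_vec_nth sol_tendsto[of Y B]) auto
    qed
    then show "(\<lambda>m. fn (real_resolvent lam (Y m)) \<theta>) \<longlonglongrightarrow> fn (real_resolvent lam y) \<theta>"
      using \<theta> by (intro vec_tendstoI) (simp add: fn_real_resolvent[OF lam])
  qed
qed

definition resolvent :: "complex \<Rightarrow> (complex ^ 'n) bborel \<Rightarrow> (complex ^ 'n) bborel" where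
  "resolvent lam y = real_resolvent lam (re_part y) + scaleC \<i> (real_resolvent lam (im_part y))"

lemma resolvent_complex_linear:
  assumes lam: "growth < Re lam"
  shows "resolvent lam (x + y) = resolvent lam x + resolvent lam y"
    "resolvent lam (scaleC c y) = scaleC c (resolvent lam y)"
proof -
  note R = real_resolvent_linear[OF lam]
  have "re_part (x + y) = re_part x + re_part y" "im_part (x + y) = im_part x + im_part y"
    by (rule bborel_eqI, simp add: fn_re_part fn_im_part plus_bborel.rep_eq vec_eq_iff)+
  then show "resolvent lam (x + y) = resolvent lam x + resolvent lam y"
    by (intro bborel_eqI)
       (simp add: resolvent_def linear_add[OF R] plus_bborel.rep_eq fn_scaleC vec_eq_iff algebra_simps)
  have "re_part (scaleC c y) = Re c *\<^sub>R re_part y + (- Im c) *\<^sub>R im_part y"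
    "im_part (scaleC c y) = Re c *\<^sub>R im_part y + Im c *\<^sub>R re_part y"
    by (rule bborel_eqI,
        simp add: fn_re_part fn_im_part plus_bborel.rep_eq minus_bborel.rep_eq scaleR_bborel.rep_eq
          fn_scaleC vec_eq_iff)+
  note parts = this[THEN arg_cong[where f = "real_resolvent lam"], unfolded linear_add[OF R] linear_scale[OF R]]
  show "resolvent lam (scaleC c y) = scaleC c (resolvent lam y)"
    unfolding resolvent_def parts
    by (intro bborel_eqI)
       (simp add: plus_bborel.rep_eq minus_bborel.rep_eq scaleR_bborel.rep_eq
         fn_scaleC vec_eq_iff complex_eq_iff algebra_simps)
qed

lemma resolvent_bounded_linear:
  assumes lam: "growth < Re lam"
  shows "bounded_linear (resolvent lam)"
proof (rule bounded_linear_intro)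
  show "resolvent lam (x + y) = resolvent lam x + resolvent lam y" for x y
    by (rule resolvent_complex_linear[OF lam])
  show "resolvent lam (r *\<^sub>R x) = r *\<^sub>R resolvent lam x" for r x
    unfolding scaleR_eq_scaleC by (rule resolvent_complex_linear[OF lam])
  show "norm (resolvent lam y) \<le> norm y * (2 * resolvent_const lam)" for y
  proof -
    note c = resolvent_const_nonneg[of lam]
    have "norm (real_resolvent lam (re_part y)) \<le> resolvent_const lam * norm y"
      by (rule order_trans[OF norm_real_resolvent_le[OF lam] mult_left_mono[OF norm_re_part_le c]])
    moreover have "norm (real_resolvent lam (im_part y)) \<le> resolvent_const lam * norm y"
      by (rule order_trans[OF norm_real_resolvent_le[OF lam] mult_left_mono[OF norm_im_part_le c]])
    then have "norm (scaleC \<i> (real_resolvent lam (im_part y))) \<le> resolvent_const lam * norm y"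
      using norm_scaleC_le[of \<i> "real_resolvent lam (im_part y)"] by simp
    ultimately show ?thesis
      unfolding resolvent_def by (rule order_trans[OF norm_triangle_mono]) simp
  qed
qed

lemma resolvent_cfn:
  assumes "growth < Re lam"
  shows "resolvent lam (cfn y) = real_resolvent lam y"
  by (rule bborel_eqI)
     (simp add: resolvent_def re_part_cfn im_part_cfn linear_0[OF real_resolvent_linear[OF assms]]
       plus_bborel.rep_eq fn_scaleC zero_bborel.rep_eq vec_eq_iff)

text \<open>The functional \<open>y \<mapsto> \<langle>f, R y\<rangle>\<close> on real elements is continuous under bounded pointwise convergence,
  hence given by a function of bounded variation, which then represents it on complex elements.\<close>

lemma resolvent_adjoint:
  assumes f: "f \<in> NBV" and lam: "growth < Re lam"
  shows "\<exists>g\<in>NBV. \<forall>y. cpairing f (resolvent lam y) = cpairing g y"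
proof -
  obtain g where g: "g \<in> NBV" "\<And>y. cpairing f (real_resolvent lam y) = cpairing g (cfn y)"
    by (rule cpairing_representation[OF real_resolvent_sigma_continuous[OF f lam]]) blast
  have "cpairing f (resolvent lam y) = cpairing g y" for y
  proof -
    have "cpairing f (resolvent lam y) = cpairing g (cfn (re_part y)) + \<i> * cpairing g (cfn (im_part y))"
      by (simp add: resolvent_def cpairing_add[OF f] cpairing_scaleC[OF f] g(2))
    also have "\<dots> = cpairing g (cfn (re_part y) + scaleC \<i> (cfn (im_part y)))"
      by (simp add: cpairing_add[OF g(1)] cpairing_scaleC[OF g(1)])
    finally show ?thesis by (simp only: re_im_part)
  qed
  then show ?thesis using g(1) by blast
qed

text \<open>The weak defining identity of the Laplace transformed semigroup follows from the pointwise
  definition by Fubini.\<close>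

lemma cpairing_resolvent:
  assumes f: "f \<in> NBV" and lam: "growth < Re lam"
  shows "cpairing (\<lambda>\<sigma>. cvec (f \<sigma>)) (resolvent lam (cfn y)) =
    (LBINT t:{0..}. exp (- lam * complex_of_real t) * complex_of_real (pairing f (delay_semigroup \<zeta> t y)))"
proof -
  note L = scalar_stieltjes_laplace[OF NBV_nth[OF f] sol_exp_bounded lam]
  have "cpairing (\<lambda>\<sigma>. cvec (f \<sigma>)) (resolvent lam (cfn y)) =
      (\<Sum>k\<in>UNIV. scalar_stieltjes (\<lambda>\<sigma>. f \<sigma> $ k) (\<lambda>\<sigma>. laplace lam (\<lambda>t. sol y t $ k) (- \<sigma>)))"
    unfolding cpairing_cvec[OF f] resolvent_cfn[OF lam]
    by (intro sum.cong refl scalar_stieltjes_cong NBV_nth f) (simp add: fn_real_resolvent[OF lam])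
  also have "\<dots> = (\<Sum>k\<in>UNIV. LBINT t:{0..}. exp (- lam * complex_of_real t) *
      complex_of_real (scalar_stieltjes (\<lambda>\<sigma>. f \<sigma> $ k) (\<lambda>\<sigma>. sol y (t - \<sigma>) $ k)))"
    by (intro sum.cong refl L(2)[symmetric])
  also have "\<dots> = (LBINT t:{0..}. (\<Sum>k\<in>UNIV. exp (- lam * complex_of_real t) *
      complex_of_real (scalar_stieltjes (\<lambda>\<sigma>. f \<sigma> $ k) (\<lambda>\<sigma>. sol y (t - \<sigma>) $ k))))"
    using L(1) unfolding set_lebesgue_integral_def set_integrable_def
    by (subst Bochner_Integration.integral_sum[symmetric]) (simp_all add: scaleR_sum_right)
  finally show ?thesis unfolding pairing_semigroup[OF f] by (simp add: sum_distrib_left)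
qed

lemma laplace_operator_resolvent:
  assumes "growth < Re lam"
  shows "laplace_operator (delay_semigroup \<zeta>) lam (resolvent lam)"
  unfolding laplace_operator_def
  using resolvent_bounded_linear[OF assms] resolvent_complex_linear(2)[OF assms]
    resolvent_adjoint[OF _ assms] cpairing_resolvent[OF _ assms] by blast

lemma twin_semigroup_with_growth:
  "twin_semigroup_with (delay_semigroup \<zeta>) (1 + CARD('n) * (2 * exp growth)) growth"
  unfolding twin_semigroup_with_def
proof (intro conjI allI impI ballI)
  fix t :: real and f :: "real \<Rightarrow> real ^ 'n" and y assume f: "f \<in> NBV"
  \<comment> \<open>Invariance of NBV under the adjoint: the composition is continuous under bounded convergence.\<close>
  show "\<exists>g\<in>NBV. \<forall>y. pairing f (delay_semigroup \<zeta> t y) = pairing g y"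
    using pairing_representation[OF semigroup_sigma_continuous[OF f]] by blast
  have tv: "0 \<le> total_variation f" by (rule total_variation_nonneg[OF f])
  have "\<bar>pairing f (delay_semigroup \<zeta> t y)\<bar> \<le> CARD('n) * total_variation f * norm (delay_semigroup \<zeta> t y)"
    by (rule pairing_bound[OF f])
  also have "\<dots> \<le> CARD('n) * total_variation f * (2 * exp growth * exp (growth * t) * norm y)"
    using tv by (intro mult_left_mono norm_semigroup_le) auto
  also have "\<dots> = (CARD('n) * (2 * exp growth)) * (exp (growth * t) * norm y * total_variation f)"
    by (simp add: mult_ac)
  also have "\<dots> \<le> (1 + CARD('n) * (2 * exp growth)) * (exp (growth * t) * norm y * total_variation f)"
    using tv by (intro mult_right_mono) auto
  finally show "\<bar>pairing f (delay_semigroup \<zeta> t y)\<bar> \<le>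
      (1 + CARD('n) * (2 * exp growth)) * exp (growth * t) * norm y * total_variation f"
    by (simp add: mult_ac)
  show "(\<lambda>t. pairing f (delay_semigroup \<zeta> t y)) \<in> borel_measurable (restrict_space borel {0..})"
    by (rule measurable_restrict_space1[OF pairing_semigroup_measurable[OF f]])
next
  fix lam assume "growth < Re lam"
  then show "\<exists>R. laplace_operator (delay_semigroup \<zeta>) lam R" using laplace_operator_resolvent by blast
qed (simp_all add: semigroup_bounded_linear semigroup_zero semigroup_add)

end

section \<open>Laplace transforms of primitives\<close>

text \<open>Integration by parts for a primitive \<open>u\<close> of a bounded Borel function \<open>h\<close>, whose
  derivative need not exist everywhere: insert \<open>u(t) = u(a) + \<integral> h\<close> and exchange the order of integration over the
  triangle \<open>a \<le> s \<le> t \<le> b\<close>.\<close>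

lemma laplace_by_parts:
  fixes u h :: "real \<Rightarrow> complex" and \<mu> :: complex
  assumes ab: "a \<le> b" and h: "h \<in> borel_measurable borel" "\<And>s. s \<in> {a..b} \<Longrightarrow> norm (h s) \<le> B"
    and u: "\<And>t. t \<in> {a..b} \<Longrightarrow> u t = u a + (LBINT s:{a..t}. h s)"
  shows "(LBINT t:{a..b}. exp (- \<mu> * complex_of_real t) * (\<mu> * u t - h t)) =
    exp (- \<mu> * complex_of_real a) * u a - exp (- \<mu> * complex_of_real b) * u b"
proof -
  define E where "E t = exp (- \<mu> * complex_of_real t)" for t
  define H where "H t = (LBINT s:{a..t}. h s)" for t
  have contE: "continuous_on S E" for S unfolding E_def[abs_def] by (intro continuous_intros)
  have Em [measurable]: "E \<in> borel_measurable borel" by (intro borel_measurable_continuous_onI contE)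
  note [measurable] = h(1)
  have "compact (E ` {a..b})" by (intro compact_continuous_image contE) simp
  then obtain K where K: "\<And>t. t \<in> {a..b} \<Longrightarrow> norm (E t) \<le> K"
    using compact_imp_bounded by (fastforce simp: bounded_iff)
  have B0: "0 \<le> B" using order_trans[OF norm_ge_zero h(2)[of a]] ab by simp
  have K0: "0 \<le> K" using order_trans[OF norm_ge_zero K[of a]] ab by simp
  have dE: "(LBINT t:{s..b}. \<mu> * E t) = E s - E b" if "s \<le> b" for s
  proof -
    have "((\<lambda>t. - E t) has_vector_derivative \<mu> * E t) (at t within {s..b})" for t
      unfolding E_def
      by (rule has_vector_derivative_real_field[THEN has_vector_derivative_at_within])
         (auto intro!: derivative_eq_intros)
    then show ?thesis
      unfolding set_lebesgue_integral_def using that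
      by (subst integral_FTC_atLeastAtMost[where F = "\<lambda>t. - E t"]) (auto intro!: continuous_intros contE)
  qed
  \<comment> \<open>The integrand over the triangle; its inner integrals are computed in both orders.\<close>
  define f where "f t s = (if a \<le> s \<and> s \<le> t \<and> t \<le> b then \<mu> * E t * h s else 0)" for t s
  have fm: "case_prod f \<in> borel_measurable (lborel \<Otimes>\<^sub>M lborel)"
    unfolding f_def[abs_def] by measurable
  have "integrable (lborel \<Otimes>\<^sub>M lborel) (case_prod f)"
  proof (rule Bochner_Integration.integrable_bound[OF _ fm])
    have "emeasure (lborel \<Otimes>\<^sub>M lborel) ({a..b} \<times> {a..b}) < \<infinity>"
      by (subst lborel.emeasure_pair_measure_Times) (auto simp: emeasure_lborel_Icc_eq ennreal_mult_less_top)
    then show "integrable (lborel \<Otimes>\<^sub>M lborel) (\<lambda>p. indicator ({a..b} \<times> {a..b}) p *\<^sub>R (cmod \<mu> * K * B))"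
      by (intro integrable_scaleR_left integrable_real_indicator) auto
    have "norm (f t s) \<le> norm (indicator ({a..b} \<times> {a..b}) (t, s) *\<^sub>R (cmod \<mu> * K * B))" for t s
    proof (cases "a \<le> s \<and> s \<le> t \<and> t \<le> b")
      case True
      then have "cmod \<mu> * norm (E t) * norm (h s) \<le> cmod \<mu> * K * B"
        using K[of t] h(2)[of s] K0 by (intro mult_mono) auto
      then show ?thesis using True B0 K0 by (simp add: f_def norm_mult abs_mult)
    next
      case False
      then have "f t s = 0" unfolding f_def by (rule if_not_P)
      then show ?thesis by simp
    qed
    then show "AE p in lborel \<Otimes>\<^sub>M lborel. norm (case_prod f p) \<le> norm (indicator ({a..b} \<times> {a..b}) p *\<^sub>R (cmod \<mu> * K * B))"
      by (intro always_eventually) auto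
  qed
  note F = lborel_pair.Fubini_integral[OF this] lborel_pair.integrable_fst[OF this]
  have f1: "(\<integral>s. f t s \<partial>lborel) = indicator {a..b} t *\<^sub>R (\<mu> * E t * H t)" for t
  proof -
    have "(\<integral>s. f t s \<partial>lborel) =
        (\<integral>s. (indicator {a..b} t *\<^sub>R (\<mu> * E t)) * (indicator {a..t} s *\<^sub>R h s) \<partial>lborel)"
      by (intro Bochner_Integration.integral_cong refl) (auto simp: f_def indicator_def)
    also have "\<dots> = (indicator {a..b} t *\<^sub>R (\<mu> * E t)) * (\<integral>s. indicator {a..t} s *\<^sub>R h s \<partial>lborel)"
      by (rule integral_mult_right_zero)
    finally show ?thesis by (simp add: H_def set_lebesgue_integral_def)
  qed
  have f2: "(\<integral>t. f t s \<partial>lborel) = indicator {a..b} s *\<^sub>R ((E s - E b) * h s)" for s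
  proof (cases "s \<le> b")
    case True
    have "(\<integral>t. f t s \<partial>lborel) =
        (\<integral>t. (indicator {s..b} t *\<^sub>R (\<mu> * E t)) * (indicator {a..b} s *\<^sub>R h s) \<partial>lborel)"
      using True by (intro Bochner_Integration.integral_cong refl) (auto simp: f_def indicator_def)
    also have "\<dots> = (\<integral>t. indicator {s..b} t *\<^sub>R (\<mu> * E t) \<partial>lborel) * (indicator {a..b} s *\<^sub>R h s)"
      by (rule integral_mult_left_zero)
    finally show ?thesis unfolding dE[OF True, unfolded set_lebesgue_integral_def] by simp
  next
    case False
    then have "f t s = 0" for t by (auto simp: f_def)
    then show ?thesis using False by simp
  qed
  have iH: "set_integrable lborel {a..b} (\<lambda>t. \<mu> * E t * H t)"
    using F(2) unfolding f1 set_integrable_def .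
  have ih: "set_integrable lborel {a..b} h" using h by (rule set_integrable_Icc_bounded)
  have iE: "set_integrable lborel {a..b} (\<lambda>t. \<mu> * E t * u a)"
    by (rule set_integrable_Icc_bounded[where B = "cmod \<mu> * K * norm (u a)"])
       (use K in \<open>auto simp: norm_mult intro!: mult_right_mono mult_left_mono\<close>)
  have iEh: "set_integrable lborel {a..b} (\<lambda>t. E t * h t)"
    by (rule set_integrable_Icc_bounded[where B = "K * B"])
       (use K h K0 in \<open>auto simp: norm_mult intro!: mult_mono\<close>)
  have IH: "(LBINT t:{a..b}. \<mu> * E t * H t) = (LBINT s:{a..b}. E s * h s) - E b * H b"
  proof -
    have "(LBINT t:{a..b}. \<mu> * E t * H t) = (LBINT s:{a..b}. (E s - E b) * h s)"
      using F(1) unfolding f1 f2 by (simp add: set_lebesgue_integral_def)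
    also have "\<dots> = (LBINT s:{a..b}. E s * h s) - (LBINT s:{a..b}. E b * h s)"
      unfolding left_diff_distrib using ih by (intro set_integral_diff iEh) simp
    finally show ?thesis by (simp add: H_def)
  qed
  have "(LBINT t:{a..b}. E t * (\<mu> * u t - h t)) = (LBINT t:{a..b}. (\<mu> * E t * u a + \<mu> * E t * H t) - E t * h t)"
  proof (rule set_lebesgue_integral_cong)
    have "E t * (\<mu> * u t - h t) = \<mu> * E t * u a + \<mu> * E t * H t - E t * h t" if "t \<in> {a..b}" for t
    proof -
      have "u t = u a + H t" unfolding H_def by (rule u[OF that])
      then show ?thesis by (simp only:) (simp add: algebra_simps)
    qed
    then show "\<forall>t. t \<in> {a..b} \<longrightarrow> E t * (\<mu> * u t - h t) = \<mu> * E t * u a + \<mu> * E t * H t - E t * h t"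
      by blast
  qed simp
  also have "\<dots> = ((LBINT t:{a..b}. \<mu> * E t * u a) + (LBINT t:{a..b}. \<mu> * E t * H t)) - (LBINT t:{a..b}. E t * h t)"
    by (simp add: set_integral_diff(2)[OF set_integral_add(1)[OF iE iH] iEh] set_integral_add(2)[OF iE iH])
  also have "\<dots> = (E a - E b) * u a - E b * H b"
    unfolding IH using dE[OF ab] by simp
  also have "\<dots> = E a * u a - E b * u b"
  proof -
    have "u b = u a + H b" unfolding H_def by (rule u) (use ab in simp)
    then show ?thesis by (simp only:) (simp add: algebra_simps)
  qed
  finally show ?thesis by (simp add: E_def)
qed

lemma exp_bounded_nonneg: "exp_bounded C \<omega> x \<Longrightarrow> 0 \<le> C"
  using order_trans[OF abs_ge_zero, of "x 0" C] by (auto simp: exp_bounded_def dest: spec[of _ 0])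

lemma exp_bounded_on_Icc:
  assumes "exp_bounded C \<omega> x"
  obtains B where "\<And>s. s \<in> {a..b} \<Longrightarrow> \<bar>x s\<bar> \<le> B"
proof -
  have "\<bar>x s\<bar> \<le> C * exp (\<bar>\<omega>\<bar> * (\<bar>a\<bar> + \<bar>b\<bar>))" if "s \<in> {a..b}" for s
  proof -
    have "\<omega> * s \<le> \<bar>\<omega> * s\<bar>" by simp
    also have "\<dots> \<le> \<bar>\<omega>\<bar> * (\<bar>a\<bar> + \<bar>b\<bar>)" unfolding abs_mult using that by (intro mult_left_mono) auto
    finally have "C * exp (\<omega> * s) \<le> C * exp (\<bar>\<omega>\<bar> * (\<bar>a\<bar> + \<bar>b\<bar>))"
      using exp_bounded_nonneg[OF assms] by (intro mult_left_mono) auto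
    then show ?thesis using assms unfolding exp_bounded_def by (meson order_trans)
  qed
  then show ?thesis by (rule that)
qed

text \<open>The rule for the Laplace transform of a derivative. The exponent may have any real part above
  \<open>\<omega>\<close>, possibly a negative one, so the constant \<open>u(a)\<close> cannot be transformed separately; the identity is
  obtained on finite intervals, and the boundary term at infinity tends to 0.\<close>

lemma laplace_derivative:
  assumes u: "exp_bounded C \<omega> u" and h: "exp_bounded D \<omega> h" and lam: "\<omega> < Re lam"
    and int: "\<And>t. a \<le> t \<Longrightarrow> u t = u a + (LBINT s:{a..t}. h s)"
  shows "lam * laplace lam u a - laplace lam h a = complex_of_real (u a)"
proof -
  let ?E = "\<lambda>t. exp (- lam * complex_of_real t)"
  let ?g = "\<lambda>t. ?E t * (lam * complex_of_real (u (t + a)) - complex_of_real (h (t + a)))"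
  have hm: "h \<in> borel_measurable borel" using h by (simp add: exp_bounded_def)
  have fin: "(LBINT t:{0..T}. ?g t) = complex_of_real (u a) - ?E T * complex_of_real (u (T + a))" if T: "0 \<le> T" for T
  proof -
    obtain B where B: "\<And>s. s \<in> {a..T + a} \<Longrightarrow> \<bar>h s\<bar> \<le> B" using h by (rule exp_bounded_on_Icc) blast
    have "(LBINT t:{0..T}. ?g t) = ?E 0 * complex_of_real (u (0 + a)) - ?E T * complex_of_real (u (T + a))"
    proof (rule laplace_by_parts[OF T])
      show "(\<lambda>t. complex_of_real (h (t + a))) \<in> borel_measurable borel" using hm by measurable
      show "norm (complex_of_real (h (s + a))) \<le> B" if "s \<in> {0..T}" for s using B[of "s + a"] that by auto
      show "complex_of_real (u (t + a)) = complex_of_real (u (0 + a)) + (LBINT s:{0..t}. complex_of_real (h (s + a)))"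
        if "t \<in> {0..T}" for t
      proof -
        have "u (t + a) = u a + (LBINT s:{0..t}. h (s + a))"
          using int[of "t + a"] set_integral_shift[of a "t + a" h a] that by simp
        then show ?thesis by (simp add: set_integral_complex_of_real)
      qed
    qed
    then show ?thesis by simp
  qed
  have iu: "set_integrable lborel {0..} (\<lambda>t. lam * (?E t * complex_of_real (u (t + a))))"
    using laplace_integrable[OF u lam, of a] by simp
  note ih = laplace_integrable[OF h lam, of a]
  have g: "?g = (\<lambda>t. lam * (?E t * complex_of_real (u (t + a))) - ?E t * complex_of_real (h (t + a)))"
    by (auto simp: algebra_simps)
  have gi: "set_integrable lborel {0..} ?g" unfolding g by (rule set_integral_diff(1)[OF iu ih])
  have gv: "(LBINT t:{0..}. ?g t) = lam * laplace lam u a - laplace lam h a"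
    unfolding g laplace_def using set_integral_diff(2)[OF iu ih] by simp
  have lim: "((\<lambda>T. LBINT t:{0..T}. ?g t) \<longlongrightarrow> (LBINT t:{0..}. ?g t)) at_top"
    by (rule tendsto_set_lebesgue_integral_at_top[OF _ gi]) simp
  have lim': "((\<lambda>T. complex_of_real (u a) - ?E T * complex_of_real (u (T + a))) \<longlongrightarrow> complex_of_real (u a) - 0) at_top"
  proof (rule tendsto_diff[OF tendsto_const Lim_null_comparison])
    have "norm (?E T * complex_of_real (u (T + a))) \<le> C * exp (\<omega> * a) * exp (- (Re lam - \<omega>) * T)" for T
    proof -
      have "exp (- Re lam * T) * \<bar>u (T + a)\<bar> \<le> exp (- Re lam * T) * (C * exp (\<omega> * (T + a)))"
        using u by (intro mult_left_mono) (auto simp: exp_bounded_def)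
      also have "\<dots> = C * exp (\<omega> * a) * exp (- (Re lam - \<omega>) * T)" by (simp add: mult_exp_exp algebra_simps)
      finally show ?thesis by (simp add: norm_mult)
    qed
    then show "\<forall>\<^sub>F T in at_top. norm (?E T * complex_of_real (u (T + a))) \<le> C * exp (\<omega> * a) * exp (- (Re lam - \<omega>) * T)"
      by (intro always_eventually allI)
    have "((\<lambda>T. C * exp (\<omega> * a) * exp (- (Re lam - \<omega>) * T)) \<longlongrightarrow> C * exp (\<omega> * a) * 0) at_top"
      using lam by (intro tendsto_intros filterlim_compose[OF exp_at_bot]
          filterlim_tendsto_neg_mult_at_bot[OF tendsto_const] filterlim_ident) auto
    then show "((\<lambda>T. C * exp (\<omega> * a) * exp (- (Re lam - \<omega>) * T)) \<longlongrightarrow> 0) at_top" by simp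
  qed
  have ev: "\<forall>\<^sub>F T in at_top. complex_of_real (u a) - ?E T * complex_of_real (u (T + a)) = (LBINT t:{0..T}. ?g t)"
    using eventually_ge_at_top[of 0] by eventually_elim (rule fin[symmetric])
  have "(LBINT t:{0..}. ?g t) = complex_of_real (u a) - 0"
    by (rule tendsto_unique[OF trivial_limit_at_top_linorder lim Lim_transform_eventually[OF lim' ev]])
  then show ?thesis using gv by simp
qed

section \<open>Point evaluations\<close>

text \<open>Point evaluations are continuous under bounded pointwise convergence, hence pairings with elements
  of \<open>NBV\<close>. This is how weak identities become pointwise ones.\<close>

lemma point_evaluation:
  fixes k :: "'n::finite"
  assumes \<theta>: "\<theta> \<in> {-1..0}"
  obtains f :: "real \<Rightarrow> real ^ 'n" where "f \<in> NBV" "\<And>y. pairing f y = fn y \<theta> $ k"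
    "\<And>w. cpairing (\<lambda>\<sigma>. cvec (f \<sigma>)) w = fn w \<theta> $ k"
proof -
  have "sigma_continuous (\<lambda>y :: (real ^ 'n) bborel. fn y \<theta> $ k)"
    unfolding sigma_continuous_def
  proof (intro conjI allI impI)
    show "linear (\<lambda>y :: (real ^ 'n) bborel. fn y \<theta> $ k)"
      by (rule linearI) (simp_all add: plus_bborel.rep_eq scaleR_bborel.rep_eq)
  qed (use \<theta> in \<open>auto intro!: tendsto_vec_nth\<close>)
  then obtain f :: "real \<Rightarrow> real ^ 'n" where f: "f \<in> NBV" "\<And>y. fn y \<theta> $ k = pairing f y"
    by (rule pairing_representation) blast
  have real: "cpairing (\<lambda>\<sigma>. cvec (f \<sigma>)) (cfn y) = complex_of_real (fn y \<theta> $ k)" for y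
  proof -
    have "scalar_stieltjes (\<lambda>\<sigma>. f \<sigma> $ j) (\<lambda>\<sigma>. complex_of_real (fn y (- \<sigma>) $ j)) =
        complex_of_real (scalar_stieltjes (\<lambda>\<sigma>. f \<sigma> $ j) (\<lambda>\<sigma>. fn y (- \<sigma>) $ j))" for j
      by (rule scalar_stieltjes_bounded_linear[OF NBV_nth[OF f(1)] bounded_borel_nth[OF bounded_borel_fn] bounded_linear_of_real])
    then show ?thesis
      unfolding cpairing_cvec[OF f(1)] f(2) pairing_eq by (simp add: fn_cfn cvec_def)
  qed
  have "cpairing (\<lambda>\<sigma>. cvec (f \<sigma>)) w = fn w \<theta> $ k" for w
  proof -
    have "cpairing (\<lambda>\<sigma>. cvec (f \<sigma>)) (cfn (re_part w) + scaleC \<i> (cfn (im_part w))) = fn w \<theta> $ k"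
      unfolding cpairing_add[OF NBV_cvec[OF f(1)]] cpairing_scaleC[OF NBV_cvec[OF f(1)]] real fn_re_part fn_im_part
      by (simp add: complex_eq_iff)
    then show ?thesis by (simp only: re_im_part)
  qed
  then show ?thesis using f by (intro that) auto
qed

section \<open>The resolvent equation\<close>

lemma set_integral_nth:
  fixes f :: "'b \<Rightarrow> 'a::euclidean_space ^ 'n"
  assumes "set_integrable M A f"
  shows "(LINT x:A|M. f x) $ i = (LINT x:A|M. f x $ i)"
  using integral_bounded_linear[OF bounded_linear_vec_nth[of i] assms[unfolded set_integrable_def]]
  by (simp add: set_lebesgue_integral_def)

lemma bounded_borel_laplace:
  assumes x: "exp_bounded C \<omega> x" and lam: "\<omega> < Re lam"
  shows "bounded_borel (\<lambda>\<sigma>. laplace lam x (- \<sigma>))"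
proof (rule bounded_borelI)
  have "laplace lam x \<in> borel_measurable borel"
    using x by (intro laplace_measurable) (simp add: exp_bounded_def)
  then show "(\<lambda>\<sigma>. laplace lam x (- \<sigma>)) \<in> borel_measurable borel"
    by (rule measurable_compose[rotated]) simp
qed (rule norm_laplace_le[OF x lam exp_shift_le])

context delay_equation
begin

text \<open>For a primitive \<open>w\<close> of \<open>v\<close> the increment \<open>w(s - \<sigma>) - w(- \<sigma>)\<close> is the integral of \<open>v(r - \<sigma>)\<close> for \<open>r\<close> from 0
  to \<open>s\<close>; Fubini exchanges this integral with the Stieltjes integral in \<open>\<sigma>\<close>.\<close>

lemma drift_of_primitive:
  assumes v: "history v" and hw: "history w"
    and prim: "\<And>t. -1 \<le> t \<Longrightarrow> w t = c + (LBINT r:{-1..t}. v r)" and s: "0 \<le> s"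
  shows "drift w s = drift w 0 + (LBINT r:{0..s}. drift v r)"
proof -
  have "drift w s $ i - drift w 0 $ i = (LBINT r:{0..s}. drift v r) $ i" for i
  proof -
    let ?sc = "\<lambda>j. scalar_stieltjes (\<lambda>\<sigma>. \<zeta> \<sigma> $ i $ j)"
    note b = bounded_borel_nth[OF history_bounded_borel]
    obtain B where B: "0 \<le> B" "\<And>r. r \<le> s \<Longrightarrow> norm (v r) \<le> B" using v by (rule historyE) blast
    have incr: "w (s - \<sigma>) $ j - w (0 - \<sigma>) $ j = (\<integral>r. indicator {0..s} r * v (r - \<sigma>) $ j \<partial>lborel)"
      if \<sigma>: "\<sigma> \<in> {0..1}" for \<sigma> j
    proof -
      have "w (s - \<sigma>) - w (- \<sigma>) = (LBINT r:{-\<sigma>..s - \<sigma>}. v r)"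
        using set_integral_Icc_split[OF history_integrable[OF v], of "-1" "-\<sigma>" "s - \<sigma>"] prim[of "s - \<sigma>"] prim[of "-\<sigma>"] \<sigma> s
        by simp
      also have "\<dots> = (LBINT r:{0..s}. v (r - \<sigma>))"
        using set_integral_shift[of "-\<sigma>" "s - \<sigma>" v "-\<sigma>"] by simp
      finally have e: "w (s - \<sigma>) - w (- \<sigma>) = (LBINT r:{0..s}. v (r - \<sigma>))" .
      have "set_integrable lborel {0..s} (\<lambda>r. v (r - \<sigma>))"
      proof (rule set_integrable_Icc_bounded)
        show "(\<lambda>r. v (r - \<sigma>)) \<in> borel_measurable borel"
          by (rule measurable_compose[OF _ v[unfolded history_def, THEN conjunct1]]) simp
        show "norm (v (r - \<sigma>)) \<le> B" if "r \<in> {0..s}" for r using that \<sigma> by (intro B(2)) auto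
      qed
      from arg_cong[OF e, of "\<lambda>x. x $ j"] set_integral_nth[OF this, of j] show ?thesis
        by (simp add: set_lebesgue_integral_def)
    qed
    have m: "case_prod (\<lambda>r \<sigma>. indicator {0..s} r * v (r - \<sigma>) $ j) \<in> borel_measurable (borel \<Otimes>\<^sub>M borel)" for j
    proof -
      have "(\<lambda>t. v t $ j) \<in> borel_measurable borel"
        using v by (intro borel_measurable_vecD) (simp add: history_def)
      from measurable_compose[OF _ this, of "\<lambda>p. fst p - snd p" "borel \<Otimes>\<^sub>M borel"]
      have "(\<lambda>p. v (fst p - snd p) $ j) \<in> borel_measurable (borel \<Otimes>\<^sub>M borel)" by simp
      then show ?thesis by (simp add: case_prod_beta')
    qed
    have w: "integrable lborel (\<lambda>r. indicator {0..s} r *\<^sub>R B)"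
      by (intro integrable_scaleR_left integrable_real_indicator) (auto simp: emeasure_lborel_Icc_eq)
    have F: "integrable lborel (\<lambda>r. ?sc j (\<lambda>\<sigma>. indicator {0..s} r * v (r - \<sigma>) $ j))"
      "(\<integral>r. ?sc j (\<lambda>\<sigma>. indicator {0..s} r * v (r - \<sigma>) $ j) \<partial>lborel) =
       ?sc j (\<lambda>\<sigma>. \<integral>r. indicator {0..s} r * v (r - \<sigma>) $ j \<partial>lborel)" for j
    proof -
      have le: "norm (indicator {0..s} r * v (r - \<sigma>) $ j) \<le> indicator {0..s} r *\<^sub>R B" if "\<sigma> \<in> {0..1}" for r \<sigma>
        using component_le_norm_cart[of "v (r - \<sigma>)" j] B(2)[of "r - \<sigma>"] that by (cases "r \<in> {0..s}") auto
      note F = scalar_stieltjes_Fubini[OF NBV_entry m w le]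
      show "integrable lborel (\<lambda>r. ?sc j (\<lambda>\<sigma>. indicator {0..s} r * v (r - \<sigma>) $ j))" by (rule F(1))
      show "(\<integral>r. ?sc j (\<lambda>\<sigma>. indicator {0..s} r * v (r - \<sigma>) $ j) \<partial>lborel) =
          ?sc j (\<lambda>\<sigma>. \<integral>r. indicator {0..s} r * v (r - \<sigma>) $ j \<partial>lborel)" by (rule F(2))
    qed
    have "drift w s $ i - drift w 0 $ i = (\<Sum>j\<in>UNIV. ?sc j (\<lambda>\<sigma>. w (s - \<sigma>) $ j - w (0 - \<sigma>) $ j))"
      unfolding drift_nth[OF hw] sum_subtractf[symmetric]
      by (intro sum.cong refl scalar_stieltjes_diff[symmetric] NBV_entry b[OF hw])
    also have "\<dots> = (\<Sum>j\<in>UNIV. ?sc j (\<lambda>\<sigma>. \<integral>r. indicator {0..s} r * v (r - \<sigma>) $ j \<partial>lborel))"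
      by (intro sum.cong refl scalar_stieltjes_cong NBV_entry incr)
    also have "\<dots> = (\<integral>r. (\<Sum>j\<in>UNIV. ?sc j (\<lambda>\<sigma>. indicator {0..s} r * v (r - \<sigma>) $ j)) \<partial>lborel)"
      by (simp add: F(2) Bochner_Integration.integral_sum[OF F(1)])
    also have "\<dots> = (LBINT r:{0..s}. drift v r $ i)"
      unfolding set_lebesgue_integral_def drift_nth[OF v]
      by (intro Bochner_Integration.integral_cong refl)
         (simp add: sigma_functional_cmult[OF sigma_functional_scalar_stieltjes(1)[OF NBV_entry] b[OF v]] sum_distrib_left)
    finally show ?thesis using set_integral_nth[OF drift_integrable[OF v]] by simp
  qed
  then have "drift w s - drift w 0 = (LBINT r:{0..s}. drift v r)" by (simp add: vec_eq_iff)
  then show ?thesis by (simp add: algebra_simps)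
qed

text \<open>The candidate \<open>w\<close>, the primitive of the solution for \<open>\<psi>'\<close>, satisfies
  \<open>w' = \<psi>'(0) + \<integral> drift v = \<psi>'(0) + drift w - drift w(0)\<close>, and \<open>drift w(0) = \<psi>'(0)\<close> is the boundary
  condition. So \<open>w\<close> solves the delay equation.\<close>

lemma delay_operator_primitive:
  assumes C: "(\<psi>, \<psi>') \<in> delay_operator \<zeta>" and t: "-1 \<le> t"
  shows "sol \<psi> t = fn \<psi> (-1) + (LBINT r:{-1..t}. sol \<psi>' r)"
proof -
  have prim: "fn \<psi> \<theta> = fn \<psi> (-1) + (LBINT \<sigma>:{-1..\<theta>}. fn \<psi>' \<sigma>)" if "\<theta> \<in> {-1..0}" for \<theta>
    using C that unfolding delay_operator_def by blast
  have bc: "fn \<psi>' 0 = rhs (\<lambda>\<sigma>. fn \<psi> (- \<sigma>))"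
    using C unfolding delay_operator_def rhs_def by blast
  note v = sol_history[of \<psi>']
  define w where "w t = initial \<psi> t + (LBINT s:{0..t}. sol \<psi>' s)" for t
  have hw: "history w"
    unfolding w_def[abs_def] using picard_history[of 0 \<psi>]
    by (intro history_add history_primitive v) (simp add: picard_def)
  have w0: "w t = fn \<psi> t" if "t \<le> 0" for t
    using that by (simp add: w_def initial_def primitive_nonpos min_def)
  have before: "(LBINT r:{-1..t}. sol \<psi>' r) = (LBINT r:{-1..t}. fn \<psi>' r)" if "t \<le> 0" for t
    by (rule set_lebesgue_integral_cong) (use that in \<open>auto simp: sol_initial\<close>)
  have wt: "w t = fn \<psi> (-1) + (LBINT r:{-1..t}. sol \<psi>' r)" if "-1 \<le> t" for t
  proof (cases "t \<le> 0")
    case True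
    then show ?thesis using prim[of t] that w0[of t] before[of t] by simp
  next
    case False
    then have "(LBINT r:{-1..t}. sol \<psi>' r) = (LBINT r:{-1..0}. fn \<psi>' r) + (LBINT r:{0..t}. sol \<psi>' r)"
      using set_integral_Icc_split[OF history_integrable[OF v], of "-1" 0 t] before[of 0] by simp
    then show ?thesis using False prim[of 0] by (simp add: w_def initial_def min_def)
  qed
  have eq: "drift w s = sol \<psi>' s" if "0 \<le> s" for s
  proof -
    have "drift w 0 = fn \<psi>' 0" unfolding drift_def bc by (rule rhs_cong) (simp add: w0)
    then show ?thesis
      using drift_of_primitive[OF v hw wt that] sol_forward[OF that, of \<psi>'] by simp
  qed
  have "w t = sol \<psi> t" for t
  proof (rule evolve_fixed_point_unique[OF hw sol_history])
    fix t
    have "evolve w t = (LBINT s:{0..t}. sol \<psi>' s)"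
      unfolding evolve_def by (rule set_lebesgue_integral_cong) (auto simp: eq)
    then show "w t - sol \<psi> t = evolve w t - evolve (sol \<psi>) t"
      using sol_eq[of \<psi> t] by (simp add: w_def)
  qed
  then show ?thesis using wt[OF t] by simp
qed

text \<open>The admissible \<open>\<omega>\<close> is arbitrary and may lie below \<open>growth\<close>; the bound comes from the weak estimate
  applied to the evaluation at 0.\<close>

lemma twin_sol_bound:
  assumes T: "twin_semigroup_with (delay_semigroup \<zeta>) M \<omega>"
  shows "\<exists>C. exp_bounded C \<omega> (\<lambda>t. sol y t $ k)"
proof -
  obtain f :: "real \<Rightarrow> real ^ 'n" where f: "f \<in> NBV" "\<And>y. pairing f y = fn y 0 $ k"
    by (rule point_evaluation[of 0 k]) auto
  \<comment> \<open>The second summand covers the initial segment, where t lies between -1 and 0.\<close>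
  let ?C = "M * norm y * total_variation f + norm y * exp \<bar>\<omega>\<bar>"
  have M: "0 \<le> M" using T by (simp add: twin_semigroup_with_def)
  then have A: "0 \<le> M * norm y * total_variation f" by (intro mult_nonneg_nonneg total_variation_nonneg f) auto
  have "\<bar>sol y t $ k\<bar> \<le> ?C * exp (\<omega> * t)" for t
  proof -
    consider "0 \<le> t" | "t < -1" | "-1 \<le> t" "t < 0" by linarith
    then show ?thesis
    proof cases
      case 1
      then have "\<bar>pairing f (delay_semigroup \<zeta> t y)\<bar> \<le> M * exp (\<omega> * t) * norm y * total_variation f"
        using T f(1) unfolding twin_semigroup_with_def by blast
      then have "\<bar>sol y t $ k\<bar> \<le> (M * norm y * total_variation f) * exp (\<omega> * t)"
        by (simp add: f(2) fn_semigroup mult_ac)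
      also have "\<dots> \<le> ?C * exp (\<omega> * t)" by (intro mult_right_mono) auto
      finally show ?thesis .
    next
      case 2
      then show ?thesis using A by (simp add: sol_initial fn_outside)
    next
      case 3
      have "\<bar>\<omega> * t\<bar> \<le> \<bar>\<omega>\<bar> * 1" unfolding abs_mult using 3 by (intro mult_left_mono) auto
      then have "1 \<le> exp \<bar>\<omega>\<bar> * exp (\<omega> * t)" by (simp add: mult_exp_exp)
      then have "norm y * 1 \<le> norm y * (exp \<bar>\<omega>\<bar> * exp (\<omega> * t))" by (rule mult_left_mono) simp
      moreover have "\<bar>sol y t $ k\<bar> \<le> norm y"
        using 3 component_le_norm_cart[of "fn y t" k] norm_fn_le[of y t] by (simp add: sol_initial)
      moreover have "norm y * (exp \<bar>\<omega>\<bar> * exp (\<omega> * t)) \<le> ?C * exp (\<omega> * t)"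
        unfolding mult.assoc[symmetric, of "norm y"] using A by (intro mult_right_mono) auto
      ultimately show ?thesis by linarith
    qed
  qed
  moreover have "(\<lambda>t. sol y t $ k) \<in> borel_measurable borel" by (rule borel_measurable_vecD[OF sol_measurable])
  ultimately show ?thesis unfolding exp_bounded_def by blast
qed

lemma laplace_operator_cfn:
  assumes R: "laplace_operator (delay_semigroup \<zeta>) lam R" and \<theta>: "\<theta> \<in> {-1..0}"
  shows "fn (R (cfn y)) \<theta> $ k = laplace lam (\<lambda>t. sol y t $ k) \<theta>"
proof -
  obtain f :: "real \<Rightarrow> real ^ 'n" where f: "f \<in> NBV" "\<And>y. pairing f y = fn y \<theta> $ k"
    "\<And>w. cpairing (\<lambda>\<sigma>. cvec (f \<sigma>)) w = fn w \<theta> $ k"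
    by (rule point_evaluation[OF \<theta>, of k]) blast
  have "cpairing (\<lambda>\<sigma>. cvec (f \<sigma>)) (R (cfn y)) =
      (LBINT t:{0..}. exp (- lam * complex_of_real t) * complex_of_real (pairing f (delay_semigroup \<zeta> t y)))"
    using R f(1) unfolding laplace_operator_def by blast
  then show ?thesis using \<theta> by (simp add: f(2,3) fn_semigroup laplace_def)
qed

text \<open>Complex linearity of \<open>R\<close> reduces its values to those on real elements, which point evaluations
  compute as Laplace transforms of solutions.\<close>

lemma resolvent_equation_iff:
  assumes R: "laplace_operator (delay_semigroup \<zeta>) lam R"
  shows "cfn y = R (scaleC lam (cfn y) - cfn z) \<longleftrightarrow>
    (\<forall>\<theta>\<in>{-1..0}. \<forall>k. complex_of_real (fn y \<theta> $ k) =
       lam * laplace lam (\<lambda>t. sol y t $ k) \<theta> - laplace lam (\<lambda>t. sol z t $ k) \<theta>)"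
proof -
  have lin: "linear R" using R by (simp add: laplace_operator_def bounded_linear.linear)
  have sc: "R (scaleC lam (cfn y)) = scaleC lam (R (cfn y))" using R by (simp add: laplace_operator_def)
  have val: "fn (R (scaleC lam (cfn y) - cfn z)) \<theta> $ k =
      lam * laplace lam (\<lambda>t. sol y t $ k) \<theta> - laplace lam (\<lambda>t. sol z t $ k) \<theta>" if "\<theta> \<in> {-1..0}" for \<theta> k
    using laplace_operator_cfn[OF R that]
    by (simp add: linear_diff[OF lin] sc minus_bborel.rep_eq fn_scaleC)
  have "cfn y = w \<longleftrightarrow> (\<forall>\<theta>\<in>{-1..0}. \<forall>k. complex_of_real (fn y \<theta> $ k) = fn w \<theta> $ k)" for w
  proof
    assume "\<forall>\<theta>\<in>{-1..0}. \<forall>k. complex_of_real (fn y \<theta> $ k) = fn w \<theta> $ k"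
    then show "cfn y = w" by (intro bborel_eqI) (simp add: fn_cfn cvec_def vec_eq_iff)
  qed (auto simp: fn_cfn cvec_def)
  then show ?thesis using val by auto
qed

lemma delay_operator_resolvent:
  assumes T: "twin_semigroup_with (delay_semigroup \<zeta>) M \<omega>" and lam: "\<omega> < Re lam"
    and C: "(\<psi>, \<psi>') \<in> delay_operator \<zeta>" and \<theta>: "\<theta> \<in> {-1..0}"
  shows "complex_of_real (fn \<psi> \<theta> $ k) =
    lam * laplace lam (\<lambda>t. sol \<psi> t $ k) \<theta> - laplace lam (\<lambda>t. sol \<psi>' t $ k) \<theta>"
proof -
  obtain A where A: "exp_bounded A \<omega> (\<lambda>t. sol \<psi> t $ k)" using twin_sol_bound[OF T] by blast
  obtain B where B: "exp_bounded B \<omega> (\<lambda>t. sol \<psi>' t $ k)" using twin_sol_bound[OF T] by blast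
  have "sol \<psi> t $ k = sol \<psi> \<theta> $ k + (LBINT s:{\<theta>..t}. sol \<psi>' s $ k)" if "\<theta> \<le> t" for t
  proof -
    note I = history_integrable[OF sol_history[of \<psi>']]
    have "sol \<psi> t = sol \<psi> \<theta> + (LBINT s:{\<theta>..t}. sol \<psi>' s)"
      using delay_operator_primitive[OF C, of t] delay_operator_primitive[OF C, of \<theta>]
        set_integral_Icc_split[OF I, of "-1" \<theta> t] \<theta> that by simp
    then show ?thesis by (simp add: set_integral_nth[OF I])
  qed
  from laplace_derivative[OF A B lam this] show ?thesis using \<theta> by (simp add: sol_initial)
qed

lemma drift_exp_bounded:
  assumes T: "twin_semigroup_with (delay_semigroup \<zeta>) M \<omega>"
  shows "\<exists>D. exp_bounded D \<omega> (\<lambda>t. drift (sol y) t $ i)"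
proof -
  have "\<forall>j. \<exists>C. exp_bounded C \<omega> (\<lambda>t. sol y t $ j)" using twin_sol_bound[OF T] by blast
  then obtain C where C: "\<And>j. exp_bounded (C j) \<omega> (\<lambda>t. sol y t $ j)" by metis
  let ?D = "\<Sum>j\<in>UNIV. total_variation (\<lambda>\<sigma>. \<zeta> \<sigma> $ i $ j) * (C j * exp \<bar>\<omega>\<bar>)"
  have "\<bar>drift (sol y) t $ i\<bar> \<le> ?D * exp (\<omega> * t)" for t
    unfolding drift_nth[OF sol_history] sum_distrib_right mult.assoc
  proof (rule order_trans[OF sum_abs sum_mono], rule scalar_stieltjes_bound[OF NBV_entry])
    fix j
    show "(\<lambda>\<sigma>. sol y (t - \<sigma>) $ j) \<in> borel_measurable borel"
      by (rule bounded_borel_measurable[OF bounded_borel_nth[OF history_bounded_borel[OF sol_history]]])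
    fix \<sigma> :: real assume \<sigma>: "\<sigma> \<in> {0..1}"
    have "\<bar>sol y (t - \<sigma>) $ j\<bar> \<le> C j * exp (\<omega> * (t - \<sigma>))" using C by (simp add: exp_bounded_def)
    also have "\<dots> = C j * (exp (\<omega> * (- \<sigma>)) * exp (\<omega> * t))" by (simp add: mult_exp_exp algebra_simps)
    also have "\<dots> \<le> C j * (exp \<bar>\<omega>\<bar> * exp (\<omega> * t))"
      using exp_shift_le[OF \<sigma>] exp_bounded_nonneg[OF C] by (intro mult_left_mono mult_right_mono) auto
    finally show "\<bar>sol y (t - \<sigma>) $ j\<bar> \<le> C j * (exp \<bar>\<omega>\<bar> * exp (\<omega> * t))" .
  qed
  moreover have "(\<lambda>t. drift (sol y) t $ i) \<in> borel_measurable borel"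
    by (rule borel_measurable_vecD[OF drift_measurable[OF sol_history]])
  ultimately show ?thesis unfolding exp_bounded_def by blast
qed

lemma laplace_drift:
  assumes T: "twin_semigroup_with (delay_semigroup \<zeta>) M \<omega>" and lam: "\<omega> < Re lam"
  shows "laplace lam (\<lambda>t. drift (sol y) t $ i) 0 =
    (\<Sum>j\<in>UNIV. scalar_stieltjes (\<lambda>\<sigma>. \<zeta> \<sigma> $ i $ j) (\<lambda>\<sigma>. laplace lam (\<lambda>t. sol y t $ j) (- \<sigma>)))"
proof -
  have "\<forall>j. \<exists>C. exp_bounded C \<omega> (\<lambda>t. sol y t $ j)" using twin_sol_bound[OF T] by blast
  then obtain C where C: "\<And>j. exp_bounded (C j) \<omega> (\<lambda>t. sol y t $ j)" by metis
  note L = scalar_stieltjes_laplace[OF NBV_entry C lam]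
  have "laplace lam (\<lambda>t. drift (sol y) t $ i) 0 =
      (LBINT t:{0..}. (\<Sum>j\<in>UNIV. exp (- lam * complex_of_real t) *
        complex_of_real (scalar_stieltjes (\<lambda>\<sigma>. \<zeta> \<sigma> $ i $ j) (\<lambda>\<sigma>. sol y (t - \<sigma>) $ j))))"
    unfolding laplace_def drift_nth[OF sol_history] by (simp add: sum_distrib_left)
  also have "\<dots> = (\<Sum>j\<in>UNIV. LBINT t:{0..}. exp (- lam * complex_of_real t) *
      complex_of_real (scalar_stieltjes (\<lambda>\<sigma>. \<zeta> \<sigma> $ i $ j) (\<lambda>\<sigma>. sol y (t - \<sigma>) $ j)))"
    using L(1) unfolding set_lebesgue_integral_def set_integrable_def
    by (subst Bochner_Integration.integral_sum[symmetric]) (simp_all add: scaleR_sum_right)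
  finally show ?thesis by (simp only: L(2))
qed

text \<open>The Laplace transform of the delay equation.\<close>

lemma laplace_sol_equation:
  assumes T: "twin_semigroup_with (delay_semigroup \<zeta>) M \<omega>" and lam: "\<omega> < Re lam"
  shows "lam * laplace lam (\<lambda>t. sol y t $ i) 0 -
      (\<Sum>j\<in>UNIV. scalar_stieltjes (\<lambda>\<sigma>. \<zeta> \<sigma> $ i $ j) (\<lambda>\<sigma>. laplace lam (\<lambda>t. sol y t $ j) (- \<sigma>))) =
    complex_of_real (fn y 0 $ i)"
proof -
  obtain A where A: "exp_bounded A \<omega> (\<lambda>t. sol y t $ i)" using twin_sol_bound[OF T] by blast
  obtain D where D: "exp_bounded D \<omega> (\<lambda>t. drift (sol y) t $ i)" using drift_exp_bounded[OF T] by blast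
  have "sol y t $ i = sol y 0 $ i + (LBINT s:{0..t}. drift (sol y) s $ i)" if "0 \<le> t" for t
    using sol_forward[OF that, of y] by (simp add: sol_initial set_integral_nth[OF drift_integrable[OF sol_history]])
  from laplace_derivative[OF A D lam this] show ?thesis
    unfolding laplace_drift[OF T lam] by (simp add: sol_initial)
qed

text \<open>Multiplication by \<open>exp(- \<lambda> \<theta>)\<close> turns the Laplace transform at \<open>\<theta>\<close> into the tail integral of a function \<open>g\<close>
  independent of \<open>\<theta>\<close>. So \<open>p(\<theta>) = exp(- \<lambda> \<theta>) y(\<theta>)\<close> is a primitive of \<open>- g\<close>, and integration by parts with
  exponent \<open>- \<lambda>\<close> recovers \<open>y = exp(\<lambda> \<theta>) p(\<theta>)\<close> as a primitive of \<open>z\<close>.\<close>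

lemma resolvent_primitive:
  assumes T: "twin_semigroup_with (delay_semigroup \<zeta>) M \<omega>" and lam: "\<omega> < Re lam"
    and res: "\<And>\<theta> k. \<theta> \<in> {-1..0} \<Longrightarrow> complex_of_real (fn y \<theta> $ k) =
      lam * laplace lam (\<lambda>t. sol y t $ k) \<theta> - laplace lam (\<lambda>t. sol z t $ k) \<theta>"
    and \<theta>: "\<theta> \<in> {-1..0}"
  shows "fn y \<theta> $ k = fn y (-1) $ k + (LBINT s:{-1..\<theta>}. fn z s $ k)"
proof -
  let ?u = "\<lambda>t. complex_of_real (sol y t $ k)" and ?v = "\<lambda>t. complex_of_real (sol z t $ k)"
  let ?E = "\<lambda>t. exp (- lam * complex_of_real t)"
  let ?g = "\<lambda>t. ?E t * (lam * ?u t - ?v t)"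
  let ?p = "\<lambda>t. ?E t * ?u t"
  obtain A where A: "exp_bounded A \<omega> (\<lambda>t. sol y t $ k)" using twin_sol_bound[OF T] by blast
  obtain B where B: "exp_bounded B \<omega> (\<lambda>t. sol z t $ k)" using twin_sol_bound[OF T] by blast
  have um: "(\<lambda>t. sol y t $ k) \<in> borel_measurable borel" and vm: "(\<lambda>t. sol z t $ k) \<in> borel_measurable borel"
    by (rule borel_measurable_vecD[OF sol_measurable])+
  have Em: "?E \<in> borel_measurable borel" by (intro borel_measurable_continuous_onI continuous_intros)
  have gm: "?g \<in> borel_measurable borel" using um vm Em by measurable
  have tail: "?p \<theta> = (LBINT s:{\<theta>..}. ?g s) \<and> set_integrable lborel {\<theta>..} ?g" if "\<theta> \<in> {-1..0}" for \<theta>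
  proof -
    let ?f = "\<lambda>t. lam * (?E t * ?u (t + \<theta>)) - ?E t * ?v (t + \<theta>)"
    have iu: "set_integrable lborel {0..} (\<lambda>t. lam * (?E t * ?u (t + \<theta>)))"
      using laplace_integrable[OF A lam, of \<theta>] by simp
    note iv = laplace_integrable[OF B lam, of \<theta>]
    define F where "F t = indicator {0..} t *\<^sub>R ?f t" for t
    define G where "G s = indicator {\<theta>..} s *\<^sub>R ?g s" for s
    have F: "integral\<^sup>L lborel F = complex_of_real (fn y \<theta> $ k)" "integrable lborel F"
      using set_integral_diff[OF iu iv] res[OF that, of k]
      by (simp_all add: F_def[abs_def] set_lebesgue_integral_def[symmetric] set_integrable_def[symmetric] laplace_def)
    have shift: "(\<lambda>t. G (\<theta> + 1 * t)) = (\<lambda>t. ?E \<theta> * F t)"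
    proof
      fix t
      have "?E (\<theta> + t) = ?E \<theta> * ?E t" by (simp add: exp_add[symmetric] algebra_simps)
      then show "G (\<theta> + 1 * t) = ?E \<theta> * F t"
        unfolding F_def G_def by (simp add: indicator_def add.commute algebra_simps)
    qed
    have Gval: "integral\<^sup>L lborel G = ?E \<theta> * complex_of_real (fn y \<theta> $ k)"
      using lborel_integral_real_affine[of 1 G \<theta>] unfolding shift by (simp add: F(1))
    have Gint: "integrable lborel G"
      using lborel_integrable_real_affine_iff[of 1 G \<theta>] unfolding shift by (simp add: F(2))
    have "(LBINT s:{\<theta>..}. ?g s) = ?E \<theta> * complex_of_real (fn y \<theta> $ k)"
      using Gval unfolding set_lebesgue_integral_def G_def[abs_def] .
    moreover have "set_integrable lborel {\<theta>..} ?g"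
      using Gint unfolding set_integrable_def G_def[abs_def] .
    ultimately have "(LBINT s:{\<theta>..}. ?g s) = ?E \<theta> * complex_of_real (fn y \<theta> $ k)"
      "set_integrable lborel {\<theta>..} ?g" by blast+
    then show ?thesis using that by (simp add: sol_initial)
  qed
  have split: "?p \<theta>' = ?p (-1) + (LBINT s:{-1..\<theta>'}. - ?g s)" if \<theta>': "\<theta>' \<in> {-1..0}" for \<theta>'
  proof -
    have "{-1..} = {-1..\<theta>'} \<union> {\<theta>'..}" using \<theta>' by auto
    moreover have "AE r in lborel. \<not> (r \<in> {-1..\<theta>'} \<and> r \<in> {\<theta>'..})"
      using AE_lborel_singleton[of \<theta>'] by eventually_elim auto
    moreover have i: "set_integrable lborel {-1..\<theta>'} ?g"
      by (rule set_integrable_subset[OF tail[of "-1", THEN conjunct2]]) auto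
    ultimately have "(LBINT s:{-1..}. ?g s) = (LBINT s:{-1..\<theta>'}. ?g s) + (LBINT s:{\<theta>'..}. ?g s)"
      using tail[OF \<theta>', THEN conjunct2] by (simp only:) (rule set_integral_Un_AE, simp_all)
    then show ?thesis
      unfolding set_integral_uminus[OF i] using tail[of "-1"] tail[OF \<theta>'] by simp
  qed
  obtain KA where KA: "\<And>s. s \<in> {-1..\<theta>} \<Longrightarrow> \<bar>sol y s $ k\<bar> \<le> KA" using A by (rule exp_bounded_on_Icc) blast
  obtain KB where KB: "\<And>s. s \<in> {-1..\<theta>} \<Longrightarrow> \<bar>sol z s $ k\<bar> \<le> KB" using B by (rule exp_bounded_on_Icc) blast
  have "bounded (?E ` {-1..\<theta>})"
    by (intro compact_imp_bounded compact_continuous_image continuous_intros) simp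
  then obtain KE where KE: "\<And>s. s \<in> {-1..\<theta>} \<Longrightarrow> norm (?E s) \<le> KE"
    unfolding bounded_iff by (metis imageI)
  have gb: "norm (- ?g s) \<le> KE * (cmod lam * KA + KB)" if "s \<in> {-1..\<theta>}" for s
  proof -
    have "norm (lam * ?u s - ?v s) \<le> norm (lam * ?u s) + norm (?v s)" by (rule norm_triangle_ineq4)
    also have "\<dots> \<le> cmod lam * KA + KB"
      using KA[OF that] KB[OF that] by (intro add_mono) (auto simp: norm_mult intro!: mult_left_mono)
    finally show ?thesis
      using KE[OF that] order_trans[OF norm_ge_zero KE[OF that]]
      unfolding norm_minus_cancel norm_mult by (intro mult_mono) auto
  qed
  \<comment> \<open>Integration by parts is now applied to p with exponent - lam, which cancels the factor in p.\<close>
  have neg: "exp (- (- lam) * complex_of_real t) * ?E t = 1" for t by (simp add: mult_exp_exp)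
  have "(\<lambda>t. exp (- (- lam) * complex_of_real t) * (- lam * ?p t - - ?g t)) = (\<lambda>t. - ?v t)"
  proof
    fix t
    have "exp (- (- lam) * complex_of_real t) * (- lam * ?p t - - ?g t) =
        (exp (- (- lam) * complex_of_real t) * ?E t) * (- ?v t)" by (simp add: algebra_simps)
    then show "exp (- (- lam) * complex_of_real t) * (- lam * ?p t - - ?g t) = - ?v t" by (simp only: neg mult_1_left)
  qed
  then have "(LBINT t:{-1..\<theta>}. - ?v t) =
      (LBINT t:{-1..\<theta>}. exp (- (- lam) * complex_of_real t) * (- lam * ?p t - - ?g t))"
    by (simp only:)
  also have "\<dots> = exp (- (- lam) * complex_of_real (-1)) * ?p (-1) - exp (- (- lam) * complex_of_real \<theta>) * ?p \<theta>"
    by (rule laplace_by_parts[OF _ _ gb]) (use \<theta> gm split in auto)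
  also have "\<dots> = ?u (-1) - ?u \<theta>" unfolding mult.assoc[symmetric] neg by simp
  finally have v: "(LBINT t:{-1..\<theta>}. - ?v t) = ?u (-1) - ?u \<theta>" .
  have "(LBINT t:{-1..\<theta>}. - ?v t) = - (LBINT t:{-1..\<theta>}. ?v t)" by (simp add: set_lebesgue_integral_def)
  also have "\<dots> = - complex_of_real (LBINT t:{-1..\<theta>}. sol z t $ k)" by (simp add: set_integral_complex_of_real)
  finally have "complex_of_real (sol y \<theta> $ k) =
      complex_of_real (sol y (-1) $ k + (LBINT t:{-1..\<theta>}. sol z t $ k))" unfolding v by (simp add: algebra_simps)
  then have "sol y \<theta> $ k = sol y (-1) $ k + (LBINT t:{-1..\<theta>}. sol z t $ k)"
    by (simp only: of_real_eq_iff)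
  moreover have "(LBINT t:{-1..\<theta>}. sol z t $ k) = (LBINT t:{-1..\<theta>}. fn z t $ k)"
    by (rule set_lebesgue_integral_cong) (use \<theta> in \<open>auto simp: sol_initial\<close>)
  ultimately show ?thesis using \<theta> by (simp add: sol_initial)
qed

text \<open>Let \<open>U\<close>, \<open>V\<close> be the Laplace transforms of the delayed solutions for \<open>y\<close> and \<open>z\<close>. The transformed
  delay equation for \<open>y\<close> and the resolvent equation at 0 give \<open>V(0) = \<integral> d\<zeta> U\<close>; the one for \<open>z\<close> gives
  \<open>z(0) = \<lambda> V(0) - \<integral> d\<zeta> V = \<integral> d\<zeta> (\<lambda> U - V)\<close>, which is \<open>\<integral> d\<zeta> y(- \<sigma>)\<close> by the resolvent equation at \<open>- \<sigma>\<close>.\<close>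

lemma resolvent_boundary_condition:
  assumes T: "twin_semigroup_with (delay_semigroup \<zeta>) M \<omega>" and lam: "\<omega> < Re lam"
    and res: "\<And>\<theta> k. \<theta> \<in> {-1..0} \<Longrightarrow> complex_of_real (fn y \<theta> $ k) =
      lam * laplace lam (\<lambda>t. sol y t $ k) \<theta> - laplace lam (\<lambda>t. sol z t $ k) \<theta>"
  shows "fn z 0 = rhs (\<lambda>\<sigma>. fn y (- \<sigma>))"
proof -
  let ?sc = "\<lambda>i j. scalar_stieltjes (\<lambda>\<sigma>. \<zeta> \<sigma> $ i $ j)"
  let ?U = "\<lambda>j \<sigma>. laplace lam (\<lambda>t. sol y t $ j) (- \<sigma>)" and ?V = "\<lambda>j \<sigma>. laplace lam (\<lambda>t. sol z t $ j) (- \<sigma>)"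
  have b: "bounded_borel (?U j)" "bounded_borel (?V j)" for j
    using twin_sol_bound[OF T, of y j] twin_sol_bound[OF T, of z j] bounded_borel_laplace lam by blast+
  have "fn z 0 $ i = rhs (\<lambda>\<sigma>. fn y (- \<sigma>)) $ i" for i
  proof -
    \<comment> \<open>Eliminate u(0) between the transformed equation for y and the resolvent equation at 0.\<close>
    have V0: "laplace lam (\<lambda>t. sol z t $ i) 0 = (\<Sum>j\<in>UNIV. ?sc i j (?U j))"
      using laplace_sol_equation[OF T lam, of y i] res[of 0 i] by simp
    have "complex_of_real (fn z 0 $ i) = lam * (\<Sum>j\<in>UNIV. ?sc i j (?U j)) - (\<Sum>j\<in>UNIV. ?sc i j (?V j))"
      using laplace_sol_equation[OF T lam, of z i] unfolding V0 by simp
    also have "\<dots> = (\<Sum>j\<in>UNIV. ?sc i j (\<lambda>\<sigma>. lam * ?U j \<sigma>) - ?sc i j (?V j))"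
      by (simp add: sum_distrib_left sum_subtractf
          scalar_stieltjes_bounded_linear[OF NBV_entry b(1) bounded_linear_mult_right])
    also have "\<dots> = (\<Sum>j\<in>UNIV. ?sc i j (\<lambda>\<sigma>. lam * ?U j \<sigma> - ?V j \<sigma>))"
      by (intro sum.cong refl scalar_stieltjes_diff[symmetric] NBV_entry b
          bounded_borel_linear[OF bounded_linear_mult_right])
    also have "\<dots> = (\<Sum>j\<in>UNIV. ?sc i j (\<lambda>\<sigma>. complex_of_real (fn y (- \<sigma>) $ j)))"
      by (intro sum.cong refl scalar_stieltjes_cong NBV_entry) (simp add: res)
    also have "\<dots> = complex_of_real (\<Sum>j\<in>UNIV. ?sc i j (\<lambda>\<sigma>. fn y (- \<sigma>) $ j))"
      by (simp add: scalar_stieltjes_bounded_linear[OF NBV_entry bounded_borel_nth[OF bounded_borel_fn] bounded_linear_of_real])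
    finally show ?thesis unfolding rhs_nth[OF bounded_borel_fn] of_real_eq_iff .
  qed
  then show ?thesis by (simp add: vec_eq_iff)
qed

lemma primitive_in_Lip:
  assumes "\<And>\<theta>. \<theta> \<in> {-1..0} \<Longrightarrow> fn y \<theta> = fn y (-1) + (LBINT \<sigma>:{-1..\<theta>}. fn z \<sigma>)"
  shows "y \<in> Lip"
proof -
  have I: "set_integrable lborel {a..b} (fn z)" for a b
    by (rule set_integrable_Icc_bounded[OF measurable_fn norm_fn_le])
  have le: "norm (fn y s - fn y t) \<le> norm z * \<bar>s - t\<bar>" if "s \<in> {-1..0}" "t \<in> {-1..0}" "s \<le> t" for s t
  proof -
    have "fn y t - fn y s = (LBINT \<sigma>:{s..t}. fn z \<sigma>)"
      using assms[OF that(1)] assms[OF that(2)] set_integral_Icc_split[OF I, of "-1" s t] that by simp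
    also have "norm \<dots> \<le> (LBINT \<sigma>. indicator {s..t} \<sigma> *\<^sub>R norm z)"
      unfolding set_lebesgue_integral_def
    proof (rule Bochner_Integration.integral_norm_bound_integral)
      show "integrable lborel (\<lambda>\<sigma>. indicator {s..t} \<sigma> *\<^sub>R norm z)"
        by (intro integrable_scaleR_left integrable_real_indicator) (auto simp: emeasure_lborel_Icc_eq)
    qed (use I norm_fn_le[of z] in \<open>auto simp: set_integrable_def indicator_def\<close>)
    also have "\<dots> = norm z * \<bar>s - t\<bar>" using that by simp
    finally show ?thesis by (simp add: norm_minus_commute)
  qed
  have "(norm z)-lipschitz_on {-1..0} (fn y)"
  proof (rule lipschitz_onI)
    show "dist (fn y s) (fn y t) \<le> norm z * dist s t" if "s \<in> {-1..0}" "t \<in> {-1..0}" for s t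
      using le[of s t] le[of t s] that by (cases "s \<le> t") (auto simp: dist_norm norm_minus_commute abs_minus_commute)
  qed simp
  then show ?thesis by (auto simp: Lip_def)
qed

lemma is_generator_delay_operator: "is_generator (delay_semigroup \<zeta>) (delay_operator \<zeta>)"
  unfolding is_generator_def
proof (intro conjI allI impI)
  show "twin_semigroup (delay_semigroup \<zeta>)"
    unfolding twin_semigroup_def using twin_semigroup_with_growth by blast
  fix M \<omega> lam R y z
  assume "twin_semigroup_with (delay_semigroup \<zeta>) M \<omega> \<and> \<omega> < Re lam \<and> laplace_operator (delay_semigroup \<zeta>) lam R"
  then have T: "twin_semigroup_with (delay_semigroup \<zeta>) M \<omega>" and lam: "\<omega> < Re lam"
    and R: "laplace_operator (delay_semigroup \<zeta>) lam R" by auto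
  show "(y, z) \<in> delay_operator \<zeta> \<longleftrightarrow> cfn y = R (scaleC lam (cfn y) - cfn z)"
    unfolding resolvent_equation_iff[OF R]
  proof
    assume "(y, z) \<in> delay_operator \<zeta>"
    then show "\<forall>\<theta>\<in>{-1..0}. \<forall>k. complex_of_real (fn y \<theta> $ k) =
        lam * laplace lam (\<lambda>t. sol y t $ k) \<theta> - laplace lam (\<lambda>t. sol z t $ k) \<theta>"
      using delay_operator_resolvent[OF T lam] by blast
  next
    assume "\<forall>\<theta>\<in>{-1..0}. \<forall>k. complex_of_real (fn y \<theta> $ k) =
        lam * laplace lam (\<lambda>t. sol y t $ k) \<theta> - laplace lam (\<lambda>t. sol z t $ k) \<theta>"
    then have res: "complex_of_real (fn y \<theta> $ k) =
        lam * laplace lam (\<lambda>t. sol y t $ k) \<theta> - laplace lam (\<lambda>t. sol z t $ k) \<theta>" if "\<theta> \<in> {-1..0}" for \<theta> k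
      using that by blast
    have I: "set_integrable lborel {-1..\<theta>} (fn z)" for \<theta>
      by (rule set_integrable_Icc_bounded[OF measurable_fn norm_fn_le])
    have prim: "fn y \<theta> = fn y (-1) + (LBINT \<sigma>:{-1..\<theta>}. fn z \<sigma>)" if "\<theta> \<in> {-1..0}" for \<theta>
      using resolvent_primitive[OF T lam res that] by (simp add: vec_eq_iff set_integral_nth[OF I])
    show "(y, z) \<in> delay_operator \<zeta>"
      unfolding delay_operator_def
      using primitive_in_Lip[OF prim] prim resolvent_boundary_condition[OF T lam res]
      unfolding rhs_def by blast
  qed
qed

end

section \<open>Lipschitz functions as primitives\<close>

lemma sigma_functional_scale:
  assumes "sigma_functional L"
  shows "sigma_functional (\<lambda>g. c * L g)"
  unfolding sigma_functional_def
proof (intro conjI allI impI)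
  fix G :: "nat \<Rightarrow> real \<Rightarrow> real" and g B
  assume "\<forall>n. G n \<in> borel_measurable borel" "g \<in> borel_measurable borel"
    "\<forall>n. \<forall>\<sigma>\<in>{0..1}. \<bar>G n \<sigma>\<bar> \<le> B" "\<forall>\<sigma>\<in>{0..1}. (\<lambda>n. G n \<sigma>) \<longlonglongrightarrow> g \<sigma>"
  then show "(\<lambda>n. c * L (G n)) \<longlonglongrightarrow> c * L g"
    by (intro tendsto_mult_left sigma_functional_tendsto[OF assms, where B = B]) auto
qed (simp_all add: sigma_functional_add[OF assms] sigma_functional_cmult[OF assms] algebra_simps)

lemma continuous_increasing_measure:
  fixes P :: "real \<Rightarrow> real"
  assumes mono: "\<And>s t. 0 \<le> s \<Longrightarrow> s \<le> t \<Longrightarrow> t \<le> 1 \<Longrightarrow> P s \<le> P t" and "0 \<le> P 0"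
    and cont: "continuous_on {0..1} P"
  obtains \<mu> where "finite_measure \<mu>" "sets \<mu> = sets (restrict_space borel {0..1})"
    "\<And>t. 0 < t \<Longrightarrow> t \<le> 1 \<Longrightarrow> measure \<mu> {0..t} = P t"
proof -
  obtain \<mu> where \<mu>: "finite_measure \<mu>" "sets \<mu> = sets (restrict_space borel {0..1})"
    "measure \<mu> {0..1} = P 1" "\<And>t. 0 < t \<Longrightarrow> t < 1 \<Longrightarrow> (P \<longlongrightarrow> measure \<mu> {0..t}) (at_right t)"
    by (rule increasing_function_measure[of P, OF mono assms(2)]) blast+
  have "measure \<mu> {0..t} = P t" if t: "0 < t" "t \<le> 1" for t
  proof (cases "t = 1")
    case False
    have "isCont P t"
      using cont t False by (intro continuous_on_interior[OF cont]) auto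
    then have "(P \<longlongrightarrow> P t) (at_right t)"
      unfolding isCont_def by (rule filterlim_mono) (auto simp: at_le)
    then show ?thesis
      using \<mu>(4)[of t] t False tendsto_unique[OF trivial_limit_at_right_real] by auto
  qed (simp add: \<mu>(3))
  with \<mu> show ?thesis by (intro that)
qed

text \<open>The functions \<open>L t + (q t - q 0)\<close> and \<open>L t - (q t - q 0)\<close> are increasing, and the measures that belong
  to them add up to \<open>2 L\<close> times Lebesgue measure, as one checks on initial segments. So the first
  measure has a density with values between 0 and \<open>2 L\<close>, from which \<open>L\<close> is subtracted.\<close>

lemma lipschitz_density:
  fixes q :: "real \<Rightarrow> real"
  assumes lip: "\<And>s t. s \<in> {0..1} \<Longrightarrow> t \<in> {0..1} \<Longrightarrow> \<bar>q s - q t\<bar> \<le> L * \<bar>s - t\<bar>" and L: "0 \<le> L"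
  obtains h where "h \<in> borel_measurable borel" "\<And>s. \<bar>h s\<bar> \<le> L"
    "\<And>t. t \<in> {0..1} \<Longrightarrow> q t = q 0 + (LBINT s:{0..t}. h s)"
proof -
  let ?P = "\<lambda>t. L * t + (q t - q 0)" and ?Q = "\<lambda>t. L * t - (q t - q 0)"
  have qc: "continuous_on {0..1} q"
    by (rule lipschitz_on_continuous_on[of L]) (use lip L in \<open>auto intro!: lipschitz_onI simp: dist_real_def\<close>)
  have mono: "?P s \<le> ?P t" "?Q s \<le> ?Q t" if "0 \<le> s" "s \<le> t" "t \<le> 1" for s t
  proof -
    have "\<bar>q s - q t\<bar> \<le> L * (t - s)" using lip[of s t] that by (simp add: abs_minus_commute)
    then show "?P s \<le> ?P t" "?Q s \<le> ?Q t" by (auto simp: abs_le_iff algebra_simps)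
  qed
  obtain \<mu> where \<mu>: "finite_measure \<mu>" "sets \<mu> = sets (restrict_space borel {0..1})"
    "\<And>t. 0 < t \<Longrightarrow> t \<le> 1 \<Longrightarrow> measure \<mu> {0..t} = ?P t"
    by (rule continuous_increasing_measure[of ?P, OF mono(1)]) (auto intro!: continuous_intros qc)
  obtain \<nu> where \<nu>: "finite_measure \<nu>" "sets \<nu> = sets (restrict_space borel {0..1})"
    "\<And>t. 0 < t \<Longrightarrow> t \<le> 1 \<Longrightarrow> measure \<nu> {0..t} = ?Q t"
    by (rule continuous_increasing_measure[of ?Q, OF mono(2)]) (auto intro!: continuous_intros qc)
  define \<kappa> where "\<kappa> = restrict_space lborel {0..1::real}"
  have \<kappa>: "finite_measure \<kappa>" "sets \<kappa> = sets (restrict_space borel {0..1})"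
    by (auto simp: \<kappa>_def space_restrict_space emeasure_restrict_space sets_restrict_space intro!: finite_measureI)
  have ind: "integral\<^sup>L m (indicator A) = measure m (A \<inter> {0..1})"
    if "sets m = sets (restrict_space borel {0..1})" for m and A :: "real set"
    using space_unit_interval[OF that] by simp
  have dom: "measure \<mu> (A \<inter> {0..1}) \<le> 2 * L * measure \<kappa> (A \<inter> {0..1})" if A: "A \<in> sets borel" for A
  proof -
    have "integral\<^sup>L \<mu> (indicator A) = 2 * L * integral\<^sup>L \<kappa> (indicator A) - integral\<^sup>L \<nu> (indicator A)"
    proof (rule sigma_functional_eqI[of "integral\<^sup>L \<mu>" "\<lambda>g. 2 * L * integral\<^sup>L \<kappa> g - integral\<^sup>L \<nu> g"])
      show "sigma_functional (integral\<^sup>L \<mu>)" by (rule sigma_functional_integral[OF \<mu>(1,2)])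
      show "sigma_functional (\<lambda>g. 2 * L * integral\<^sup>L \<kappa> g - integral\<^sup>L \<nu> g)"
        by (intro sigma_functional_difference sigma_functional_scale sigma_functional_integral \<kappa> \<nu>)
      show "bounded_borel (indicator A :: real \<Rightarrow> real)" by (rule bounded_borel_indicator[OF A])
      fix t :: real assume t: "0 < t" "t \<le> 1"
      then have "{0..t} \<inter> {0..1} = {0..t}" by auto
      moreover have "measure \<kappa> {0..t} = t"
        using t by (simp add: \<kappa>_def measure_restrict_space)
      ultimately show "integral\<^sup>L \<mu> (indicator {0..t}) = 2 * L * integral\<^sup>L \<kappa> (indicator {0..t}) - integral\<^sup>L \<nu> (indicator {0..t})"
        unfolding ind[OF \<mu>(2)] ind[OF \<nu>(2)] ind[OF \<kappa>(2)] using t by (simp add: \<mu>(3) \<nu>(3))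
    qed
    then show ?thesis unfolding ind[OF \<mu>(2)] ind[OF \<nu>(2)] ind[OF \<kappa>(2)] by simp
  qed
  define \<mu>' where "\<mu>' = distr \<mu> borel (\<lambda>x. x)"
  have id: "(\<lambda>x. x) \<in> measurable \<mu> borel" by (rule measurable_from_unit_interval[OF \<mu>(2)]) simp
  interpret \<mu>: finite_measure \<mu> by fact
  have em: "emeasure \<mu>' A = ennreal (measure \<mu> (A \<inter> {0..1}))" if "A \<in> sets borel" for A
    using that space_unit_interval[OF \<mu>(2)] unfolding \<mu>'_def
    by (subst emeasure_distr[OF id]) (auto simp: \<mu>.emeasure_eq_measure)
  have emk: "emeasure \<mu>' A \<le> ennreal (2 * L) * emeasure lborel (A \<inter> {0..1})" if "A \<in> sets borel" for A
  proof -
    have fin: "emeasure lborel (A \<inter> {0..1}) \<noteq> \<infinity>"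
      using emeasure_mono[of "A \<inter> {0..1}" "{0..1}" "lborel :: real measure"] by (auto simp: top_unique)
    have "measure \<kappa> (A \<inter> {0..1}) = measure lborel (A \<inter> {0..1})"
      by (simp add: \<kappa>_def measure_restrict_space)
    then have "measure \<mu> (A \<inter> {0..1}) \<le> 2 * L * measure lborel (A \<inter> {0..1})" using dom[OF that] by simp
    then have "emeasure \<mu>' A \<le> ennreal (2 * L * measure lborel (A \<inter> {0..1}))"
      unfolding em[OF that] by (rule ennreal_leI)
    also have "\<dots> = ennreal (2 * L) * emeasure lborel (A \<inter> {0..1})"
      using fin L by (simp add: ennreal_mult emeasure_eq_ennreal_measure)
    finally show ?thesis .
  qed
  have "absolutely_continuous lborel \<mu>'"
    unfolding absolutely_continuous_def
  proof
    fix A assume A: "A \<in> null_sets (lborel :: real measure)"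
    then have b: "A \<in> sets borel" by auto
    have "emeasure lborel (A \<inter> {0..1}) = 0"
      using A emeasure_mono[of "A \<inter> {0..1}" A "lborel :: real measure"] by (auto simp: null_sets_def)
    then have "emeasure \<mu>' A = 0" using emk[OF b] by simp
    then show "A \<in> null_sets \<mu>'" using b by (auto simp: null_sets_def \<mu>'_def)
  qed
  then obtain f where f: "f \<in> borel_measurable lborel" "density lborel f = \<mu>'"
    using sigma_finite_measure.Radon_Nikodym[OF lborel.sigma_finite_measure_axioms, of \<mu>'] by (auto simp: \<mu>'_def)
  have fA: "emeasure \<mu>' A = (\<integral>\<^sup>+x. f x * indicator A x \<partial>lborel)" if "A \<in> sets borel" for A
    unfolding f(2)[symmetric] using that f(1) by (simp add: emeasure_density)
  have [measurable]: "f \<in> borel_measurable borel" using f(1) by simp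
  \<comment> \<open>By domination the density has at most the integral of 2 L over this set, which is therefore null.\<close>
  define A where "A = {x \<in> {0..1}. ennreal (2 * L) < f x}"
  have Ab [measurable]: "A \<in> sets borel" unfolding A_def by measurable
  have Afin: "emeasure lborel A < \<infinity>"
  proof (rule le_less_trans)
    show "emeasure lborel A \<le> emeasure lborel {0..1::real}" by (rule emeasure_mono) (auto simp: A_def)
  qed simp
  have "A \<inter> {0..1} = A" by (auto simp: A_def)
  then have le: "(\<integral>\<^sup>+x. f x * indicator A x \<partial>lborel) \<le> (\<integral>\<^sup>+x. ennreal (2 * L) * indicator A x \<partial>lborel)"
    using emk[OF Ab] fA[OF Ab] by (simp add: nn_integral_cmult_indicator)
  have "(\<integral>\<^sup>+x. f x * indicator A x - ennreal (2 * L) * indicator A x \<partial>lborel) =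
      (\<integral>\<^sup>+x. f x * indicator A x \<partial>lborel) - (\<integral>\<^sup>+x. ennreal (2 * L) * indicator A x \<partial>lborel)"
  proof (rule nn_integral_diff)
    show "(\<integral>\<^sup>+x. ennreal (2 * L) * indicator A x \<partial>lborel) \<noteq> \<infinity>"
      using Afin by (simp add: nn_integral_cmult_indicator ennreal_mult_eq_top_iff)
    show "AE x in lborel. ennreal (2 * L) * indicator A x \<le> f x * indicator A x"
      by (intro always_eventually) (auto simp: A_def indicator_def)
  qed measurable
  also have "\<dots> = 0" by (rule diff_eq_0_ennreal[OF le_less_trans[OF le] le]) (use Afin in \<open>simp add: nn_integral_cmult_indicator ennreal_mult_less_top\<close>)
  finally have "AE x in lborel. f x * indicator A x - ennreal (2 * L) * indicator A x = 0"
    by (subst (asm) nn_integral_0_iff_AE) auto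
  then have bound: "AE x in lborel. x \<in> {0..1} \<longrightarrow> f x \<le> ennreal (2 * L)"
  proof eventually_elim
    case (elim x)
    show ?case
    proof (rule ccontr)
      assume "\<not> (x \<in> {0..1} \<longrightarrow> f x \<le> ennreal (2 * L))"
      then have x: "x \<in> A" "ennreal (2 * L) < f x" by (auto simp: A_def)
      then have "f x - ennreal (2 * L) = 0" using elim by simp
      then have "f x \<le> ennreal (2 * L)" by (simp add: diff_eq_0_iff_ennreal)
      then show False using x(2) by (simp add: leD)
    qed
  qed
  \<comment> \<open>Truncation makes the bound hold everywhere.\<close>
  define r where "r x = min (enn2real (f x)) (2 * L)" for x
  have rm [measurable]: "r \<in> borel_measurable borel" unfolding r_def[abs_def] by measurable
  have r: "0 \<le> r x" "r x \<le> 2 * L" for x using L by (auto simp: r_def)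
  have P: "?P t = (LBINT s:{0..t}. r s)" if t: "0 < t" "t \<le> 1" for t
  proof -
    have "AE x in lborel. ennreal (indicator {0..t} x *\<^sub>R r x) = f x * indicator {0..t} x"
      using bound
    proof eventually_elim
      case (elim x)
      show ?case
      proof (cases "x \<in> {0..t}")
        case True
        then have le: "f x \<le> ennreal (2 * L)" using elim t by auto
        then have "f x < top" using ennreal_less_top le_less_trans by blast
        moreover have "enn2real (f x) \<le> 2 * L" by (rule enn2real_leI[OF _ le]) (use L in simp)
        ultimately show ?thesis using True by (simp add: r_def min_def)
      qed simp
    qed
    then have "(\<integral>\<^sup>+x. ennreal (indicator {0..t} x *\<^sub>R r x) \<partial>lborel) = emeasure \<mu>' {0..t}"
      unfolding fA[of "{0..t}", simplified] by (rule nn_integral_cong_AE)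
    also have "\<dots> = ennreal (?P t)"
    proof -
      have "{0..t} \<inter> {0..1} = {0..t}" using t by auto
      then show ?thesis using t by (simp add: em \<mu>(3))
    qed
    finally have "(\<integral>\<^sup>+x. ennreal (indicator {0..t} x *\<^sub>R r x) \<partial>lborel) = ennreal (?P t)" .
    moreover have "0 \<le> ?P t" using mono(1)[of 0 t] t by simp
    ultimately show ?thesis
      unfolding set_lebesgue_integral_def
      by (subst integral_eq_nn_integral) (use r in \<open>auto simp: indicator_def\<close>)
  qed
  show ?thesis
  proof (rule that[of "\<lambda>s. r s - L"])
    show "(\<lambda>s. r s - L) \<in> borel_measurable borel" by measurable
    show "\<bar>r s - L\<bar> \<le> L" for s using r[of s] by (simp add: abs_le_iff)
    fix t :: real assume t: "t \<in> {0..1}"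
    show "q t = q 0 + (LBINT s:{0..t}. r s - L)"
    proof (cases "t = 0")
      case True
      then show ?thesis by (subst primitive_nonpos) simp_all
    next
      case False
      have "set_integrable lborel {0..t} r" "set_integrable lborel {0..t} (\<lambda>_. L)"
        by (rule set_integrable_Icc_bounded[where B = "2 * L"], use r in auto)
           (rule set_integrable_Icc_bounded[where B = L], use L in auto)
      then have "(LBINT s:{0..t}. r s - L) = (LBINT s:{0..t}. r s) - (LBINT s:{0..t}. L)" by simp
      moreover have "(LBINT s:{0..t}. L) = L * t" using t by (simp add: set_lebesgue_integral_def)
      ultimately show ?thesis using P[of t] t False by simp
    qed
  qed
qed

context delay_equation
begin

text \<open>The density of \<open>\<psi>\<close> may be changed at the single point 0 without changing its primitive; there it is
  given the value that the boundary condition prescribes.\<close>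

lemma Lip_in_Domain:
  assumes \<psi>: "\<psi> \<in> Lip"
  shows "\<psi> \<in> Domain (delay_operator \<zeta>)"
proof -
  obtain L where L: "L-lipschitz_on {-1..0} (fn \<psi>)" using \<psi> by (auto simp: Lip_def)
  have L0: "0 \<le> L" using L by (rule lipschitz_on_nonneg)
  have "\<exists>h. h \<in> borel_measurable borel \<and> (\<forall>s. \<bar>h s\<bar> \<le> L) \<and>
      (\<forall>t\<in>{0..1}. fn \<psi> (t - 1) $ k = fn \<psi> (0 - 1) $ k + (LBINT s:{0..t}. h s))" for k
  proof (rule lipschitz_density[of "\<lambda>t. fn \<psi> (t - 1) $ k" L])
    fix s t :: real assume "s \<in> {0..1}" "t \<in> {0..1}"
    then have "norm (fn \<psi> (s - 1) - fn \<psi> (t - 1)) \<le> L * \<bar>s - t\<bar>"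
      using lipschitz_onD[OF L, of "s - 1" "t - 1"] by (simp add: dist_norm dist_real_def)
    then show "\<bar>fn \<psi> (s - 1) $ k - fn \<psi> (t - 1) $ k\<bar> \<le> L * \<bar>s - t\<bar>"
      using component_le_norm_cart[of "fn \<psi> (s - 1) - fn \<psi> (t - 1)" k] by simp
  qed (use L0 in auto)
  then obtain h where h: "\<And>k. h k \<in> borel_measurable borel" "\<And>k s. \<bar>h k s\<bar> \<le> L"
    "\<And>k t. t \<in> {0..1} \<Longrightarrow> fn \<psi> (t - 1) $ k = fn \<psi> (-1) $ k + (LBINT s:{0..t}. h k s)"
    by (simp add: choice_iff) (metis atLeastAtMost_iff)
  define g where "g \<theta> = (if \<theta> = 0 then rhs (\<lambda>\<sigma>. fn \<psi> (- \<sigma>)) else \<chi> k. h k (\<theta> + 1))" for \<theta>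
  have hm [measurable]: "(\<lambda>\<theta>. \<chi> k. h k (\<theta> + 1)) \<in> borel_measurable borel"
  proof (rule borel_measurable_vecI)
    show "(\<lambda>\<theta>. (\<chi> k. h k (\<theta> + 1)) $ i) \<in> borel_measurable borel" for i
      using measurable_compose[OF _ h(1)[of i], of "\<lambda>\<theta>. \<theta> + 1" borel] by simp
  qed
  have gm: "g \<in> borel_measurable borel" unfolding g_def[abs_def] by measurable
  have gb: "norm (g \<theta>) \<le> norm (rhs (\<lambda>\<sigma>. fn \<psi> (- \<sigma>))) + CARD('n) * L" for \<theta>
  proof -
    have "norm (\<chi> k. h k (\<theta> + 1)) \<le> (\<Sum>k\<in>(UNIV :: 'n set). L)"
      by (rule order_trans[OF norm_le_l1_cart sum_mono]) (simp add: h(2))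
    then show ?thesis using L0 by (auto simp: g_def intro: add_nonneg_nonneg add_increasing)
  qed
  have fg: "fn (bborel_of g) = (\<lambda>\<theta>. if \<theta> \<in> {-1..0} then g \<theta> else 0)"
    by (rule fn_bborel_of[OF measurable_restrict_space1[OF gm]])
       (auto intro!: boundedI[of _ "norm (rhs (\<lambda>\<sigma>. fn \<psi> (- \<sigma>))) + CARD('n) * L"] gb)
  have "fn \<psi> \<theta> = fn \<psi> (-1) + (LBINT \<sigma>:{-1..\<theta>}. fn (bborel_of g) \<sigma>)" if \<theta>: "\<theta> \<in> {-1..0}" for \<theta>
  proof -
    have I: "set_integrable lborel {-1..\<theta>} (fn (bborel_of g))"
      by (rule set_integrable_Icc_bounded[OF measurable_fn norm_fn_le])
    have "(LBINT \<sigma>:{-1..\<theta>}. fn (bborel_of g) \<sigma> $ k) = (LBINT s:{0..\<theta> + 1}. h k s)" for k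
    proof -
      have ae: "AE \<sigma> in lborel. indicator {-1..\<theta>} \<sigma> *\<^sub>R fn (bborel_of g) \<sigma> $ k = indicator {-1..\<theta>} \<sigma> *\<^sub>R h k (\<sigma> + 1)"
        using AE_lborel_singleton[of 0] by eventually_elim (use \<theta> in \<open>auto simp: fg g_def indicator_def\<close>)
      have fk: "(\<lambda>\<sigma>. fn (bborel_of g) \<sigma> $ k) \<in> borel_measurable borel"
        by (rule borel_measurable_vecD[OF measurable_fn])
      have hk: "(\<lambda>\<sigma>. h k (\<sigma> + 1)) \<in> borel_measurable borel"
        using measurable_compose[OF _ h(1)[of k], of "\<lambda>\<theta>. \<theta> + 1" borel] by simp
      have "(LBINT \<sigma>:{-1..\<theta>}. fn (bborel_of g) \<sigma> $ k) = (LBINT \<sigma>:{-1..\<theta>}. h k (\<sigma> + 1))"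
        unfolding set_lebesgue_integral_def
        by (rule integral_cong_AE[OF _ _ ae]) (use hk fk in measurable)
      then show ?thesis using set_integral_shift[of 0 "\<theta> + 1" "h k" 1] by simp
    qed
    then show ?thesis
      using h(3)[of "\<theta> + 1"] \<theta> by (simp add: vec_eq_iff set_integral_nth[OF I])
  qed
  moreover have "fn (bborel_of g) 0 = rhs (\<lambda>\<sigma>. fn \<psi> (- \<sigma>))" by (simp add: fg g_def)
  ultimately have "(\<psi>, bborel_of g) \<in> delay_operator \<zeta>"
    using \<psi> unfolding delay_operator_def rhs_def by blast
  then show ?thesis by blast
qed

end

section \<open>The generator of the delay semigroup and its domain\<close>

theorem theorem4p5:
  fixes \<zeta> :: "real \<Rightarrow> real ^ 'n ^ 'n"
  assumes "\<zeta> \<in> NBV"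
  shows "is_generator (delay_semigroup \<zeta>) (delay_operator \<zeta>) \<and>
         Domain (delay_operator \<zeta>) = Lip"
proof -
  interpret delay_equation \<zeta> by unfold_locales (rule assms)
  have "Domain (delay_operator \<zeta>) \<subseteq> Lip" by (auto simp: delay_operator_def)
  then show ?thesis using is_generator_delay_operator Lip_in_Domain by blast
qed

end
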